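(* Fix an integer $r\ge 3$ and let $w=n^\alpha$ (an integer, up to rounding) for some fixed $\alpha\in\left(\frac12,1\right)$. Let $N=\binom{n}{w}$ and $$D=\sum_{s=0}^{w-1}\frac{w!\,(n-w)!}{(r-1)!\,s!\,[(w-s)!]^{r}\,[n-rw+(r-1)s]!}.$$ Then, asymptotically almost surely as $n\to\infty$, the $r$-sunflower-free process run on a universe of size $n$ produces a $w$-uniform $r$-sunflower-free family of size $$\Omega\left((w^2/n)^{\frac{1}{r-1}}\,N D^{-\frac{1}{r-1}}\right).$$
   Context: An $r$-sunflower is a collection of $r$ (distinct) sets such that the intersection of any two sets in the collection is identical (the common intersection, possibly empty, is called the kernel). A family of sets is $r$-sunflower-free if it contains no $r$-sunflower. A family is $w$-uniform if all its sets have size $w$. The $r$-sunflower-free process on a universe $U$ of $n$ points: start with the empty family; at each step add a $w$-subset of $U$ chosen uniformly at random from all $w$-subsets not yet in the family whose addition does not create an $r$-sunflower with previously chosen sets; stop when no such $w$-subset exists. The output is the final family. $D$ is the number of $r$-sunflowers consisting of $w$-subsets of $U$ that contain a given $w$-subset. "Asymptotically almost surely" means with probability tending to $1$ as $n\to\infty$; $r$ and $\alpha$ are fixed, and the implicit constant may depend on them. *)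

theory Defs
  imports "HOL-Probability.Probability"
begin

definition is_sunflower :: "nat \<Rightarrow> 'a set set \<Rightarrow> bool" where
  "is_sunflower r F \<longleftrightarrow>
     finite F \<and> card F = r \<and> (\<exists>K. \<forall>A\<in>F. \<forall>B\<in>F. A \<noteq> B \<longrightarrow> A \<inter> B = K)"

definition sunflower_free :: "nat \<Rightarrow> 'a set set \<Rightarrow> bool" where
  "sunflower_free r H \<longleftrightarrow> \<not> (\<exists>F. F \<subseteq> H \<and> is_sunflower r F)"

definition uniform_subsets :: "'a set \<Rightarrow> nat \<Rightarrow> 'a set set" where
  "uniform_subsets U w = {S. S \<subseteq> U \<and> card S = w}"

definition available :: "nat \<Rightarrow> 'a set \<Rightarrow> nat \<Rightarrow> 'a set set \<Rightarrow> 'a set set" where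
  "available r U w H =
     {S \<in> uniform_subsets U w. S \<notin> H \<and> sunflower_free r (insert S H)}"

definition process_step :: "nat \<Rightarrow> 'a set \<Rightarrow> nat \<Rightarrow> 'a set set \<Rightarrow> 'a set set pmf" where
  "process_step r U w H =
     (if available r U w H = {} then return_pmf H
      else map_pmf (\<lambda>S. insert S H) (pmf_of_set (available r U w H)))"

primrec process_run :: "nat \<Rightarrow> 'a set \<Rightarrow> nat \<Rightarrow> nat \<Rightarrow> 'a set set pmf" where
  "process_run r U w 0 = return_pmf {}"
| "process_run r U w (Suc k) = bind_pmf (process_run r U w k) (process_step r U w)"

text \<open>
  A stopped run stays where it is, and every step before stopping adds a new set, so for finite
  \<open>U\<close> the state after \<open>card U choose w\<close> steps is the final family (see
  \<open>available_sunflower_free_process\<close> below).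
\<close>
definition sunflower_free_process :: "nat \<Rightarrow> 'a set \<Rightarrow> nat \<Rightarrow> 'a set set pmf" where
  "sunflower_free_process r U w = process_run r U w (card U choose w)"

text \<open>
  Summands with \<open>n - r w + (r - 1) s < 0\<close> count nothing (the petals do not fit into the universe)
  and are set to 0; the guard also ensures that the subtractions of naturals do not truncate.
\<close>
definition sunflower_degree :: "nat \<Rightarrow> nat \<Rightarrow> nat \<Rightarrow> real" where
  "sunflower_degree r n w =
     (\<Sum>s<w. if r * w \<le> n + (r - 1) * s
            then fact w * fact (n - w) /
                 (fact (r - 1) * fact s * fact (w - s) ^ r * fact (n + (r - 1) * s - r * w))
            else 0)"

lemma finite_uniform_subsets: "finite U \<Longrightarrow> finite (uniform_subsets U w)"
  unfolding uniform_subsets_def by simp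

lemma card_uniform_subsets: "finite U \<Longrightarrow> card (uniform_subsets U w) = card U choose w"
  unfolding uniform_subsets_def by (rule n_subsets)

lemma finite_available: "finite U \<Longrightarrow> finite (available r U w H)"
  unfolding available_def by (simp add: finite_uniform_subsets)

lemma process_run_support:
  assumes "finite U" "r > 0" "H \<in> set_pmf (process_run r U w k)"
  shows "H \<subseteq> uniform_subsets U w \<and> sunflower_free r H \<and> (available r U w H = {} \<or> card H = k)"
  using assms(3)
proof (induction k arbitrary: H)
  case 0
  then show ?case using assms(2) by (auto simp: sunflower_free_def is_sunflower_def)
next
  case (Suc k)
  then obtain G where G: "G \<in> set_pmf (process_run r U w k)"
    and H: "H \<in> set_pmf (process_step r U w G)" by auto
  note IH = Suc.IH[OF G]
  show ?case
  proof (cases "available r U w G = {}")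
    case True
    then show ?thesis using H IH by (simp add: process_step_def)
  next
    case False
    then obtain S where S: "S \<in> available r U w G" "H = insert S G"
      using H finite_available[OF assms(1)] by (auto simp: process_step_def)
    have "finite G" using IH finite_uniform_subsets[OF assms(1)] finite_subset by blast
    then show ?thesis using S IH False by (auto simp: available_def)
  qed
qed

lemma
  assumes "finite U" "r > 0" "H \<in> set_pmf (sunflower_free_process r U w)"
  shows sunflower_free_process_uniform: "H \<subseteq> uniform_subsets U w"
    and sunflower_free_process_free: "sunflower_free r H"
    and available_sunflower_free_process: "available r U w H = {}"
proof -
  note * = process_run_support[OF assms(1,2) assms(3)[unfolded sunflower_free_process_def]]
  show "H \<subseteq> uniform_subsets U w" "sunflower_free r H" using * by auto
  show "available r U w H = {}"
  proof (rule ccontr)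
    assume "available r U w H \<noteq> {}"
    with * have "card H = card (uniform_subsets U w)"
      by (simp add: card_uniform_subsets assms(1))
    with * have "H = uniform_subsets U w"
      using card_subset_eq finite_uniform_subsets[OF assms(1)] by blast
    with \<open>available r U w H \<noteq> {}\<close> show False by (auto simp: available_def)
  qed
qed

end

theory Submission
  imports Defs "HOL-Real_Asymp.Real_Asymp"
begin

text \<open>
  Put \<open>\<mu> = w\<^sup>2 / n\<close>. Two random \<open>w\<close>-sets are disjoint with probability about \<open>exp (- \<mu>)\<close>, so \<open>r\<close> random
  sets form a sunflower with probability \<open>exp (- (r choose 2) \<mu>)\<close> up to a factor \<open>exp (o(\<mu>))\<close>, and the
  number \<open>T\<close> of steps to be survived is about \<open>exp (r \<mu> / 2)\<close>. On the other hand a random set meets a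
  given one in a positive fraction of its points with probability less than \<open>exp (- K w)\<close> for every
  \<open>K\<close>, which is negligible compared with every \<open>exp (O(\<mu>))\<close>.

  Let \<open>C\<close> be a sunflower with kernel \<open>K\<close> and fewer than \<open>r\<close> members, and let \<open>E\<close> be the family of sets
  extending it to a larger sunflower with kernel \<open>K\<close>. The proportion of sets in \<open>E\<close> that are still
  available is tracked for all such \<open>C\<close> at once. If it is the same number \<open>q\<close> for all of them, then an
  available set \<open>y\<close> is closed in the next step with probability \<open>W(y) / N\<close>, where \<open>W(y)\<close> is the number
  of sets completing \<open>y\<close> and \<open>r - 2\<close> chosen sets to a sunflower, available or not. The growth of \<open>W(y)\<close>
  is governed by the same proportions, so it follows a deterministic path which does not depend on
  \<open>y\<close>. Hence all proportions decay alike, down to \<open>exp (- c \<mu>)\<close> with a small constant \<open>c\<close>, and relative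
  errors are amplified by at most \<open>exp (O(c \<mu>))\<close>. One step changes a tracked quantity by a relative
  amount of at most about \<open>exp (- \<mu> / 2)\<close>, and exponential potentials survive a union bound over all
  tests.
\<close>

section \<open>Pessimistic estimators for the process\<close>

text \<open>The factor \<open>(w ^ 2 / n) powr (1 / (r - 1))\<close> reflects how long errors stay
  under control. Relative errors grow by \<open>exp (O(L))\<close> with
  \<open>L = D * (T / N) ^ (r - 1)\<close>, so \<open>L\<close> may reach a small multiple of \<mu>;
  solving \<open>L = c * \<mu>\<close> for \<open>T\<close> gives the claimed size.

  A single slack \<open>x = exp (\<delta> * \<mu>)\<close>, with a small constant \<delta>,
  organises the estimates. Tolerances start at \<open>1 / x ^ 2\<close> and end at most at
  \<open>1 / x\<close>; one step moves a normalised proportion or completion count by at most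
  \<open>1 / x ^ 5\<close>; the exponential weight \<open>x ^ 3\<close> then makes every initial
  potential at most \<open>exp (- x)\<close>. There are \<open>2 ^ O(n)\<close> tests, and
  eventually \<open>x \<ge> n ^ 2\<close> because \<mu> is a positive power of \<open>n\<close>;
  this is where \<alpha> > 1/2 enters.

  Kernels in the main terms have size at most \<kappa>, a small constant multiple of
  \<open>w\<close>. The restriction can only decrease the degree, which enters the bound with a
  negative exponent. The threshold \<open>2 * \<kappa>\<close> arises because two sets may share a
  kernel of up to \<kappa> points and up to \<kappa> further ones.\<close>

lemma finite_set_pmf_process_step:
  assumes "finite U"
  shows "finite (set_pmf (process_step r U w H))"
  using finite_available[OF assms, of r w H] by (auto simp: process_step_def)

lemma finite_set_pmf_process_run:
  assumes "finite U"
  shows "finite (set_pmf (process_run r U w k))"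
  by (induction k) (auto simp: finite_set_pmf_process_step[OF assms])

lemma expectation_process_step:
  fixes f :: "'a set set \<Rightarrow> real"
  assumes "finite U" "available r U w H \<noteq> {}"
  shows "measure_pmf.expectation (process_step r U w H) f =
    (\<Sum>A\<in>available r U w H. f (insert A H)) / real (card (available r U w H))"
  using assms finite_available[OF assms(1), of r w H]
  by (simp add: process_step_def integral_pmf_of_set)

lemma expectation_process_run_Suc:
  fixes f :: "'a set set \<Rightarrow> real"
  assumes "finite U"
  shows "measure_pmf.expectation (process_run r U w (Suc k)) f =
    measure_pmf.expectation (process_run r U w k)
      (\<lambda>H. measure_pmf.expectation (process_step r U w H) f)"
proof -
  have "measure_pmf.expectation (process_run r U w (Suc k)) f =
      (\<Sum>H\<in>set_pmf (process_run r U w k). pmf (process_run r U w k) H *\<^sub>R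
        measure_pmf.expectation (process_step r U w H) f)"
    unfolding process_run.simps
    by (rule pmf_expectation_bind)
      (auto intro: finite_set_pmf_process_run finite_set_pmf_process_step assms)
  also have "\<dots> = measure_pmf.expectation (process_run r U w k)
      (\<lambda>H. measure_pmf.expectation (process_step r U w H) f)"
    by (rule integral_measure_pmf[symmetric]) (auto intro: finite_set_pmf_process_run assms)
  finally show ?thesis .
qed

text \<open>
  Truncating the potential at 1 makes it a supermartingale along the whole run: nothing has to be
  known about the process once the potential has exceeded 1.
\<close>
lemma potential_bound:
  fixes \<Phi> :: "nat \<Rightarrow> 'a set set \<Rightarrow> real"
  assumes U: "finite U"
    and step: "\<And>i H. i < T \<Longrightarrow> \<Phi> i H < 1 \<Longrightarrow>
      measure_pmf.expectation (process_step r U w H) (\<Phi> (Suc i)) \<le> \<Phi> i H"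
  shows "measure_pmf.expectation (process_run r U w T) (\<lambda>H. min 1 (\<Phi> T H)) \<le> \<Phi> 0 {}"
proof -
  have "k \<le> T \<Longrightarrow> measure_pmf.expectation (process_run r U w k) (\<lambda>H. min 1 (\<Phi> k H)) \<le> \<Phi> 0 {}" for k
  proof (induction k)
    case (Suc k)
    have int: "integrable (measure_pmf (process_step r U w H)) (g :: _ \<Rightarrow> real)" for g H
      by (rule integrable_measure_pmf_finite) (rule finite_set_pmf_process_step[OF U])
    have "measure_pmf.expectation (process_step r U w H) (\<lambda>H. min 1 (\<Phi> (Suc k) H)) \<le> min 1 (\<Phi> k H)" for H
    proof -
      have "measure_pmf.expectation (process_step r U w H) (\<lambda>H. min 1 (\<Phi> (Suc k) H))
          \<le> measure_pmf.expectation (process_step r U w H) (\<lambda>H. 1)"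
        by (rule integral_mono[OF int int]) auto
      moreover have "measure_pmf.expectation (process_step r U w H) (\<lambda>H. min 1 (\<Phi> (Suc k) H))
          \<le> measure_pmf.expectation (process_step r U w H) (\<Phi> (Suc k))"
        by (rule integral_mono[OF int int]) auto
      ultimately show ?thesis
        using step[of k H] Suc.prems by (cases "\<Phi> k H < 1") auto
    qed
    then have "measure_pmf.expectation (process_run r U w (Suc k)) (\<lambda>H. min 1 (\<Phi> (Suc k) H))
        \<le> measure_pmf.expectation (process_run r U w k) (\<lambda>H. min 1 (\<Phi> k H))"
      unfolding expectation_process_run_Suc[OF U]
      by (intro integral_mono integrable_measure_pmf_finite finite_set_pmf_process_run[OF U])
    with Suc show ?case by simp
  qed simp
  then show ?thesis by simp
qed

text \<open>The potential controls the first \<open>T\<close> steps only, whereas the output is the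
  state after \<open>card U choose w\<close> steps; a step never removes a set, so a lower bound on
  the size persists.\<close>

lemma process_run_mono:
  assumes "finite U" "k \<le> l"
  shows "measure_pmf.prob (process_run r U w k) {H. finite H \<and> t \<le> card H}
    \<le> measure_pmf.prob (process_run r U w l) {H. finite H \<and> t \<le> card H}"
  using assms(2)
proof (induction l rule: dec_induct)
  case (step l)
  let ?P = "{H. finite H \<and> t \<le> card H}"
  have "measure_pmf.prob (process_run r U w l) ?P
      = measure_pmf.expectation (process_run r U w l) (indicator ?P)" by simp
  also have "\<dots> \<le> measure_pmf.expectation (process_run r U w l)
      (\<lambda>H. measure_pmf.expectation (process_step r U w H) (indicator ?P))"
  proof (intro integral_mono integrable_measure_pmf_finite finite_set_pmf_process_run assms)
    fix H :: "'a set set"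
    show "(indicator ?P H :: real) \<le> measure_pmf.expectation (process_step r U w H) (indicator ?P)"
    proof (cases "H \<in> ?P")
      case True
      have "set_pmf (process_step r U w H) \<subseteq> ?P"
        using True finite_available[OF assms(1), of r w H] card_insert_le[of H]
        by (auto simp: process_step_def intro: order_trans)
      then have "measure_pmf.prob (process_step r U w H) ?P = 1"
        by (intro measure_pmf.prob_eq_1[THEN iffD2]) (auto simp: AE_measure_pmf_iff)
      then show ?thesis by (simp add: indicator_def)
    qed simp
  qed
  also have "\<dots> = measure_pmf.prob (process_run r U w (Suc l)) ?P"
    by (subst expectation_process_run_Suc[OF assms(1), symmetric]) simp
  finally show ?case using step.IH by linarith
qed simp

lemma potential_card_bound:
  fixes \<Phi> :: "nat \<Rightarrow> 'a set set \<Rightarrow> real"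
  assumes U: "finite U" and r: "r > 0"
    and step: "\<And>i H. i < T \<Longrightarrow> \<Phi> i H < 1 \<Longrightarrow>
      measure_pmf.expectation (process_step r U w H) (\<Phi> (Suc i)) \<le> \<Phi> i H"
    and nonneg: "\<And>H. \<Phi> T H \<ge> 0"
    and final: "\<And>H. \<Phi> T H < 1 \<Longrightarrow> card H = T"
    and small: "\<Phi> 0 {} < 1"
  shows "measure_pmf.prob (sunflower_free_process r U w) {H. T \<le> card H} \<ge> 1 - \<Phi> 0 {}"
proof -
  let ?P = "{H. finite H \<and> T \<le> card H}"
  have supp: "H \<subseteq> uniform_subsets U w" if "H \<in> set_pmf (process_run r U w k)" for H k
    using process_run_support[OF U r that] by simp
  have fin: "finite H" if "H \<in> set_pmf (process_run r U w k)" for H k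
    using supp[OF that] finite_uniform_subsets[OF U] finite_subset by blast
  have "measure_pmf.prob (process_run r U w T) (- ?P) = measure_pmf.expectation (process_run r U w T) (indicator (- ?P))"
    by simp
  also have "\<dots> \<le> measure_pmf.expectation (process_run r U w T) (\<lambda>H. min 1 (\<Phi> T H))"
  proof (rule integral_mono_AE)
    show "AE H in measure_pmf (process_run r U w T). (indicator (- ?P) H :: real) \<le> min 1 (\<Phi> T H)"
      using final nonneg fin by (force simp: AE_measure_pmf_iff indicator_def min_def not_le)
  qed (intro integrable_measure_pmf_finite finite_set_pmf_process_run[OF U])+
  also have "\<dots> \<le> \<Phi> 0 {}" by (rule potential_bound[OF U]) (rule step)
  finally have comp: "measure_pmf.prob (process_run r U w T) (- ?P) \<le> \<Phi> 0 {}" .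
  then have run: "measure_pmf.prob (process_run r U w T) ?P \<ge> 1 - \<Phi> 0 {}"
    using measure_pmf.prob_compl[of ?P "process_run r U w T"] by (simp add: Compl_eq_Diff_UNIV)
  \<comment> \<open>That \<open>T \<le> card U choose w\<close> is not assumed; it follows because a
    family of at least \<open>T\<close> sets of size \<open>w\<close> occurs with positive
    probability.\<close>
  then have "measure_pmf.prob (process_run r U w T) ?P \<noteq> 0" using small by simp
  then have "set_pmf (process_run r U w T) \<inter> ?P \<noteq> {}"
    by (simp add: measure_pmf_zero_iff)
  then obtain H where H: "H \<in> set_pmf (process_run r U w T)" "T \<le> card H" by auto
  have "T \<le> card U choose w"
    using H supp[OF H(1)] card_mono[OF finite_uniform_subsets[OF U], of H w] card_uniform_subsets[OF U]
    by simp
  then have "measure_pmf.prob (sunflower_free_process r U w) ?P \<ge> 1 - \<Phi> 0 {}"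
    unfolding sunflower_free_process_def
    using process_run_mono[OF U, of T "card U choose w" r w T] run by linarith
  moreover have "measure_pmf.prob (sunflower_free_process r U w) ?P
      \<le> measure_pmf.prob (sunflower_free_process r U w) {H. T \<le> card H}"
    by (rule measure_pmf.finite_measure_mono) auto
  ultimately show ?thesis by linarith
qed

section \<open>Exponential moments of bounded nonnegative increments\<close>

lemma exp_le_quadratic:
  fixes t :: real
  assumes "t \<le> 1"
  shows "exp t \<le> 1 + t + t\<^sup>2"
proof (cases "t \<ge> 0")
  case True
  then show ?thesis using exp_bound[of t] assms by simp
next
  case False
  then have t: "t < 0" by simp
  let ?f = "\<lambda>u::real. 1 + u + u\<^sup>2 - exp u"
  have "?f 0 \<le> ?f t"
  proof (rule DERIV_nonpos_imp_nonincreasing[of t 0 ?f])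
    fix u :: real assume u: "t \<le> u" "u \<le> 0"
    have "(?f has_real_derivative (1 + 2 * u - exp u)) (at u)"
      by (auto intro!: derivative_eq_intros)
    moreover have "1 + 2 * u - exp u \<le> 0" using u exp_ge_add_one_self[of u] by linarith
    ultimately show "\<exists>y. (?f has_real_derivative y) (at u) \<and> y \<le> 0" by blast
  qed (use t in simp)
  then show ?thesis by simp
qed

text \<open>As \<open>0 \<le> d \<le> b\<close>, the second moment is at most \<open>b\<close> times
  the mean, so the quadratic term of \<open>exp_le_quadratic\<close> is charged to the mean. That
  estimate also holds for all negative arguments, so both signs of \<open>s\<close> are covered at
  once.\<close>

lemma average_exp_le:
  fixes d :: "'b \<Rightarrow> real"
  assumes "finite X" "X \<noteq> {}"
    and d: "\<And>A. A \<in> X \<Longrightarrow> 0 \<le> d A" "\<And>A. A \<in> X \<Longrightarrow> d A \<le> b"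
    and s: "\<bar>s\<bar> = \<theta>" "\<theta> * b \<le> 1"
  shows "(\<Sum>A\<in>X. exp (s * d A)) / card X
    \<le> exp (s * ((\<Sum>A\<in>X. d A) / card X) + \<theta>\<^sup>2 * b * ((\<Sum>A\<in>X. d A) / card X))"
proof -
  have card: "real (card X) > 0" using assms by (simp add: card_gt_0_iff)
  have th: "\<theta> \<ge> 0" using s by auto
  have s2: "s\<^sup>2 = \<theta>\<^sup>2" using s(1) by (metis power2_abs)
  have "exp (s * d A) \<le> 1 + (s + \<theta>\<^sup>2 * b) * d A" if "A \<in> X" for A
  proof -
    have "s * d A \<le> \<theta> * b" using d[OF that] s th by (intro mult_mono) auto
    then have "exp (s * d A) \<le> 1 + s * d A + (s * d A)\<^sup>2" using s by (intro exp_le_quadratic) simp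
    also have "(s * d A)\<^sup>2 = \<theta>\<^sup>2 * (d A * d A)" using s2 by (simp add: power_mult_distrib power2_eq_square)
    also have "\<dots> \<le> \<theta>\<^sup>2 * (b * d A)" using d[OF that] by (intro mult_left_mono mult_right_mono) auto
    finally show ?thesis by (simp add: algebra_simps)
  qed
  then have "(\<Sum>A\<in>X. exp (s * d A)) \<le> (\<Sum>A\<in>X. 1 + (s + \<theta>\<^sup>2 * b) * d A)"
    by (rule sum_mono)
  also have "\<dots> = card X + (s + \<theta>\<^sup>2 * b) * (\<Sum>A\<in>X. d A)"
    by (simp add: sum.distrib sum_distrib_left)
  finally have "(\<Sum>A\<in>X. exp (s * d A)) / card X \<le> 1 + (s + \<theta>\<^sup>2 * b) * ((\<Sum>A\<in>X. d A) / card X)"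
    using card by (simp add: field_simps)
  also have "\<dots> \<le> exp ((s + \<theta>\<^sup>2 * b) * ((\<Sum>A\<in>X. d A) / card X))" by (rule exp_ge_add_one_self)
  finally show ?thesis by (simp add: algebra_simps)
qed

section \<open>Binomial estimates\<close>

text \<open>Each absorption step multiplies by \<open>(k - l) / (m - l)\<close>, which is at most
  \<open>k / m\<close> because \<open>k \<le> m\<close>.\<close>

lemma choose_shrink_both:
  assumes "l \<le> k" "k \<le> m" "m > 0"
  shows "real ((m - l) choose (k - l)) \<le> real (m choose k) * (real k / real m) ^ l"
  using assms(1)
proof (induction l)
  case (Suc l)
  then have IH: "real ((m - l) choose (k - l)) \<le> real (m choose k) * (real k / real m) ^ l" by simp
  have pos: "m - l > 0" "k - l > 0" using Suc assms by auto
  have "(m - l) * ((m - Suc l) choose (k - Suc l)) = (k - l) * ((m - l) choose (k - l))"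
    using binomial_absorption[of "k - Suc l" "m - l"] pos by (simp add: Suc_diff_Suc)
  then have "real (m - l) * real ((m - Suc l) choose (k - Suc l)) = real (k - l) * real ((m - l) choose (k - l))"
    by (metis of_nat_mult)
  then have "real ((m - Suc l) choose (k - Suc l)) = (real (k - l) / real (m - l)) * real ((m - l) choose (k - l))"
    using pos by (simp add: field_simps)
  also have "\<dots> \<le> (real k / real m) * (real (m choose k) * (real k / real m) ^ l)"
  proof (rule mult_mono[OF _ IH])
    show "real (k - l) / real (m - l) \<le> real k / real m"
      using assms Suc.prems pos by (simp add: field_simps of_nat_diff) (metis mult.commute mult_left_mono of_nat_0_le_iff of_nat_mono)
  qed auto
  finally show ?case by (simp add: algebra_simps)
qed simp

text \<open>Removing one point from a ground set of \<open>M + 1 \<le> m\<close> points costs the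
  factor \<open>1 - k / (M + 1)\<close>, which is at most \<open>exp (- k / m)\<close>.\<close>

lemma choose_shrink_top:
  assumes "m > 0"
  shows "real ((m - b) choose k) \<le> real (m choose k) * exp (- real b * real k / real m)"
proof (induction b)
  case (Suc b)
  show ?case
  proof (cases "b < m \<and> k \<le> m - b")
    case False
    then have "k > m - Suc b \<or> (k = 0 \<and> m \<le> b)" by auto
    then show ?thesis by (auto simp: binomial_eq_0)
  next
    case True
    define M where "M = m - Suc b"
    have M: "m - b = Suc M" using True by (simp add: M_def Suc_diff_Suc)
    have "(Suc M) * (M choose k) = (Suc M - k) * (Suc M choose k)"
      using binomial_absorb_comp[of "Suc M" k] by simp
    then have "real (Suc M) * real (M choose k) = real (Suc M - k) * real (Suc M choose k)"
      by (metis of_nat_mult)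
    then have "real (M choose k) = (1 - real k / real (Suc M)) * real (Suc M choose k)"
      using True M by (simp add: field_simps of_nat_diff del: binomial_Suc_Suc)
    also have "\<dots> \<le> exp (- real k / real m) * real (Suc M choose k)"
    proof (rule mult_right_mono)
      have "real k / real m \<le> real k / real (Suc M)"
        using True assms M by (intro divide_left_mono) auto
      then have "1 - real k / real (Suc M) \<le> 1 + (- real k / real m)" by simp
      also have "\<dots> \<le> exp (- real k / real m)" by (rule exp_ge_add_one_self)
      finally show "1 - real k / real (Suc M) \<le> exp (- real k / real m)" .
    qed simp
    also have "\<dots> \<le> exp (- real k / real m) * (real (m choose k) * exp (- real b * real k / real m))"
      using Suc.IH M by (intro mult_left_mono) auto
    also have "\<dots> = real (m choose k) * exp (- real (Suc b) * real k / real m)"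
      using assms by (simp add: mult_exp_exp field_simps add_divide_distrib)
    finally show ?thesis by (simp add: M_def)
  qed
qed simp

section \<open>Counting sets with prescribed intersections\<close>

definition sunflower_with :: "'a set set \<Rightarrow> 'a set \<Rightarrow> bool" where
  "sunflower_with C K \<longleftrightarrow> (\<forall>A\<in>C. K \<subseteq> A) \<and> (\<forall>A\<in>C. \<forall>B\<in>C. A \<noteq> B \<longrightarrow> A \<inter> B = K)"

lemma sunflower_with_mono: "sunflower_with C K \<Longrightarrow> B \<subseteq> C \<Longrightarrow> sunflower_with B K"
  unfolding sunflower_with_def by blast

lemma sunflower_with_insert:
  assumes "A \<notin> C" "C \<noteq> {}"
  shows "sunflower_with (insert A C) K \<longleftrightarrow> sunflower_with C K \<and> A \<inter> \<Union>C = K"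
proof
  assume *: "sunflower_with (insert A C) K"
  then have "A \<inter> B = K" if "B \<in> C" for B
    using assms(1) that unfolding sunflower_with_def by (metis insertCI)
  then have "A \<inter> \<Union>C = K" using assms(2) by blast
  then show "sunflower_with C K \<and> A \<inter> \<Union>C = K"
    using sunflower_with_mono[OF *] by blast
next
  assume *: "sunflower_with C K \<and> A \<inter> \<Union>C = K"
  then have "A \<inter> B = K" if "B \<in> C" for B
    using that unfolding sunflower_with_def by blast
  moreover have "K \<subseteq> A" using * by blast
  ultimately show "sunflower_with (insert A C) K"
    using * unfolding sunflower_with_def by (simp add: Int_commute)
qed

text \<open>\<open>\<kappa>\<close> separates ordinary intersections from exceptionally large ones.
  Petals will have at least \<open>w - 2 * (r + 1) * \<kappa>\<close> points, and
  \<open>\<kappa>_small\<close> keeps this subtraction from truncating. \<open>U_large\<close>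
  leaves at least half of the universe outside any \<open>r - 1\<close> sets of size
  \<open>w\<close>.\<close>

locale uniform_family =
  fixes U :: "'a set" and r w \<kappa> :: nat
  assumes finite_U: "finite U"
    and r_ge_3: "3 \<le> r"
    and \<kappa>_pos: "1 \<le> \<kappa>"
    and \<kappa>_small: "2 * (r + 1) * \<kappa> \<le> w"
    and U_large: "2 * r * w \<le> card U"
begin

abbreviation "n \<equiv> card U"
abbreviation "V \<equiv> uniform_subsets U w"
abbreviation "N \<equiv> real (card V)"

text \<open>\<open>\<omega>\<close> bounds the chance that a random set with prescribed trace on at
  most \<open>r - 1\<close> sets contains one further given point. \<open>lam\<close> is a lower
  version of \<open>w ^ 2 / n\<close>: the exponent for avoiding a petal of
  \<open>w - 2 * (r + 1) * \<kappa>\<close> points with \<open>w - 4 * \<kappa>\<close> points still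
  to be placed. \<open>\<nu>\<close> is a union bound over the \<kappa>-subsets of a set, of which
  there are at most \<open>2 ^ w\<close>.\<close>

definition "\<omega> = 2 * real w / real n"
definition "lam = real (w - 4 * \<kappa>) * real (w - 2 * (r + 1) * \<kappa>) / real n"
definition "\<nu> = 2 ^ w * \<omega> ^ \<kappa>"
definition "E R K = {y \<in> V. y \<inter> R = K}"

lemma finite_V: "finite V"
  by (rule finite_uniform_subsets[OF finite_U])

lemma V_D: "A \<in> V \<Longrightarrow> A \<subseteq> U" "A \<in> V \<Longrightarrow> card A = w" "A \<in> V \<Longrightarrow> finite A"
  using finite_U finite_subset by (auto simp: uniform_subsets_def)

lemma w_ge: "8 * \<kappa> \<le> w"
proof -
  have "8 * \<kappa> \<le> 2 * (r + 1) * \<kappa>" using r_ge_3 by (intro mult_right_mono) auto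
  then show ?thesis using \<kappa>_small by linarith
qed

lemma w_pos: "w > 0" using w_ge \<kappa>_pos by linarith

lemma n_ge: "6 * w \<le> n"
proof -
  have "6 * w \<le> 2 * r * w" using r_ge_3 by (intro mult_right_mono) auto
  then show ?thesis using U_large by linarith
qed

lemma n_pos: "n > 0" using n_ge w_pos by linarith

lemma N_pos: "N > 0"
  using n_ge by (simp add: card_uniform_subsets[OF finite_U])

lemma \<omega>_bounds: "0 < \<omega>" "\<omega> \<le> 1"
  using n_ge w_pos n_pos by (auto simp: \<omega>_def field_simps)

lemma \<nu>_pos: "\<nu> > 0" using \<omega>_bounds by (simp add: \<nu>_def)

lemma lam_nonneg: "lam \<ge> 0" by (simp add: lam_def)

lemma finite_E [simp]: "finite (E R K)"
  using finite_V by (simp add: E_def)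

lemma E_empty: "E {} {} = V" by (auto simp: E_def)

lemma card_E:
  assumes "R \<subseteq> U" "K \<subseteq> R" "card K \<le> w"
  shows "card (E R K) = (n - card R) choose (w - card K)"
proof -
  have fin: "finite R" "finite K" using assms finite_U by (meson finite_subset subset_trans)+
  let ?Z = "{z. z \<subseteq> U - R \<and> card z = w - card K}"
  have disj: "z \<inter> K = {}" "finite z" if "z \<in> ?Z" for z
    using that assms finite_U by (auto intro: finite_subset)
  have "E R K = (\<lambda>z. z \<union> K) ` ?Z"
  proof (intro equalityI subsetI)
    fix y assume y: "y \<in> E R K"
    then have yU: "y \<subseteq> U" "card y = w" "y \<inter> R = K" by (auto simp: E_def uniform_subsets_def)
    have "card (y - R) = card y - card (y \<inter> R)"
      using yU finite_U finite_subset by (intro card_Diff_subset_Int) blast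
    then have "y - R \<in> ?Z" using yU by auto
    moreover have "y = (y - R) \<union> K" using yU by auto
    ultimately show "y \<in> (\<lambda>z. z \<union> K) ` ?Z" by blast
  next
    fix y assume "y \<in> (\<lambda>z. z \<union> K) ` ?Z"
    then obtain z where z: "z \<in> ?Z" "y = z \<union> K" by blast
    then have "card y = w" using disj[OF z(1)] fin assms by (simp add: card_Un_disjoint)
    then show "y \<in> E R K" using z assms by (auto simp: E_def uniform_subsets_def)
  qed
  moreover have "inj_on (\<lambda>z. z \<union> K) ?Z"
    using disj by (intro inj_onI) blast
  ultimately have "card (E R K) = card ?Z" by (simp add: card_image)
  also have "\<dots> = card (U - R) choose (w - card K)"
    using finite_U by (intro n_subsets) auto
  also have "card (U - R) = n - card R" using fin assms by (simp add: card_Diff_subset)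
  finally show ?thesis .
qed

lemma room: "card R \<le> (r - 1) * w \<Longrightarrow> n \<le> 2 * (n - card R)" "card R \<le> (r - 1) * w \<Longrightarrow> 3 * w \<le> n - card R"
proof -
  assume R: "card R \<le> (r - 1) * w"
  have "(r - 1) * w = r * w - w" by (simp add: diff_mult_distrib)
  then have 1: "2 * card R + 2 * w \<le> n" using R U_large r_ge_3 w_pos by (cases r) auto
  then show "n \<le> 2 * (n - card R)" by linarith
  then show "3 * w \<le> n - card R" using n_ge by linarith
qed

lemma E_pos:
  assumes "R \<subseteq> U" "K \<subseteq> R" "card K \<le> w" "card R \<le> (r - 1) * w"
  shows "card (E R K) > 0"
  using room(2)[OF assms(4)] by (simp add: card_E assms)

text \<open>Once the trace on \<open>R\<close> is fixed, each further point to be contained costs a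
  factor \<open>\<omega>\<close> and each point to be avoided costs
  \<open>exp (- (w - 4 * \<kappa>) / n)\<close>, because at least \<open>w - 4 * \<kappa>\<close>
  points are still to be placed. The later upper bounds on \<open>card (E R K)\<close> rest on this
  one.\<close>

lemma E_ratio:
  assumes "R \<subseteq> R2" "R2 \<subseteq> U" "K \<subseteq> R" "K2 \<subseteq> R2" "K2 \<inter> R = K" "card R \<le> (r - 1) * w" "card K2 \<le> 4 * \<kappa>"
  shows "real (card (E R2 K2)) \<le> real (card (E R K)) * \<omega> ^ card (K2 - K)
    * exp (- (real (w - 4 * \<kappa>) / real n) * real (card (R2 - R - K2)))"
proof -
  define m where "m = n - card R"
  define k where "k = w - card K"
  define l where "l = card (K2 - K)"
  define b where "b = card (R2 - R - K2)"
  have fin: "finite R2" "finite R" "finite K2" "finite K"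
    using assms finite_U by (meson finite_subset subset_trans)+
  have KK2: "K \<subseteq> K2" using assms by blast
  have cK2: "card K2 = card K + l"
    using fin KK2 by (simp add: l_def card_Diff_subset card_mono)
  have K2w: "card K2 \<le> w" using assms w_ge by linarith
  have "R2 = R \<union> ((K2 - K) \<union> (R2 - R - K2))" using assms by blast
  moreover have "R \<inter> ((K2 - K) \<union> (R2 - R - K2)) = {}" using assms by blast
  moreover have "(K2 - K) \<inter> (R2 - R - K2) = {}" by blast
  ultimately have cR2: "card R2 = card R + (l + b)"
    using fin unfolding l_def b_def by (metis card_Un_disjoint finite_Diff finite_Un)
  have m: "n \<le> 2 * m" "3 * w \<le> m" using room[OF assms(6)] by (auto simp: m_def)
  have lk: "l \<le> k" "k \<le> m" "m - l > 0" "m > 0" using K2w cK2 m w_pos by (auto simp: k_def)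
  have "card (E R2 K2) = (m - l - b) choose (k - l)"
    using assms K2w cK2 cR2 by (simp add: card_E m_def k_def add.assoc)
  then have "real (card (E R2 K2)) \<le> real ((m - l) choose (k - l)) * exp (- real b * real (k - l) / real (m - l))"
    using choose_shrink_top[OF lk(3)] by simp
  also have "\<dots> \<le> (real (m choose k) * \<omega> ^ l) * exp (- (real (w - 4 * \<kappa>) / real n) * real b)"
  proof (rule mult_mono)
    have "real k / real m \<le> \<omega>"
    proof -
      have "real k * real n \<le> real w * (2 * real m)" using m by (intro mult_mono) (auto simp: k_def)
      then show ?thesis using lk n_pos by (simp add: \<omega>_def field_simps)
    qed
    then have "real (m choose k) * (real k / real m) ^ l \<le> real (m choose k) * \<omega> ^ l"
      by (intro mult_left_mono power_mono) auto
    then show "real ((m - l) choose (k - l)) \<le> real (m choose k) * \<omega> ^ l"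
      using choose_shrink_both[OF lk(1,2,4)] by linarith
    have "real (w - 4 * \<kappa>) / real n \<le> real (k - l) / real (m - l)"
      using cK2 assms(7) lk by (intro frac_le) (auto simp: k_def m_def)
    then have "real b * (real (w - 4 * \<kappa>) / real n) \<le> real b * (real (k - l) / real (m - l))"
      by (intro mult_left_mono) auto
    then show "exp (- real b * real (k - l) / real (m - l)) \<le> exp (- (real (w - 4 * \<kappa>) / real n) * real b)"
      by (simp add: algebra_simps)
  qed (use \<omega>_bounds in auto)
  also have "real (m choose k) = real (card (E R K))"
    using assms K2w cK2 by (subst card_E) (auto simp: m_def k_def)
  finally show ?thesis by (simp add: l_def b_def)
qed

text \<open>Such a \<open>y\<close> contains one of the at most \<open>2 ^ w\<close> subsets of
  \<open>A - R\<close> with \<kappa> points, and each of these costs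
  \<open>\<omega> ^ \<kappa>\<close>.\<close>

lemma near_tail:
  assumes "A \<in> V" "R \<subseteq> U" "K \<subseteq> R" "card R \<le> (r - 1) * w" "card K \<le> 2 * \<kappa>"
  shows "real (card {y \<in> E R K. \<kappa> < card (y \<inter> A - R)}) \<le> \<nu> * real (card (E R K))"
proof -
  note A = V_D[OF assms(1)]
  define \<Z> where "\<Z> = {Z. Z \<subseteq> A - R \<and> card Z = \<kappa>}"
  have \<Z>: "finite \<Z>" "card \<Z> \<le> 2 ^ w"
  proof -
    have "\<Z> \<subseteq> Pow A" by (auto simp: \<Z>_def)
    then show "finite \<Z>" "card \<Z> \<le> 2 ^ w"
      using A card_mono[of "Pow A" \<Z>] finite_subset[of \<Z> "Pow A"] by (auto simp: card_Pow)
  qed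
  have sub: "{y \<in> E R K. \<kappa> < card (y \<inter> A - R)} \<subseteq> (\<Union>Z\<in>\<Z>. E (R \<union> Z) (K \<union> Z))"
  proof
    fix y assume y: "y \<in> {y \<in> E R K. \<kappa> < card (y \<inter> A - R)}"
    then obtain Z where "Z \<subseteq> y \<inter> A - R" "card Z = \<kappa>"
      by (metis (no_types, lifting) mem_Collect_eq less_imp_le obtain_subset_with_card_n)
    then have "Z \<in> \<Z>" "y \<in> E (R \<union> Z) (K \<union> Z)" using y by (auto simp: E_def \<Z>_def)
    then show "y \<in> (\<Union>Z\<in>\<Z>. E (R \<union> Z) (K \<union> Z))" by blast
  qed
  have each: "real (card (E (R \<union> Z) (K \<union> Z))) \<le> real (card (E R K)) * \<omega> ^ \<kappa>" if "Z \<in> \<Z>" for Z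
  proof -
    have Z: "Z \<subseteq> A - R" "card Z = \<kappa>" using that by (auto simp: \<Z>_def)
    have 1: "K \<union> Z - K = Z" "(R \<union> Z) - R - (K \<union> Z) = {}" using Z assms by auto
    have "card (K \<union> Z) \<le> 4 * \<kappa>" using card_Un_le[of K Z] Z assms(5) by linarith
    then show ?thesis
      using E_ratio[of R "R \<union> Z" K "K \<union> Z"] Z assms A unfolding 1 by auto
  qed
  have "real (card {y \<in> E R K. \<kappa> < card (y \<inter> A - R)}) \<le> real (card (\<Union>Z\<in>\<Z>. E (R \<union> Z) (K \<union> Z)))"
    using sub \<Z> by (intro of_nat_mono card_mono) auto
  also have "\<dots> \<le> (\<Sum>Z\<in>\<Z>. real (card (E (R \<union> Z) (K \<union> Z))))"
    using card_UN_le[OF \<Z>(1), of "\<lambda>Z. E (R \<union> Z) (K \<union> Z)"] by (metis of_nat_mono of_nat_sum)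
  also have "\<dots> \<le> (\<Sum>Z\<in>\<Z>. real (card (E R K)) * \<omega> ^ \<kappa>)"
    by (rule sum_mono) (rule each)
  also have "\<dots> = real (card \<Z>) * (real (card (E R K)) * \<omega> ^ \<kappa>)" by simp
  also have "\<dots> \<le> 2 ^ w * (real (card (E R K)) * \<omega> ^ \<kappa>)"
    using \<Z>(2) \<omega>_bounds by (intro mult_right_mono) (auto simp flip: of_nat_le_iff)
  finally show ?thesis by (simp add: \<nu>_def algebra_simps)
qed

lemma card_near_le:
  assumes "A \<in> V"
  shows "real (card {y \<in> V. \<kappa> < card (y \<inter> A)}) \<le> \<nu> * N"
  using near_tail[OF assms, of "{}" "{}"] by (simp add: E_empty)

lemma card_Union_sunflower:
  assumes "finite C" "C \<noteq> {}" "C \<subseteq> V" "sunflower_with C K"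
  shows "card (\<Union>C) = card K + card C * (w - card K)"
  using assms
proof (induction rule: finite_ne_induct)
  case (singleton A)
  then have "K \<subseteq> A" "A \<in> V" by (auto simp: sunflower_with_def)
  then show ?case using V_D card_mono by fastforce
next
  case (insert A C)
  have sf: "sunflower_with C K" "A \<inter> \<Union>C = K"
    using insert.prems sunflower_with_insert[OF insert.hyps(3,2)] by auto
  have A: "finite A" "card A = w"
    using insert.prems V_D by auto
  have "finite (\<Union>C)"
    using insert.hyps(1) insert.prems V_D(3) by (intro finite_Union) auto
  note A = A this
  have "card (A - \<Union>C) = w - card K"
    using sf A by (subst card_Diff_subset_Int) auto
  moreover have "card (\<Union>(insert A C)) = card (\<Union>C) + card (A - \<Union>C)"
    using A card_Un_disjoint[of "\<Union>C" "A - \<Union>C"] by (simp add: Un_commute)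
  ultimately show ?case using insert sf by simp
qed

lemma card_Union_le:
  assumes "C \<subseteq> V" "card C \<le> r - 1"
  shows "card (\<Union>C) \<le> (r - 1) * w"
proof -
  have "card (\<Union>C) \<le> (\<Sum>A\<in>C. card A)" by (rule card_Union_le_sum_card)
  also have "\<dots> = card C * w" using assms V_D(2) by (simp add: subset_iff)
  also have "\<dots> \<le> (r - 1) * w" using assms by simp
  finally show ?thesis .
qed

text \<open>The petals \<open>g - \<Union>C - K'\<close> are disjoint, and each keeps at least
  \<open>w - 2 * (r + 1) * \<kappa>\<close> points, since \<open>g\<close> loses at most
  \<open>2 * \<kappa>\<close> to every member of \<open>C\<close> and to the kernel. A set that
  extends both \<open>C\<close> and \<open>G\<close> avoids all of them. The condition
  \<open>K' \<inter> \<Union>C \<subseteq> K\<close> makes the two prescribed traces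
  compatible.\<close>

lemma ext_ratio:
  assumes C: "C \<subseteq> V" "card C \<le> r - 1" "K \<subseteq> \<Union>C" "card K \<le> 2 * \<kappa>"
    and G: "G \<subseteq> V" "sunflower_with G K'" "G \<noteq> {}" "card K' \<le> 2 * \<kappa>" "K' \<inter> \<Union>C \<subseteq> K"
    and near: "\<And>g v. g \<in> G \<Longrightarrow> v \<in> C \<Longrightarrow> card (g \<inter> v) \<le> 2 * \<kappa>"
  shows "real (card (E (\<Union>C \<union> \<Union>G) (K \<union> K'))) \<le>
    real (card (E (\<Union>C) K)) * \<omega> ^ card (K' - K) * exp (- lam * real (card G))"
proof -
  define p where "p = w - 2 * (r + 1) * \<kappa>"
  have finG: "finite G" and finC: "finite C" using assms finite_V finite_subset by blast+
  have petal: "p \<le> card (g - \<Union>C - K')" if g: "g \<in> G" for g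
  proof -
    have gV: "finite g" "card g = w" using V_D g G by auto
    have "g \<inter> \<Union>C = (\<Union>v\<in>C. g \<inter> v)" by blast
    then have "card (g \<inter> \<Union>C) \<le> (\<Sum>v\<in>C. card (g \<inter> v))"
      using card_UN_le[OF finC, of "\<lambda>v. g \<inter> v"] by (simp only:)
    also have "\<dots> \<le> (\<Sum>v\<in>C. 2 * \<kappa>)" using near[OF g] by (rule sum_mono)
    also have "\<dots> \<le> (r - 1) * (2 * \<kappa>)" using C by simp
    finally have 1: "card (g \<inter> \<Union>C) \<le> (r - 1) * (2 * \<kappa>)" .
    have "g = (g - \<Union>C - K') \<union> ((g \<inter> \<Union>C) \<union> (g \<inter> K'))" by blast
    then have "w = card ((g - \<Union>C - K') \<union> ((g \<inter> \<Union>C) \<union> (g \<inter> K')))"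
      using gV by simp
    also have "\<dots> \<le> card (g - \<Union>C - K') + (card (g \<inter> \<Union>C) + card (g \<inter> K'))"
      by (meson add_left_mono card_Un_le le_trans)
    also have "card (g \<inter> K') \<le> 2 * \<kappa>"
      using G(4) gV g G(2) by (metis Int_absorb1 sunflower_with_def)
    finally have "w \<le> card (g - \<Union>C - K') + (r - 1) * (2 * \<kappa>) + 2 * \<kappa>" using 1 by linarith
    moreover have "(r - 1) * (2 * \<kappa>) + 2 * \<kappa> \<le> 2 * (r + 1) * \<kappa>"
      using r_ge_3 by (cases r) (auto simp: algebra_simps)
    ultimately show ?thesis unfolding p_def by linarith
  qed
  have "card G * p \<le> (\<Sum>g\<in>G. card (g - \<Union>C - K'))"
    using sum_mono[of G "\<lambda>_. p" "\<lambda>g. card (g - \<Union>C - K')"] petal by simp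
  also have "\<dots> = card (\<Union>g\<in>G. g - \<Union>C - K')"
    using finG V_D(3) G(1,2) by (subst card_UN_disjoint) (auto simp: sunflower_with_def)
  also have "(\<Union>g\<in>G. g - \<Union>C - K') = (\<Union>C \<union> \<Union>G) - \<Union>C - (K \<union> K')" using C by blast
  finally have b: "card G * p \<le> card ((\<Union>C \<union> \<Union>G) - \<Union>C - (K \<union> K'))" .
  have K': "K' \<subseteq> \<Union>G" using G(2,3) unfolding sunflower_with_def by blast
  have CGU: "\<Union>C \<union> \<Union>G \<subseteq> U" using C(1) G(1) V_D(1) by blast
  have "card (K \<union> K') \<le> 4 * \<kappa>" using C G card_Un_le[of K K'] by linarith
  then have "real (card (E (\<Union>C \<union> \<Union>G) (K \<union> K'))) \<le> real (card (E (\<Union>C) K)) * \<omega> ^ card (K \<union> K' - K)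
    * exp (- (real (w - 4 * \<kappa>) / real n) * real (card ((\<Union>C \<union> \<Union>G) - \<Union>C - (K \<union> K'))))"
    using C G K' CGU card_Union_le[OF C(1,2)] by (intro E_ratio) auto
  also have "\<dots> \<le> real (card (E (\<Union>C) K)) * \<omega> ^ card (K' - K) * exp (- lam * real (card G))"
  proof (intro mult_mono)
    show "\<omega> ^ card (K \<union> K' - K) \<le> \<omega> ^ card (K' - K)" by (simp add: Un_Diff)
    have "lam * real (card G) = real (w - 4 * \<kappa>) / real n * real (card G * p)"
      by (simp add: lam_def p_def)
    also have "\<dots> \<le> real (w - 4 * \<kappa>) / real n * real (card ((\<Union>C \<union> \<Union>G) - \<Union>C - (K \<union> K')))"
      using b by (intro mult_left_mono of_nat_mono) auto
    finally show "exp (- (real (w - 4 * \<kappa>) / real n) * real (card ((\<Union>C \<union> \<Union>G) - \<Union>C - (K \<union> K'))))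
        \<le> exp (- lam * real (card G))" by simp
  qed (use \<omega>_bounds in auto)
  finally show ?thesis .
qed

lemma E_small:
  assumes "C \<subseteq> V" "card C \<le> r - 1" "sunflower_with C K" "card K \<le> 2 * \<kappa>" "C \<noteq> {}"
  shows "real (card (E (\<Union>C) K)) \<le> N * \<omega> ^ card K * exp (- lam * real (card C))"
  using ext_ratio[of "{}" "{}" C K] assms by (simp add: E_empty)

section \<open>Weighted counts of partial sunflowers\<close>

text \<open>The kernel is part of the data because a family \<open>C \<union> F\<close> with one
  member has many kernels. The bound \<open>m\<close> is \<kappa> in the main terms and
  \<open>2 * \<kappa>\<close> in the error terms.\<close>

definition ext_fam :: "'a set set \<Rightarrow> 'a set set \<Rightarrow> nat \<Rightarrow> nat \<Rightarrow> ('a set set \<times> 'a set) set" where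
  "ext_fam H C a m = {(F, K). F \<subseteq> H - C \<and> card F = a \<and> K \<subseteq> U \<and> card K \<le> m \<and> sunflower_with (C \<union> F) K}"

definition ext_sum :: "'a set set \<Rightarrow> 'a set set \<Rightarrow> nat \<Rightarrow> nat \<Rightarrow> ('a set \<Rightarrow> real) \<Rightarrow> real" where
  "ext_sum H C a m f = (\<Sum>(F, K)\<in>ext_fam H C a m. f K)"

lemma finite_ext_fam:
  assumes "finite H"
  shows "finite (ext_fam H C a m)"
proof (rule finite_subset)
  show "ext_fam H C a m \<subseteq> Pow H \<times> Pow U" by (auto simp: ext_fam_def)
qed (use assms finite_U in auto)

lemma ext_sum_nonneg: "(\<And>K. f K \<ge> 0) \<Longrightarrow> ext_sum H C a m f \<ge> 0"
  by (auto simp: ext_sum_def intro: sum_nonneg)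

text \<open>The new families are those that contain \<open>A\<close>; moving \<open>A\<close> into
  \<open>C\<close> turns them into a count with one chosen member less. The increments of both kinds
  of counts are computed in this way.\<close>

lemma ext_sum_insert:
  assumes "finite H" "A \<notin> H" "A \<notin> C"
  shows "ext_sum (insert A H) C (Suc a) m f = ext_sum H C (Suc a) m f + ext_sum H (insert A C) a m f"
proof -
  let ?g = "\<lambda>(F, K). (insert A F, K)"
  have A_notin: "A \<notin> F" if "(F, K) \<in> ext_fam H C' b m" for F K C' b
    using that assms by (auto simp: ext_fam_def)
  have split: "ext_fam (insert A H) C (Suc a) m = ext_fam H C (Suc a) m \<union> ?g ` ext_fam H (insert A C) a m"
  proof (intro equalityI subsetI)
    fix p assume p: "p \<in> ext_fam (insert A H) C (Suc a) m"
    obtain F K where FK: "p = (F, K)" by (cases p)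
    note F = p[unfolded FK ext_fam_def, simplified]
    show "p \<in> ext_fam H C (Suc a) m \<union> ?g ` ext_fam H (insert A C) a m"
    proof (cases "A \<in> F")
      case False
      then show ?thesis using F FK by (auto simp: ext_fam_def)
    next
      case True
      have "finite F" using F assms(1) by (meson finite.insertI finite_Diff finite_subset)
      then have "card (F - {A}) = a" using True F by simp
      moreover have "insert A C \<union> (F - {A}) = C \<union> F" using True by blast
      moreover have "F - {A} \<subseteq> H - insert A C" using F by blast
      ultimately have "(F - {A}, K) \<in> ext_fam H (insert A C) a m" using F by (simp add: ext_fam_def)
      moreover have "p = ?g (F - {A}, K)" using True FK by auto
      ultimately show ?thesis by blast
    qed
  next
    fix p assume "p \<in> ext_fam H C (Suc a) m \<union> ?g ` ext_fam H (insert A C) a m"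
    then show "p \<in> ext_fam (insert A H) C (Suc a) m"
    proof
      assume "p \<in> ?g ` ext_fam H (insert A C) a m"
      then obtain F K where FK: "p = (insert A F, K)" "(F, K) \<in> ext_fam H (insert A C) a m" by auto
      note F = FK(2)[unfolded ext_fam_def, simplified]
      have "finite F" using F assms(1) by (meson finite_Diff finite_subset)
      moreover have "A \<notin> F" using F assms by auto
      ultimately have "card (insert A F) = Suc a" using F by simp
      then show ?thesis using F FK(1) assms by (auto simp: ext_fam_def)
    qed (auto simp: ext_fam_def)
  qed
  have inj: "inj_on ?g (ext_fam H (insert A C) a m)"
    by (intro inj_onI) (auto dest: A_notin)
  have disj: "ext_fam H C (Suc a) m \<inter> ?g ` ext_fam H (insert A C) a m = {}"
    by (auto dest: A_notin)
  have "ext_sum (insert A H) C (Suc a) m f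
      = ext_sum H C (Suc a) m f + (\<Sum>(F, K)\<in>?g ` ext_fam H (insert A C) a m. f K)"
    unfolding ext_sum_def split
    by (rule sum.union_disjoint) (use finite_ext_fam[OF assms(1)] disj in auto)
  also have "(\<Sum>(F, K)\<in>?g ` ext_fam H (insert A C) a m. f K) = ext_sum H (insert A C) a m f"
    unfolding ext_sum_def by (subst sum.reindex[OF inj]) (auto intro!: sum.cong)
  finally show ?thesis .
qed

lemma ext_sum_insert_in: "A \<in> C \<Longrightarrow> ext_sum (insert A H) C a m f = ext_sum H C a m f"
  by (simp add: ext_sum_def ext_fam_def insert_Diff_if)

lemma ext_fam_insert:
  assumes "A \<notin> H" "A \<notin> C" "C \<noteq> {}"
  shows "ext_fam H (insert A C) a m = {p \<in> ext_fam H C a m. A \<inter> \<Union>(C \<union> fst p) = snd p}"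
proof -
  have "sunflower_with (insert A C \<union> F) K \<longleftrightarrow> sunflower_with (C \<union> F) K \<and> A \<inter> \<Union>(C \<union> F) = K"
    if "F \<subseteq> H" for F K
    using sunflower_with_insert[of A "C \<union> F" K] assms that by auto
  moreover have "H - insert A C = H - C" using assms by auto
  ultimately have "(F, K) \<in> ext_fam H (insert A C) a m \<longleftrightarrow>
      (F, K) \<in> ext_fam H C a m \<and> A \<inter> \<Union>(C \<union> F) = K" for F K
    by (cases "F \<subseteq> H") (auto simp add: ext_fam_def simp del: Un_insert_left)
  then show ?thesis by auto
qed

text \<open>Double counting: \<open>A\<close> extends \<open>(F, K)\<close> exactly when it lies in
  \<open>E (\<Union>(C \<union> F)) K\<close>. Mean increments of counts thus reduce to the sizes of
  such classes within the candidates \<open>X\<close>.\<close>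

lemma sum_ext_sum_insert:
  assumes "finite H" "X \<subseteq> V" "X \<inter> (H \<union> C) = {}" "C \<noteq> {}"
  shows "(\<Sum>A\<in>X. ext_sum H (insert A C) a m f)
    = (\<Sum>(F, K)\<in>ext_fam H C a m. f K * real (card (X \<inter> E (\<Union>(C \<union> F)) K)))"
proof -
  have finX: "finite X" using assms finite_V finite_subset by blast
  have "(\<Sum>A\<in>X. ext_sum H (insert A C) a m f)
      = (\<Sum>A\<in>X. \<Sum>p\<in>{p \<in> ext_fam H C a m. A \<inter> \<Union>(C \<union> fst p) = snd p}. f (snd p))"
  proof (intro sum.cong refl)
    fix A assume "A \<in> X"
    then have "A \<notin> H" "A \<notin> C" using assms(3) by auto
    then show "ext_sum H (insert A C) a m f
        = (\<Sum>p\<in>{p \<in> ext_fam H C a m. A \<inter> \<Union>(C \<union> fst p) = snd p}. f (snd p))"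
      using assms(4) unfolding ext_sum_def by (simp only: ext_fam_insert case_prod_unfold simp_thms)
  qed
  also have "\<dots> = (\<Sum>p\<in>ext_fam H C a m. \<Sum>A\<in>{A \<in> X. A \<inter> \<Union>(C \<union> fst p) = snd p}. f (snd p))"
    by (rule sum.swap_restrict[OF finX finite_ext_fam[OF assms(1)]])
  also have "\<dots> = (\<Sum>(F, K)\<in>ext_fam H C a m. f K * real (card (X \<inter> E (\<Union>(C \<union> F)) K)))"
  proof (intro sum.cong refl)
    fix p assume "p \<in> ext_fam H C a m"
    have "{A \<in> X. A \<inter> \<Union>(C \<union> fst p) = snd p} = X \<inter> E (\<Union>(C \<union> fst p)) (snd p)"
      using assms(2) by (auto simp: E_def)
    then show "(\<Sum>A\<in>{A \<in> X. A \<inter> \<Union>(C \<union> fst p) = snd p}. f (snd p))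
        = (case p of (F, K) \<Rightarrow> f K * real (card (X \<inter> E (\<Union>(C \<union> F)) K)))"
      by (simp add: case_prod_unfold)
  qed
  finally show ?thesis .
qed

text \<open>\<open>e l s\<close> is the number of sets that extend a sunflower of \<open>l\<close>
  members with a kernel of size \<open>s\<close>; see \<open>card_E_sunflower\<close>.
  \<open>ext j s\<close> is the number of unordered completions to \<open>r\<close> members when one
  set and \<open>j\<close> others are already present.\<close>

definition "e l s = (n - (s + l * (w - s))) choose (w - s)"
definition "ext j s = (\<Prod>l\<in>{j<..<r}. real (e l s)) / fact (r - 1 - j)"
text \<open>
  A random set contains \<open>K - J\<close> with probability about \<open>\<omega> ^ card (K - J)\<close>. The weight is needed
  because a single set does not determine the kernel: unweighted, the count would be dominated by
  random intersections, which rarely extend to a sunflower.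
\<close>

definition "wt J K = (if J \<subseteq> K then \<omega> ^ card (K - J) else 0)"
definition "Nw H C a J = ext_sum H C a (2 * \<kappa>) (wt J)"
text \<open>Counts \<open>r\<close>-sunflowers through \<open>u\<close> together with
  \<open>j\<close> distinguished other members that are chosen; the factor \<open>ext\<close> stands
  for the remaining \<open>r - 1 - j\<close> members, which may be any sets, chosen or not.\<close>

definition "Wn H j u = ext_sum H {u} j \<kappa> (\<lambda>K. ext j (card K))"
text \<open>The part of the degree that comes from kernels of size at most \<kappa>.\<close>

definition "Dg = (\<Sum>s\<le>\<kappa>. real (w choose s) * ext 0 s)"

lemma card_E_sunflower:
  assumes "C \<subseteq> V" "sunflower_with C K" "C \<noteq> {}" "card K \<le> w"
  shows "card (E (\<Union>C) K) = e (card C) (card K)"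
proof -
  have "finite C" using assms finite_V finite_subset by blast
  then have "card (\<Union>C) = card K + card C * (w - card K)"
    using assms by (intro card_Union_sunflower) auto
  moreover have "\<Union>C \<subseteq> U" using assms V_D by blast
  moreover have "K \<subseteq> \<Union>C" using assms unfolding sunflower_with_def by blast
  ultimately show ?thesis using assms by (simp add: card_E e_def)
qed

lemma petals_fit:
  assumes "l < r" "s \<le> w" shows "s + l * (w - s) + w \<le> n"
proof -
  have "s + l * (w - s) \<le> w + l * w" using assms by (intro add_mono mult_left_mono) auto
  also have "\<dots> = Suc l * w" by simp
  also have "\<dots> \<le> r * w" using assms by (intro mult_right_mono) auto
  finally have "s + l * (w - s) \<le> r * w" .
  moreover have "w \<le> r * w" using r_ge_3 by simp
  moreover have "2 * r * w = r * w + r * w" by simp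
  ultimately show ?thesis using U_large by linarith
qed

lemma e_pos: "l < r \<Longrightarrow> s \<le> w \<Longrightarrow> e l s > 0"
  using petals_fit[of l s] by (simp add: e_def)

lemma ext_pos: "s \<le> w \<Longrightarrow> ext j s > 0"
  by (auto simp: ext_def intro!: divide_pos_pos prod_pos e_pos)

lemma ext_nonneg: "ext j s \<ge> 0"
  by (auto simp: ext_def intro!: divide_nonneg_pos prod_nonneg)

text \<open>A completion by \<open>r - 1 - j\<close> sets arises once for each choice of the set
  added first. The same factor appears in \<open>xt_step\<close>, so the counts and their
  trajectories obey matching recursions.\<close>

lemma ext_Suc:
  assumes "Suc j < r"
  shows "real (e (Suc j) s) * ext (Suc j) s = real (r - 1 - j) * ext j s"
proof -
  have "{j<..<r} = insert (Suc j) {Suc j<..<r}" using assms by auto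
  moreover have "r - 1 - j = Suc (r - 1 - Suc j)" using assms by simp
  ultimately show ?thesis by (simp add: ext_def)
qed

lemma Dg_pos: "Dg > 0"
  unfolding Dg_def using w_ge by (intro sum_pos mult_pos_pos ext_pos) auto

lemma Wn_0:
  assumes "finite H" "u \<in> V"
  shows "Wn H 0 u = Dg"
proof -
  note u = V_D[OF assms(2)]
  let ?P = "\<lambda>s. {K. K \<subseteq> u \<and> card K = s}"
  have fin: "finite (?P s)" for s using u by simp
  have "ext_fam H {u} 0 \<kappa> = Pair {} ` (\<Union>s\<le>\<kappa>. ?P s)"
    using assms(1) u(1) unfolding ext_fam_def sunflower_with_def
    by (auto simp: card_eq_0_iff intro: finite_subset)
  then have "Wn H 0 u = (\<Sum>K\<in>(\<Union>s\<le>\<kappa>. ?P s). ext 0 (card K))"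
    by (simp add: Wn_def ext_sum_def sum.reindex inj_on_def)
  also have "\<dots> = (\<Sum>s\<le>\<kappa>. \<Sum>K\<in>?P s. ext 0 (card K))"
    using fin by (intro sum.UNION_disjoint) auto
  also have "\<dots> = Dg" using u by (simp add: Dg_def n_subsets)
  finally show ?thesis .
qed

lemma e_le:
  assumes "1 \<le> l" "l < r" "s \<le> 2 * \<kappa>"
  shows "real (e l s) \<le> N * exp (- lam * real l)"
proof -
  have sw: "s \<le> w" using assms w_ge by linarith
  have "s + l * (w - s) \<le> n" using petals_fit[OF assms(2) sw] by linarith
  from obtain_subset_with_card_n[OF this] obtain R where R: "R \<subseteq> U" "card R = s + l * (w - s)"
    by metis
  then have "s \<le> card R" by simp
  from obtain_subset_with_card_n[OF this] obtain K where K: "K \<subseteq> R" "card K = s"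
    by metis
  have finR: "finite R" using R finite_U finite_subset by blast
  have "card (R - K) = l * (w - s)" using R K finR by (simp add: card_Diff_subset finite_subset)
  then have "real (card (E R K)) \<le> N * \<omega> ^ card K * exp (- (real (w - 4 * \<kappa>) / real n) * real (l * (w - s)))"
    using E_ratio[of "{}" R "{}" K] R K assms by (auto simp: E_empty)
  also have "\<dots> \<le> N * 1 * exp (- lam * real l)"
  proof (intro mult_mono)
    have "2 * \<kappa> \<le> 2 * (r + 1) * \<kappa>" by (intro mult_right_mono) auto
    then have "w - 2 * (r + 1) * \<kappa> \<le> w - s" using assms by linarith
    then have "lam * real l \<le> real (w - 4 * \<kappa>) / real n * real (w - s) * real l"
      by (auto simp: lam_def intro!: mult_right_mono divide_right_mono mult_left_mono)
    then show "exp (- (real (w - 4 * \<kappa>) / real n) * real (l * (w - s))) \<le> exp (- lam * real l)"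
      by (simp add: mult.assoc mult.commute mult.left_commute)
  qed (use \<omega>_bounds in \<open>auto simp: power_le_one\<close>)
  also have "card (E R K) = e l s" using R K sw by (simp add: card_E e_def)
  finally show ?thesis by simp
qed

lemma sum_between: "j < r \<Longrightarrow> (\<Sum>l\<in>{j<..<r}. real l) = real (r - 1 - j) * real (r + j) / 2"
proof -
  have "(\<Sum>l\<in>{j<..<j + Suc k}. real l) = real k * real (2 * j + Suc k) / 2" for k
  proof (induction k)
    case (Suc k)
    have "{j<..<j + Suc (Suc k)} = insert (j + Suc k) {j<..<j + Suc k}" by auto
    then show ?case using Suc by (simp add: field_simps)
  next
    case 0
    have "{j<..<j + Suc 0} = {}" by auto
    then show ?case by (metis mult_zero_left of_nat_0 sum.empty div_0)
  qed
  from this[of "r - 1 - j"] show "j < r \<Longrightarrow> ?thesis" by simp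
qed

lemma ext_le:
  assumes "s \<le> 2 * \<kappa>" "j < r"
  shows "ext j s \<le> N ^ (r - 1 - j) * exp (- lam * (real (r - 1 - j) * real (r + j) / 2))"
proof -
  have "ext j s \<le> (\<Prod>l\<in>{j<..<r}. real (e l s)) / 1"
    unfolding ext_def by (intro divide_left_mono prod_nonneg fact_ge_1) auto
  also have "\<dots> \<le> (\<Prod>l\<in>{j<..<r}. N * exp (- lam * real l))"
    using assms e_le by (auto intro!: prod_mono)
  also have "\<dots> = N ^ (r - 1 - j) * exp (\<Sum>l\<in>{j<..<r}. - lam * real l)"
    using assms(2) by (simp add: prod.distrib exp_sum)
  also have "(\<Sum>l\<in>{j<..<r}. - lam * real l) = - lam * (real (r - 1 - j) * real (r + j) / 2)"
    unfolding sum_between[OF assms(2), symmetric] by (rule sum_distrib_left[symmetric])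
  finally show ?thesis .
qed

lemma wt_bounds: "0 \<le> wt J K" "wt J K \<le> 1" "J = K \<Longrightarrow> wt J K = 1"
  using \<omega>_bounds by (auto simp: wt_def power_le_one)

text \<open>Writing \<open>K = J \<union> Z\<close>, a summand is at most
  \<open>\<omega> ^ (2 * card Z)\<close>, and the binomial theorem applies. Without the weight the
  sum would be \<open>(1 + \<omega>) ^ w\<close>, roughly \<open>exp (2 * w ^ 2 / n)\<close>,
  whereas \<open>w * \<omega> ^ 2\<close> is small compared with \<open>w ^ 2 / n\<close>.\<close>

lemma sum_wt_le:
  assumes "v \<in> V"
  shows "(\<Sum>K\<in>Pow v. wt J K * \<omega> ^ card K) \<le> (1 + \<omega>\<^sup>2) ^ w"
proof -
  note v = V_D[OF assms]
  show ?thesis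
  proof (cases "J \<subseteq> v")
    case False
    then have "wt J K = 0" if "K \<in> Pow v" for K using that by (auto simp: wt_def)
    then show ?thesis by simp
  next
    case True
    have finJ: "finite J" using True v finite_subset by blast
    have "(\<Sum>K\<in>Pow v. wt J K * \<omega> ^ card K) = (\<Sum>K\<in>{K. J \<subseteq> K \<and> K \<subseteq> v}. \<omega> ^ card (K - J) * \<omega> ^ card K)"
      using v by (intro sum.mono_neutral_cong_right) (auto simp: wt_def)
    also have "\<dots> = (\<Sum>Z\<in>Pow (v - J). \<omega> ^ card Z * \<omega> ^ card (Z \<union> J))"
      using True by (intro sum.reindex_bij_witness[of _ "\<lambda>Z. Z \<union> J" "\<lambda>K. K - J"])
        (auto simp: Un_absorb2)
    also have "\<dots> \<le> (\<Sum>Z\<in>Pow (v - J). (\<omega>\<^sup>2) ^ card Z)"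
    proof (rule sum_mono)
      fix Z assume Z: "Z \<in> Pow (v - J)"
      then have "finite Z" using v finite_subset by blast
      then have "card Z \<le> card (Z \<union> J)" using finJ by (intro card_mono) auto
      then have "\<omega> ^ card Z * \<omega> ^ card (Z \<union> J) \<le> \<omega> ^ card Z * \<omega> ^ card Z"
        using \<omega>_bounds by (intro mult_left_mono power_decreasing) auto
      then show "\<omega> ^ card Z * \<omega> ^ card (Z \<union> J) \<le> (\<omega>\<^sup>2) ^ card Z"
        by (simp add: power2_eq_square power_mult_distrib)
    qed
    also have "\<dots> = (1 + \<omega>\<^sup>2) ^ card (v - J)"
      using v prod_add[of "v - J" "\<lambda>_. \<omega>\<^sup>2" "\<lambda>_. 1"] by (simp add: add.commute)
    also have "\<dots> \<le> (1 + \<omega>\<^sup>2) ^ w"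
      using v card_mono[of v "v - J"] by (intro power_increasing) auto
    finally show ?thesis .
  qed
qed

end

section \<open>Which sets are closed by a new set\<close>

text \<open>A Bonferroni inequality in which every pair of indices is counted twice.\<close>

lemma sum_card_le_card_Union:
  assumes "finite I" "\<And>i. i \<in> I \<Longrightarrow> finite (X i)"
  shows "(\<Sum>i\<in>I. card (X i)) \<le> card (\<Union>i\<in>I. X i) + (\<Sum>i\<in>I. \<Sum>j\<in>I - {i}. card (X i \<inter> X j))"
  using assms
proof (induction I rule: finite_induct)
  case (insert i I)
  let ?U = "\<Union>i\<in>I. X i"
  have fin: "finite ?U" "finite (X i)" using insert by auto
  have "X i \<inter> ?U = (\<Union>j\<in>I. X i \<inter> X j)" by blast
  then have "card (X i \<inter> ?U) \<le> (\<Sum>j\<in>I. card (X i \<inter> X j))"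
    using card_UN_le[OF insert.hyps(1), of "\<lambda>j. X i \<inter> X j"] by (simp only:)
  moreover have "card (X i) + card ?U = card (\<Union>j\<in>insert i I. X j) + card (X i \<inter> ?U)"
    using card_Un_Int[OF fin(2,1)] by simp
  moreover have "(\<Sum>k\<in>I. \<Sum>j\<in>I - {k}. card (X k \<inter> X j)) \<le> (\<Sum>k\<in>I. \<Sum>j\<in>insert i I - {k}. card (X k \<inter> X j))"
    using insert.hyps by (intro sum_mono sum_mono2) auto
  moreover have "insert i I - {i} = I" using insert.hyps by blast
  ultimately show ?case using insert by simp
qed simp

context uniform_family
begin

abbreviation "avail H \<equiv> available r U w H"

text \<open>An available \<open>A\<close> closes itself; in the estimates below it falls under the
  sets with large intersection.\<close>

definition "closed_by H A = {y \<in> avail H. y \<notin> avail (insert A H)}"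
definition "near_ok H u \<longleftrightarrow> (\<forall>A\<in>H. card (A \<inter> u) \<le> 2 * \<kappa>)"
definition "separated H \<longleftrightarrow> (\<forall>A\<in>H. \<forall>B\<in>H. A \<noteq> B \<longrightarrow> card (A \<inter> B) \<le> 2 * \<kappa>)"
text \<open>
  Tests \<open>(C, K)\<close> are dropped as soon as a set close to a member of \<open>C\<close> is chosen, or \<open>r - 1\<close> sets of
  \<open>C\<close> itself: such a step closes a positive fraction of the sets extending \<open>C\<close>.
\<close>

definition "valid H C K \<longleftrightarrow> C \<subseteq> V \<and> card C \<le> r - 1 \<and> sunflower_with C K \<and> K \<subseteq> \<Union>C \<and> card K \<le> \<kappa> \<and>
  card (C \<inter> H) \<le> r - 2 \<and> (\<forall>A\<in>H - C. \<forall>v\<in>C. card (A \<inter> v) \<le> 2 * \<kappa>)"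

lemma avail_D: "A \<in> avail H \<Longrightarrow> A \<in> V" "A \<in> avail H \<Longrightarrow> A \<notin> H"
  by (auto simp: available_def)

lemma finite_avail: "finite (avail H)"
  by (rule finite_available[OF finite_U])

lemma sunflower_free_mono: "sunflower_free k G \<Longrightarrow> H \<subseteq> G \<Longrightarrow> sunflower_free k H"
  by (auto simp: sunflower_free_def)

lemma avail_insert_subset: "avail (insert A H) \<subseteq> avail H"
  by (auto simp: available_def intro: sunflower_free_mono)

text \<open>For distinct sets both sides say that \<open>insert y (insert A H)\<close> contains a
  sunflower. The symmetry turns the loss caused by \<open>A\<close> into the rate at which
  \<open>y\<close> is closed; see \<open>sum_card_closed_by\<close>.\<close>

lemma closed_by_sym:
  assumes "A \<in> avail H" "y \<in> avail H"
  shows "y \<in> closed_by H A \<longleftrightarrow> A \<in> closed_by H y"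
  using assms by (auto simp: closed_by_def available_def insert_commute)

text \<open>Both sets were available, so a sunflower that arises must contain \<open>A\<close> and
  \<open>y\<close>. As it has at least two members, each of them contains the common pairwise
  intersection.\<close>

lemma closed_by_witness:
  assumes "A \<in> avail H" "y \<in> closed_by H A" "y \<noteq> A"
  obtains B K where "B \<subseteq> H" "card B = r - 2" "sunflower_with (insert y (insert A B)) K"
proof -
  have y: "y \<in> avail H" "y \<notin> avail (insert A H)" using assms by (auto simp: closed_by_def)
  then have "\<not> sunflower_free r (insert y (insert A H))"
    using assms by (auto simp: available_def)
  then obtain F where F: "F \<subseteq> insert y (insert A H)" "is_sunflower r F"
    by (auto simp: sunflower_free_def)
  obtain K where K: "\<forall>X\<in>F. \<forall>Y\<in>F. X \<noteq> Y \<longrightarrow> X \<inter> Y = K" and fin: "finite F" "card F = r"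
    using F by (auto simp: is_sunflower_def)
  have "A \<in> F"
  proof (rule ccontr)
    assume "A \<notin> F"
    then have "F \<subseteq> insert y H" using F by blast
    then show False using y F by (auto simp: available_def sunflower_free_def)
  qed
  moreover have "y \<in> F"
  proof (rule ccontr)
    assume "y \<notin> F"
    then have "F \<subseteq> insert A H" using F by blast
    then show False using assms F by (auto simp: available_def sunflower_free_def)
  qed
  ultimately have yA: "insert y (insert A (F - {y, A})) = F" by blast
  have "card (F - {y, A}) = r - 2"
    using \<open>A \<in> F\<close> \<open>y \<in> F\<close> assms(3) fin by (simp add: card_Diff_subset)
  moreover have "F - {y, A} \<subseteq> H" using F by blast
  moreover have "sunflower_with F K"
  proof -
    have "K \<subseteq> X" if "X \<in> F" for X
    proof -
      have "\<exists>Y\<in>F. Y \<noteq> X" using \<open>A \<in> F\<close> \<open>y \<in> F\<close> assms(3) by metis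
      then show ?thesis using K that by blast
    qed
    then show ?thesis using K by (auto simp: sunflower_with_def)
  qed
  ultimately show thesis using that yA by metis
qed

lemma closed_by_I:
  assumes "A \<in> avail H" "y \<in> avail H" "y \<noteq> A" "finite H"
    and "B \<subseteq> H" "card B = r - 2" "sunflower_with (insert y (insert A B)) K"
  shows "y \<in> closed_by H A"
proof -
  have fin: "finite B" using assms finite_subset by blast
  have "y \<notin> B" "A \<notin> B" using avail_D(2)[OF assms(1)] avail_D(2)[OF assms(2)] assms(5) by auto
  then have "card (insert y (insert A B)) = r"
    using assms(3,6) fin r_ge_3 by simp
  then have "is_sunflower r (insert y (insert A B))"
    using fin assms(7) by (auto simp: is_sunflower_def sunflower_with_def)
  moreover have "insert y (insert A B) \<subseteq> insert y (insert A H)" using assms(5) by blast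
  ultimately have "\<not> sunflower_free r (insert y (insert A H))"
    unfolding sunflower_free_def by metis
  then show ?thesis using assms by (auto simp: closed_by_def available_def)
qed

text \<open>
  A random set extends a partial sunflower with \<open>k\<close> members with probability about \<open>exp (- k * lam)\<close>,
  and there are about \<open>exp (r * lam / 2)\<close> sets to choose from. With \<open>M = card C + a\<close>, the exponent
  \<open>a * (r - M) / 2\<close> is a linear upper bound for the number of extensions by \<open>a\<close> sets that these
  probabilities predict, floored at 1; only \<open>M \<le> r - 1\<close> is used.
\<close>

definition counts_bounded :: "real \<Rightarrow> 'a set set \<Rightarrow> bool" where
  "counts_bounded Y H \<longleftrightarrow> (\<forall>C a J. C \<noteq> {} \<longrightarrow> C \<subseteq> V \<longrightarrow> 1 \<le> a \<longrightarrow> card C + a \<le> r - 1 \<longrightarrow> J \<subseteq> U \<longrightarrow>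
    Nw H C a J \<le> Y ^ a * exp (real a * real (r - (card C + a)) * lam / 2))"

lemma counts_boundedD:
  assumes "counts_bounded Y H" "C \<noteq> {}" "C \<subseteq> V" "1 \<le> a" "card C + a \<le> r - 1" "J \<subseteq> U"
  shows "Nw H C a J \<le> Y ^ a * exp (real a * real (r - (card C + a)) * lam / 2)"
  using assms unfolding counts_bounded_def by metis

section \<open>Share of the extensions closed by one set\<close>

lemma count_full:
  assumes "counts_bounded Y H" "finite H" "C \<noteq> {}" "C \<subseteq> V" "card C + a = r - 1" "K \<subseteq> U" "card K \<le> 2 * \<kappa>"
  shows "real (card {F. F \<subseteq> H - C \<and> card F = a \<and> sunflower_with (C \<union> F) K}) \<le> Y ^ a * exp (real a * lam / 2)"
proof (cases "a = 0")
  case True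
  have "{F. F \<subseteq> H - C \<and> card F = a \<and> sunflower_with (C \<union> F) K} \<subseteq> {{}}"
    using True assms(2) by (auto simp: card_eq_0_iff dest: finite_subset)
  then have "card {F. F \<subseteq> H - C \<and> card F = a \<and> sunflower_with (C \<union> F) K} \<le> card {{} :: 'a set set}"
    by (rule card_mono[rotated]) simp
  then show ?thesis using True by simp
next
  case False
  let ?X = "{F. F \<subseteq> H - C \<and> card F = a \<and> sunflower_with (C \<union> F) K}"
  \<comment> \<open>With \<open>J = K\<close> every family in \<open>?X\<close> has weight
    1.\<close>
  have "real (card ?X) = (\<Sum>(F, K')\<in>(\<lambda>F. (F, K)) ` ?X. wt K K')"
    by (subst sum.reindex) (auto simp: inj_on_def wt_bounds(3))
  also have "\<dots> \<le> Nw H C a K"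
    unfolding Nw_def ext_sum_def
    using assms by (intro sum_mono2 finite_ext_fam) (auto simp: ext_fam_def wt_bounds)
  also have "\<dots> \<le> Y ^ a * exp (real a * real (r - (card C + a)) * lam / 2)"
    using assms False by (intro counts_boundedD) auto
  also have "r - (card C + a) = 1" using assms r_ge_3 by linarith
  finally show ?thesis by simp
qed

text \<open>A number of families of at most \<open>Y ^ a * exp (a * lam / 2)\<close>, each costing
  \<open>exp (- lam * a')\<close>, contributes at most \<open>Y ^ r * exp (- lam / 2)\<close> by
  \<open>loss_term\<close>; the factor \<open>2 ^ r\<close> counts the subfamilies that may be
  shared with \<open>C\<close>.\<close>

definition "loss Y = 2 ^ r * Y ^ r * exp (- lam / 2)"

lemma loss_term:
  assumes "Y \<ge> 1" "a \<le> a'" "1 \<le> a'" "a \<le> r"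
  shows "Y ^ a * exp (real a * lam / 2) * exp (- lam * real a') \<le> Y ^ r * exp (- lam / 2)"
proof -
  have "real a * lam / 2 - lam * real a' = lam * (real a / 2 - real a')" by (simp add: algebra_simps)
  also have "\<dots> \<le> lam * (- 1 / 2)" using assms lam_nonneg by (intro mult_left_mono) auto
  finally have "exp (real a * lam / 2) * exp (- lam * real a') \<le> exp (- lam / 2)"
    by (simp add: mult_exp_exp)
  moreover have "Y ^ a \<le> Y ^ r" using assms by (intro power_increasing) auto
  ultimately have "Y ^ a * (exp (real a * lam / 2) * exp (- lam * real a')) \<le> Y ^ r * exp (- lam / 2)"
    using assms by (intro mult_mono) auto
  then show ?thesis by (simp add: mult.assoc)
qed

text \<open>With \<open>A\<close> and the shared part \<open>C0\<close> fixed, \<open>F\<close> has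
  \<open>a\<close> members left to choose, while its \<open>a'\<close> members outside
  \<open>C\<close> each cost \<open>exp (- lam)\<close>. Here \<open>a \<le> a'\<close>, with
  equality if \<open>A\<close> is in \<open>C\<close>, and \<open>a' \<ge> 1\<close> because
  \<open>F\<close> is not contained in \<open>C\<close>; this leaves at most
  \<open>exp (- lam / 2)\<close>.\<close>

lemma sharing_extensions:
  assumes cb: "counts_bounded Y H" and Y: "Y \<ge> 1" and H: "finite H" "H \<subseteq> V"
    and C: "C \<subseteq> V" "card C \<le> r - 1" "K \<subseteq> \<Union>C" "card K \<le> 2 * \<kappa>"
    and A: "A \<in> V" "A \<notin> H" and C0: "C0 \<subseteq> C"
    and FF: "finite FF"
    and F: "\<And>F. F \<in> FF \<Longrightarrow> F \<subseteq> insert A H \<and> A \<in> F \<and> card F = r - 1 \<and> F \<inter> C = C0 \<and> sunflower_with F K \<and> \<not> F \<subseteq> C"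
    and near: "\<And>F g v. F \<in> FF \<Longrightarrow> g \<in> F - C \<Longrightarrow> v \<in> C \<Longrightarrow> card (g \<inter> v) \<le> 2 * \<kappa>"
  shows "(\<Sum>F\<in>FF. real (card (E (\<Union>C \<union> \<Union>F) K))) \<le> real (card (E (\<Union>C) K)) * (Y ^ r * exp (- lam / 2))"
proof (cases "FF = {}")
  case True
  then show ?thesis using Y by simp
next
  case False
  then obtain F0 where F0: "F0 \<in> FF" by blast
  note F0' = F[OF F0]
  have finC: "finite C" using C finite_V finite_subset by blast
  have finF: "finite F" if "F \<in> FF" for F
    using F[OF that] r_ge_3 by (intro card_ge_0_finite) auto
  define a where "a = r - 1 - card (insert A C0)"
  define a' where "a' = r - 1 - card C0"
  have cC0: "card (insert A C0) \<le> r - 1"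
    using F0' card_mono[OF finF[OF F0], of "insert A C0"] by auto
  have finC0: "finite C0" using C0 finC finite_subset by blast
  have cF: "card (F - C) = a'" if "F \<in> FF" for F
    using F[OF that] finC0 by (subst card_Diff_subset_Int) (auto simp: a'_def)
  have "F0 - C \<noteq> {}" using F0' by blast
  then have a': "1 \<le> a'" using cF[OF F0] finF[OF F0] by (metis One_nat_def Suc_leI card_gt_0_iff finite_Diff)
  have "card C0 \<le> card (insert A C0)" using finC0 by (intro card_mono) auto
  then have aa': "a \<le> a'" "a \<le> r" by (auto simp: a_def a'_def)
  have KU: "K \<subseteq> U" using C V_D(1) by blast
  let ?X = "{F. F \<subseteq> H - insert A C0 \<and> card F = a \<and> sunflower_with (insert A C0 \<union> F) K}"
  have "card FF \<le> card ?X"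
  proof (rule card_inj_on_le)
    show "inj_on (\<lambda>F. F - insert A C0) FF"
    proof (rule inj_onI)
      fix F F' assume *: "F \<in> FF" "F' \<in> FF" "F - insert A C0 = F' - insert A C0"
      then have "insert A C0 \<subseteq> F" "insert A C0 \<subseteq> F'" using F[OF *(1)] F[OF *(2)] by auto
      then show "F = F'" using *(3) by (metis Diff_partition)
    qed
    show "(\<lambda>F. F - insert A C0) ` FF \<subseteq> ?X"
    proof
      fix G assume "G \<in> (\<lambda>F. F - insert A C0) ` FF"
      then obtain F1 where F1: "F1 \<in> FF" "G = F1 - insert A C0" by blast
      note F1' = F[OF F1(1)]
      have sub: "insert A C0 \<subseteq> F1" using F1' by blast
      then have "insert A C0 \<union> G = F1" using F1 by blast
      moreover have "card G = a" using F1 F1' sub finC0 by (simp add: a_def card_Diff_subset)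
      moreover have "G \<subseteq> H - insert A C0" using F1 F1' by blast
      ultimately show "G \<in> ?X" using F1' by simp
    qed
    show "finite ?X" by (rule finite_subset[of _ "Pow H"]) (use H in auto)
  qed
  also have "real (card ?X) \<le> Y ^ a * exp (real a * lam / 2)"
  proof (rule count_full[OF cb H(1)])
    show "insert A C0 \<subseteq> V" using A C0 C by auto
    show "card (insert A C0) + a = r - 1" using cC0 by (simp add: a_def)
  qed (use KU C in auto)
  finally have cFF: "real (card FF) \<le> Y ^ a * exp (real a * lam / 2)" by simp
  have each: "real (card (E (\<Union>C \<union> \<Union>F) K)) \<le> real (card (E (\<Union>C) K)) * exp (- lam * real a')" if "F \<in> FF" for F
  proof -
    have "sunflower_with (F - C) K" using F[OF that] sunflower_with_mono by blast
    moreover have "F - C \<subseteq> V" using F[OF that] H A by auto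
    moreover have "F - C \<noteq> {}" using F[OF that] by blast
    moreover have "\<Union>C \<union> \<Union>F = \<Union>C \<union> \<Union>(F - C)" by blast
    ultimately show ?thesis
      using ext_ratio[OF C, of "F - C" K] near[OF that] cF[OF that] C by auto
  qed
  have "(\<Sum>F\<in>FF. real (card (E (\<Union>C \<union> \<Union>F) K))) \<le> (\<Sum>F\<in>FF. real (card (E (\<Union>C) K)) * exp (- lam * real a'))"
    by (rule sum_mono) (rule each)
  also have "\<dots> = real (card FF) * (real (card (E (\<Union>C) K)) * exp (- lam * real a'))" by simp
  also have "\<dots> \<le> (Y ^ a * exp (real a * lam / 2)) * (real (card (E (\<Union>C) K)) * exp (- lam * real a'))"
    using cFF by (intro mult_right_mono) auto
  also have "\<dots> = real (card (E (\<Union>C) K)) * (Y ^ a * exp (real a * lam / 2) * exp (- lam * real a'))"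
    by (simp add: algebra_simps)
  also have "\<dots> \<le> real (card (E (\<Union>C) K)) * (Y ^ r * exp (- lam / 2))"
    using loss_term[OF Y aa'(1) a' aa'(2)] by (intro mult_left_mono) auto
  finally show ?thesis .
qed

text \<open>A closed \<open>y\<close> either meets \<open>A\<close> in many points outside
  \<open>\<Union>C\<close> or completes a sunflower of \<open>r - 1\<close> sets containing
  \<open>A\<close>. If that sunflower shares a member with \<open>C\<close>, the trace of
  \<open>y\<close> on this member forces the kernel to be \<open>K\<close>. Otherwise the kernel is
  free, and the weighted count \<open>Nw\<close> controls the choices.\<close>

lemma card_closed_by_le:
  assumes cb: "counts_bounded Y H" and Y: "Y \<ge> 1" and H: "finite H" "H \<subseteq> V"
    and A: "A \<in> avail H" and val: "valid (insert A H) C K"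
  shows "real (card (E (\<Union>C) K \<inter> closed_by H A)) \<le> real (card (E (\<Union>C) K)) * (\<nu> + loss Y)"
proof -
  define c where "c = real (card (E (\<Union>C) K))"
  define t where "t = Y ^ r * exp (- lam / 2)"
  have C: "C \<subseteq> V" "card C \<le> r - 1" "sunflower_with C K" "K \<subseteq> \<Union>C" "card K \<le> \<kappa>"
    "card (C \<inter> insert A H) \<le> r - 2"
    and near: "\<And>g v. g \<in> insert A H - C \<Longrightarrow> v \<in> C \<Longrightarrow> card (g \<inter> v) \<le> 2 * \<kappa>"
    using val unfolding valid_def by blast+
  have AV: "A \<in> V" "A \<notin> H" using avail_D A by auto
  have finC: "finite C" using C finite_V finite_subset by blast
  have finKC: "finite (\<Union>C)" using finC C(1) V_D(3) by (intro finite_Union) auto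
  define D1 where "D1 = {y \<in> E (\<Union>C) K. \<kappa> < card (y \<inter> A - \<Union>C)}"
  define FF where "FF C0 = {F. F \<subseteq> insert A H \<and> A \<in> F \<and> card F = r - 1 \<and> F \<inter> C = C0 \<and>
    sunflower_with F K \<and> \<not> F \<subseteq> C}" for C0
  \<comment> \<open>The condition \<open>K \<inter> A \<subseteq> K'\<close> is recorded because it
    turns the cost \<open>\<omega> ^ card (K' - K)\<close> into \<open>wt (K \<inter> A) K'\<close>,
    the weight summed by \<open>Nw\<close>.\<close>
  define GG where "GG = {(F, K'). F \<subseteq> insert A H - C \<and> A \<in> F \<and> card F = r - 1 \<and> K' \<subseteq> U \<and>
    card K' \<le> 2 * \<kappa> \<and> sunflower_with F K' \<and> K' \<inter> \<Union>C \<subseteq> K \<and> K \<inter> A \<subseteq> K'}"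
  have finFF: "finite (FF C0)" for C0
    by (rule finite_subset[of _ "Pow (insert A H)"]) (use H in \<open>auto simp: FF_def\<close>)
  have finGG: "finite GG"
    by (rule finite_subset[of _ "Pow (insert A H) \<times> Pow U"]) (use H finite_U in \<open>auto simp: GG_def\<close>)
  have sub: "E (\<Union>C) K \<inter> closed_by H A \<subseteq> D1 \<union> (\<Union>C0\<in>Pow C - {{}}. \<Union>F\<in>FF C0. E (\<Union>C \<union> \<Union>F) K)
    \<union> (\<Union>p\<in>GG. E (\<Union>C \<union> \<Union>(fst p)) (K \<union> snd p))"
  proof
    fix y assume y: "y \<in> E (\<Union>C) K \<inter> closed_by H A"
    then have yE: "y \<in> E (\<Union>C) K" and yK: "y \<inter> \<Union>C = K" and yav: "y \<in> avail H" and yV: "y \<in> V"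
      by (auto simp: closed_by_def E_def)
    have yH: "y \<notin> H" using avail_D yav by auto
    show "y \<in> D1 \<union> (\<Union>C0\<in>Pow C - {{}}. \<Union>F\<in>FF C0. E (\<Union>C \<union> \<Union>F) K)
      \<union> (\<Union>p\<in>GG. E (\<Union>C \<union> \<Union>(fst p)) (K \<union> snd p))"
    proof (cases "card (y \<inter> A) \<le> 2 * \<kappa>")
      case False
      have "y \<inter> A \<subseteq> (y \<inter> A - \<Union>C) \<union> K" using yK by blast
      then have "card (y \<inter> A) \<le> card ((y \<inter> A - \<Union>C) \<union> K)"
        using V_D(3)[OF yV] finKC C(4) by (intro card_mono) (auto intro: finite_subset)
      also have "\<dots> \<le> card (y \<inter> A - \<Union>C) + card K" by (rule card_Un_le)
      finally have "y \<in> D1" using False C(5) yE by (simp add: D1_def)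
      then show ?thesis by blast
    next
      case True
      have "y \<noteq> A" using True V_D(2)[OF AV(1)] w_ge \<kappa>_pos by auto
      then obtain B K' where B: "B \<subseteq> H" "card B = r - 2" "sunflower_with (insert y (insert A B)) K'"
        using closed_by_witness[OF A] y by blast
      define F where "F = insert A B"
      have finB: "finite B" using B H finite_subset by blast
      have yF: "y \<notin> F" using yH B \<open>y \<noteq> A\<close> by (auto simp: F_def)
      have cF: "card F = r - 1" using B AV finB r_ge_3 by (subst F_def, subst card_insert_disjoint) auto
      have sF: "sunflower_with F K'" "y \<inter> \<Union>F = K'"
        using B(3) sunflower_with_insert[of y F K'] yF by (auto simp: F_def)
      have "K' \<subseteq> A" "K' \<subseteq> y" using B(3) unfolding sunflower_with_def by auto
      then have K': "card K' \<le> 2 * \<kappa>" "K' \<subseteq> U"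
        using True card_mono[of "y \<inter> A" K'] V_D[OF yV] by auto
      have FA: "F \<subseteq> insert A H" "A \<in> F" using B by (auto simp: F_def)
      show ?thesis
      proof (cases "F \<inter> C = {}")
        case True
        have "K' \<inter> \<Union>C \<subseteq> K" using \<open>K' \<subseteq> y\<close> yK by blast
        moreover have "K \<inter> A \<subseteq> K'" using sF(2) yK FA by blast
        ultimately have "(F, K') \<in> GG" using FA True cF K' sF by (auto simp: GG_def)
        moreover have "y \<in> E (\<Union>C \<union> \<Union>F) (K \<union> K')" using yV yK sF by (auto simp: E_def)
        ultimately show ?thesis by (metis (no_types, lifting) UN_I UnI2 fst_conv snd_conv)
      next
        case False
        then obtain v where v: "v \<in> F" "v \<in> C" by blast
        have "y \<inter> v = K" using yK v C(3) unfolding sunflower_with_def by blast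
        moreover have "y \<inter> v = K'" using sF v unfolding sunflower_with_def by blast
        ultimately have "K' = K" by simp
        \<comment> \<open>All \<open>r - 1\<close> members of \<open>F\<close> lie in
          \<open>insert A H\<close>, but \<open>valid\<close> allows at most \<open>r - 2\<close> of
          those in \<open>C\<close>.\<close>
        have "\<not> F \<subseteq> C"
        proof
          assume "F \<subseteq> C"
          then have "card F \<le> card (C \<inter> insert A H)" using FA finC by (intro card_mono) auto
          then show False using C(6) cF r_ge_3 by linarith
        qed
        then have "F \<in> FF (F \<inter> C)" using FA cF sF \<open>K' = K\<close> by (simp add: FF_def)
        moreover have "y \<in> E (\<Union>C \<union> \<Union>F) K" using yV yK sF \<open>K' = K\<close> by (auto simp: E_def)
        moreover have "F \<inter> C \<in> Pow C - {{}}" using False by blast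
        ultimately show ?thesis by blast
      qed
    qed
  qed
  have D1: "real (card D1) \<le> \<nu> * c"
    unfolding D1_def c_def using C V_D(1) AV card_Union_le[OF C(1,2)] by (intro near_tail) auto
  have FFsum: "(\<Sum>F\<in>FF C0. real (card (E (\<Union>C \<union> \<Union>F) K))) \<le> c * t" if "C0 \<in> Pow C - {{}}" for C0
    unfolding c_def t_def
  proof (rule sharing_extensions[OF cb Y H C(1,2,4) _ AV _ finFF])
    show "card (g \<inter> v) \<le> 2 * \<kappa>" if "F \<in> FF C0" "g \<in> F - C" "v \<in> C" for F g v
      using that by (intro near) (auto simp: FF_def)
  qed (use that C in \<open>auto simp: FF_def\<close>)
  have GGsum: "(\<Sum>p\<in>GG. real (card (E (\<Union>C \<union> \<Union>(fst p)) (K \<union> snd p)))) \<le> c * t"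
  proof -
    let ?x = "exp (- lam * real (r - 1))"
    have "real (card (E (\<Union>C \<union> \<Union>(fst p)) (K \<union> snd p))) \<le> c * ?x * wt (K \<inter> A) (snd p)" if "p \<in> GG" for p
    proof -
      obtain F K' where p: "p = (F, K')" by (cases p)
      note g = that[unfolded p GG_def, simplified]
      have "F \<subseteq> V" using g H AV by auto
      moreover have "F \<noteq> {}" using g by blast
      moreover have "card (g' \<inter> v) \<le> 2 * \<kappa>" if "g' \<in> F" "v \<in> C" for g' v
        using near[of g' v] that g by blast
      ultimately have "real (card (E (\<Union>C \<union> \<Union>F) (K \<union> K'))) \<le> c * \<omega> ^ card (K' - K) * exp (- lam * real (card F))"
        unfolding c_def using C g by (intro ext_ratio) auto
      moreover have "K' \<subseteq> A" using g unfolding sunflower_with_def by auto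
      then have "K' - K = K' - K \<inter> A" by blast
      ultimately show ?thesis using g p by (simp add: wt_def mult.commute mult.left_commute)
    qed
    then have "(\<Sum>p\<in>GG. real (card (E (\<Union>C \<union> \<Union>(fst p)) (K \<union> snd p)))) \<le> (\<Sum>p\<in>GG. c * ?x * wt (K \<inter> A) (snd p))"
      by (rule sum_mono)
    also have "\<dots> = c * ?x * (\<Sum>p\<in>GG. wt (K \<inter> A) (snd p))" by (simp add: sum_distrib_left)
    also have "(\<Sum>p\<in>GG. wt (K \<inter> A) (snd p)) \<le> Nw H {A} (r - 2) (K \<inter> A)"
    proof -
      let ?g = "\<lambda>p. (fst p - {A}, snd p)"
      have inj: "inj_on ?g GG"
        by (intro inj_onI) (auto simp: GG_def prod_eq_iff)
      have "(\<Sum>p\<in>GG. wt (K \<inter> A) (snd p)) = (\<Sum>p\<in>?g ` GG. wt (K \<inter> A) (snd p))"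
        by (subst sum.reindex[OF inj]) simp
      also have "\<dots> \<le> (\<Sum>p\<in>ext_fam H {A} (r - 2) (2 * \<kappa>). wt (K \<inter> A) (snd p))"
      proof (rule sum_mono2)
        show "?g ` GG \<subseteq> ext_fam H {A} (r - 2) (2 * \<kappa>)"
        proof
          fix q assume "q \<in> ?g ` GG"
          then obtain F K' where q: "q = (F - {A}, K')" "(F, K') \<in> GG" by force
          note g = q(2)[unfolded GG_def, simplified]
          have "insert A (F - {A}) = F" using g by blast
          then show "q \<in> ext_fam H {A} (r - 2) (2 * \<kappa>)" using g q(1) by (auto simp: ext_fam_def)
        qed
      qed (use finite_ext_fam[OF H(1)] wt_bounds in auto)
      finally show ?thesis by (simp add: Nw_def ext_sum_def case_prod_unfold)
    qed
    also have "Nw H {A} (r - 2) (K \<inter> A) \<le> Y ^ (r - 2) * exp (real (r - 2) * real (r - (card {A} + (r - 2))) * lam / 2)"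
      using r_ge_3 AV V_D(1)[OF AV(1)] by (intro counts_boundedD[OF cb]) auto
    also have "r - (card {A} + (r - 2)) = 1" using r_ge_3 by simp
    also have "c * ?x * (Y ^ (r - 2) * exp (real (r - 2) * real 1 * lam / 2)) =
        c * (Y ^ (r - 2) * exp (real (r - 2) * lam / 2) * ?x)" by simp
    also have "\<dots> \<le> c * t"
      unfolding t_def using r_ge_3 by (intro mult_left_mono loss_term[OF Y]) (auto simp: c_def)
    finally show ?thesis by (simp add: c_def mult_left_mono)
  qed
  have "card (E (\<Union>C) K \<inter> closed_by H A) \<le> card (D1 \<union> (\<Union>C0\<in>Pow C - {{}}. \<Union>F\<in>FF C0. E (\<Union>C \<union> \<Union>F) K)
    \<union> (\<Union>p\<in>GG. E (\<Union>C \<union> \<Union>(fst p)) (K \<union> snd p)))"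
    using finC finFF finGG by (intro card_mono[OF _ sub]) (auto simp: D1_def)
  also have "\<dots> \<le> card D1 + (\<Sum>C0\<in>Pow C - {{}}. \<Sum>F\<in>FF C0. card (E (\<Union>C \<union> \<Union>F) K))
      + (\<Sum>p\<in>GG. card (E (\<Union>C \<union> \<Union>(fst p)) (K \<union> snd p)))"
    using finC finFF finGG
    by (intro order_trans[OF card_Un_le] add_mono order_trans[OF card_UN_le] sum_mono card_UN_le order.refl) auto
  finally have "real (card (E (\<Union>C) K \<inter> closed_by H A)) \<le> real (card D1)
      + (\<Sum>C0\<in>Pow C - {{}}. \<Sum>F\<in>FF C0. real (card (E (\<Union>C \<union> \<Union>F) K)))
      + (\<Sum>p\<in>GG. real (card (E (\<Union>C \<union> \<Union>(fst p)) (K \<union> snd p))))"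
    by (simp flip: of_nat_sum of_nat_add)
  also have "\<dots> \<le> \<nu> * c + (\<Sum>C0\<in>Pow C - {{}}. c * t) + c * t"
    using D1 GGsum by (intro add_mono sum_mono FFsum) auto
  \<comment> \<open>The \<open>2 ^ card C - 1\<close> nonempty subfamilies \<open>C0\<close> and the
    disjoint case \<open>GG\<close> contribute one \<open>t\<close> each.\<close>
  also have "\<dots> = c * (\<nu> + 2 ^ card C * t)"
    using finC by (simp add: card_Diff_subset card_Pow of_nat_diff algebra_simps)
  also have "\<dots> \<le> c * (\<nu> + 2 ^ r * t)"
    using C(2) Y by (intro mult_left_mono add_left_mono mult_right_mono power_increasing) (auto simp: c_def t_def)
  finally show ?thesis by (simp add: c_def t_def loss_def mult.assoc)
qed

section \<open>Number of sets closed together with a fixed set\<close>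

lemma near_ok_notin:
  assumes "u \<in> V" "near_ok H u"
  shows "u \<notin> H"
proof
  assume "u \<in> H"
  then have "w \<le> 2 * \<kappa>" using assms V_D(2)[OF assms(1)] unfolding near_ok_def by fastforce
  then show False using w_ge \<kappa>_pos by linarith
qed

text \<open>The tests from which \<open>open_sum\<close> is assembled are valid: \<open>u\<close> is
  not chosen, so \<open>{u} \<union> F\<close> has \<open>a \<le> r - 2\<close> chosen members, and
  \<open>near_ok\<close> and \<open>separated\<close> exclude large intersections with the other
  chosen sets.\<close>

lemma ext_fam_valid:
  assumes "finite H" "H \<subseteq> V" "separated H" "u \<in> V" "near_ok H u" "(F, K) \<in> ext_fam H {u} a \<kappa>" "a \<le> r - 2"
  shows "valid H ({u} \<union> F) K" "card ({u} \<union> F) = Suc a" "{u} \<union> F \<subseteq> V" "sunflower_with ({u} \<union> F) K"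
    "card K \<le> \<kappa>" "K \<subseteq> u"
proof -
  have F: "F \<subseteq> H - {u}" "card F = a" "card K \<le> \<kappa>" "sunflower_with ({u} \<union> F) K"
    using assms by (auto simp: ext_fam_def)
  have u: "u \<notin> H" by (rule near_ok_notin[OF assms(4,5)])
  have finF: "finite F" using F assms(1) by (meson finite_Diff finite_subset)
  have "u \<notin> F" using F by blast
  then show c: "card ({u} \<union> F) = Suc a" using F finF by simp
  show V: "{u} \<union> F \<subseteq> V" using F assms by auto
  show "sunflower_with ({u} \<union> F) K" "card K \<le> \<kappa>" by fact+
  show K: "K \<subseteq> u" using F(4) unfolding sunflower_with_def by blast
  have "({u} \<union> F) \<inter> H = F" using F u by blast
  moreover have "card (A \<inter> v) \<le> 2 * \<kappa>" if "A \<in> H - ({u} \<union> F)" "v \<in> {u} \<union> F" for A v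
  proof (cases "v = u")
    case False
    then have "v \<in> H" "A \<noteq> v" using that F(1) by auto
    then show ?thesis using that(1) assms(3) unfolding separated_def by simp
  qed (use that(1) assms(5) in \<open>simp add: near_ok_def\<close>)
  ultimately show "valid H ({u} \<union> F) K"
    unfolding valid_def using c V F K assms(7) r_ge_3 by auto
qed

text \<open>A set lying in two of these classes completes two sunflowers through \<open>y\<close>.
  Both kernels equal its intersection with \<open>y\<close>, hence agree, and
  \<open>sharing_extensions\<close> applies with \<open>y\<close>, here a member of
  \<open>C\<close>, in the role of \<open>A\<close>.\<close>

lemma overlap_le:
  assumes cb: "counts_bounded Y H" and Y: "Y \<ge> 1" and H: "finite H" "H \<subseteq> V" "separated H"
    and y: "y \<in> V" "near_ok H y" and p: "p \<in> ext_fam H {y} (r - 2) \<kappa>"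
  shows "(\<Sum>p'\<in>ext_fam H {y} (r - 2) \<kappa> - {p}.
      real (card (E (\<Union>({y} \<union> fst p)) (snd p) \<inter> E (\<Union>({y} \<union> fst p')) (snd p'))))
    \<le> real (card (E (\<Union>({y} \<union> fst p)) (snd p))) * loss Y"
proof -
  let ?I = "ext_fam H {y} (r - 2) \<kappa>"
  let ?X = "\<lambda>p. E (\<Union>({y} \<union> fst p)) (snd p)"
  obtain B K where BK: "p = (B, K)" by (cases p)
  define C where "C = {y} \<union> B"
  note val = ext_fam_valid[OF H y p[unfolded BK] order.refl, folded C_def]
  have cC: "card C = r - 1" using val r_ge_3 by simp
  have KC: "K \<subseteq> \<Union>C" using val by (auto simp: C_def)
  have yH: "y \<notin> H" by (rule near_ok_notin[OF y])
  have finC: "finite C" using val finite_V finite_subset by blast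
  define FF where "FF = {F. F \<subseteq> insert y H \<and> y \<in> F \<and> card F = r - 1 \<and> sunflower_with F K \<and> \<not> F \<subseteq> C}"
  have finFF: "finite FF"
    by (rule finite_subset[of _ "Pow (insert y H)"]) (use H in \<open>auto simp: FF_def\<close>)
  define J where "J = {p' \<in> ?I - {p}. ?X p \<inter> ?X p' \<noteq> {}}"
  have finJ: "finite J" using finite_ext_fam[OF H(1)] by (simp add: J_def)
  have kernel: "snd p' = K" if "p' \<in> J" for p'
  proof -
    obtain B' K' where p': "p' = (B', K')" by (cases p')
    then have "K' \<subseteq> y" using that ext_fam_valid(6)[OF H y _ order.refl] by (auto simp: J_def)
    moreover have "?X p \<inter> ?X p' \<noteq> {}" using that unfolding J_def mem_Collect_eq by (rule conjunct2)
    then obtain z where "z \<in> ?X p" "z \<in> ?X p'" by (metis IntE all_not_in_conv)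
    then have "z \<inter> \<Union>({y} \<union> B) = K" "z \<inter> \<Union>({y} \<union> B') = K'" by (auto simp: E_def BK p')
    ultimately show ?thesis using val(6) p' by auto
  qed
  have notin: "y \<notin> fst p'" if "p' \<in> ?I" for p' using that by (auto simp: ext_fam_def)
  have inj: "inj_on (\<lambda>p'. insert y (fst p')) J"
  proof (rule inj_onI)
    fix p1 p2 assume *: "p1 \<in> J" "p2 \<in> J" "insert y (fst p1) = insert y (fst p2)"
    then have "y \<notin> fst p1" "y \<notin> fst p2" using notin by (auto simp: J_def)
    then have "fst p1 = fst p2" using *(3) by (metis insert_ident)
    then show "p1 = p2" using kernel *(1,2) by (metis prod_eq_iff)
  qed
  have img: "(\<lambda>p'. insert y (fst p')) ` J \<subseteq> FF"
  proof
    fix F assume "F \<in> (\<lambda>p'. insert y (fst p')) ` J"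
    then obtain B' K' where F: "F = insert y B'" "(B', K') \<in> J" by force
    have K': "K' = K" using kernel[OF F(2)] by simp
    have I: "(B', K') \<in> ?I" "(B', K') \<noteq> p" using F(2) by (auto simp: J_def)
    note val' = ext_fam_valid[OF H y I(1) order.refl]
    have cF: "card F = r - 1" using val'(2) r_ge_3 F(1) by simp
    have "\<not> F \<subseteq> C"
    proof
      assume "F \<subseteq> C"
      then have "F = C" using cF cC finC by (metis card_subset_eq)
      moreover have "y \<notin> B" "y \<notin> B'" using notin p I(1) BK by auto
      ultimately have "B' = B" using F(1) C_def by auto
      then show False using I(2) BK K' by simp
    qed
    moreover have "B' \<subseteq> H" using I(1) by (auto simp: ext_fam_def)
    ultimately show "F \<in> FF" using cF val'(4) F(1) K' by (auto simp: FF_def)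
  qed
  have "(\<Sum>p'\<in>?I - {p}. real (card (?X p \<inter> ?X p'))) = (\<Sum>p'\<in>J. real (card (?X p \<inter> ?X p')))"
    using finite_ext_fam[OF H(1)] by (intro sum.mono_neutral_right) (auto simp: J_def)
  also have "\<dots> \<le> (\<Sum>p'\<in>J. real (card (E (\<Union>C \<union> \<Union>(insert y (fst p'))) K)))"
  proof (intro sum_mono of_nat_mono card_mono)
    fix p' assume "p' \<in> J"
    then have "snd p' = K" by (rule kernel)
    then show "?X p \<inter> ?X p' \<subseteq> E (\<Union>C \<union> \<Union>(insert y (fst p'))) K"
      by (auto simp: E_def BK C_def)
  qed simp
  also have "\<dots> = (\<Sum>F\<in>(\<lambda>p'. insert y (fst p')) ` J. real (card (E (\<Union>C \<union> \<Union>F) K)))"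
    by (subst sum.reindex[OF inj]) simp
  also have "\<dots> \<le> (\<Sum>F\<in>FF. real (card (E (\<Union>C \<union> \<Union>F) K)))"
    by (rule sum_mono2[OF finFF img]) simp
  also have "\<dots> = (\<Sum>C0\<in>Pow C. \<Sum>F\<in>{F \<in> FF. F \<inter> C = C0}. real (card (E (\<Union>C \<union> \<Union>F) K)))"
    using finFF finC by (intro sum.group[symmetric]) auto
  also have "\<dots> \<le> (\<Sum>C0\<in>Pow C. real (card (E (\<Union>C) K)) * (Y ^ r * exp (- lam / 2)))"
  proof (rule sum_mono)
    fix C0 assume C0: "C0 \<in> Pow C"
    show "(\<Sum>F\<in>{F \<in> FF. F \<inter> C = C0}. real (card (E (\<Union>C \<union> \<Union>F) K)))
        \<le> real (card (E (\<Union>C) K)) * (Y ^ r * exp (- lam / 2))"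
    proof (rule sharing_extensions[OF cb Y H(1,2) val(3) _ KC _ y(1) yH])
      show "card (g \<inter> v) \<le> 2 * \<kappa>" if "F \<in> {F \<in> FF. F \<inter> C = C0}" "g \<in> F - C" "v \<in> C" for F g v
      proof -
        have "g \<in> H - C" using that by (auto simp: FF_def C_def)
        then show ?thesis using val(1) that(3) unfolding valid_def by blast
      qed
      show "finite {F \<in> FF. F \<inter> C = C0}" using finFF by simp
    qed (use C0 cC val in \<open>auto simp: FF_def\<close>)
  qed
  also have "\<dots> = real (card (E (\<Union>C) K)) * (2 ^ (r - 1) * (Y ^ r * exp (- lam / 2)))"
    using finC cC by (simp add: card_Pow)
  also have "\<dots> \<le> real (card (E (\<Union>C) K)) * (2 ^ r * (Y ^ r * exp (- lam / 2)))"
    using Y by (intro mult_left_mono mult_right_mono power_increasing) auto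
  finally show ?thesis by (simp add: BK C_def loss_def mult.assoc)
qed

text \<open>The sum of the increments of \<open>Wn H (Suc j) u\<close> over all available sets. For
  \<open>j = r - 2\<close> it counts, with multiplicity, the available sets that complete
  \<open>u\<close> and \<open>r - 2\<close> chosen sets to a sunflower with small kernel.\<close>

definition "open_sum H j u = (\<Sum>(F, K)\<in>ext_fam H {u} j \<kappa>.
  ext (Suc j) (card K) * real (card (avail H \<inter> E (\<Union>({u} \<union> F)) K)))"

lemma ext_last: "ext (r - Suc 0) s = 1"
proof -
  have "{r - Suc 0<..<r} = {}" by auto
  then show ?thesis by (simp add: ext_def)
qed

lemma Suc_r: "Suc (r - 2) = r - Suc 0" using r_ge_3 by simp

lemma open_sum_last: "open_sum H (r - 2) y = (\<Sum>p\<in>ext_fam H {y} (r - 2) \<kappa>.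
    real (card (avail H \<inter> E (\<Union>({y} \<union> fst p)) (snd p))))"
  by (simp add: open_sum_def Suc_r ext_last case_prod_unfold)

lemma Wn_last:
  assumes "finite H" "H \<subseteq> V" "separated H" "y \<in> V" "near_ok H y"
  shows "Wn H (r - 2) y = (\<Sum>p\<in>ext_fam H {y} (r - 2) \<kappa>. real (card (E (\<Union>({y} \<union> fst p)) (snd p))))"
  unfolding Wn_def ext_sum_def
proof (intro sum.cong refl)
  fix p assume p: "p \<in> ext_fam H {y} (r - 2) \<kappa>"
  obtain B K where BK: "p = (B, K)" by (cases p)
  note val = ext_fam_valid[OF assms p[unfolded BK] order.refl]
  have "real (e (Suc (r - 2)) (card K)) * ext (Suc (r - 2)) (card K) = real (r - 1 - (r - 2)) * ext (r - 2) (card K)"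
    using r_ge_3 by (intro ext_Suc) auto
  moreover have "r - 1 - (r - 2) = 1" using r_ge_3 by simp
  ultimately have "ext (r - 2) (card K) = real (e (r - 1) (card K))"
    by (simp add: Suc_r ext_last)
  also have "e (r - 1) (card K) = card (E (\<Union>({y} \<union> B)) K)"
    using val(2,5) w_ge card_E_sunflower[OF val(3,4)] by (simp add: Suc_r)
  finally show "(case p of (F, K) \<Rightarrow> ext (r - 2) (card K)) = real (card (E (\<Union>({y} \<union> fst p)) (snd p)))"
    by (simp add: BK)
qed

lemma card_closed_by_upper:
  assumes "finite H" "H \<subseteq> V" "y \<in> avail H"
  shows "real (card (closed_by H y)) \<le> open_sum H (r - 2) y + \<nu> * N"
proof -
  have yV: "y \<in> V" using assms avail_D by auto
  let ?I = "ext_fam H {y} (r - 2) \<kappa>"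
  let ?X = "\<lambda>p. avail H \<inter> E (\<Union>({y} \<union> fst p)) (snd p)"
  have "closed_by H y \<subseteq> {A \<in> V. \<kappa> < card (A \<inter> y)} \<union> (\<Union>p\<in>?I. ?X p)"
  proof
    fix A assume A: "A \<in> closed_by H y"
    then have AV: "A \<in> avail H" "A \<in> V" using avail_D by (auto simp: closed_by_def)
    show "A \<in> {A \<in> V. \<kappa> < card (A \<inter> y)} \<union> (\<Union>p\<in>?I. ?X p)"
    proof (cases "\<kappa> < card (A \<inter> y)")
      case False
      then have "A \<noteq> y" using V_D(2)[OF yV] w_ge \<kappa>_pos by auto
      then obtain B K where B: "B \<subseteq> H" "card B = r - 2" "sunflower_with (insert A (insert y B)) K"
        using closed_by_witness[OF assms(3) A] by blast
      have "A \<notin> insert y B" using B(1) avail_D(2)[OF AV(1)] \<open>A \<noteq> y\<close> by blast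
      then have sf: "sunflower_with (insert y B) K" "A \<inter> \<Union>(insert y B) = K"
        using B(3) sunflower_with_insert[of A "insert y B" K] by auto
      have "K \<subseteq> A \<inter> y" using B(3) unfolding sunflower_with_def by auto
      then have "card K \<le> \<kappa>" "K \<subseteq> U"
        using False card_mono[of "A \<inter> y" K] V_D[OF yV] by auto
      moreover have "B \<subseteq> H - {y}" using B avail_D(2)[OF assms(3)] by auto
      ultimately have "(B, K) \<in> ?I" using B sf by (simp add: ext_fam_def)
      moreover have "A \<in> ?X (B, K)" using AV sf by (simp add: E_def)
      ultimately show ?thesis by blast
    qed (use AV in blast)
  qed
  then have "card (closed_by H y) \<le> card ({A \<in> V. \<kappa> < card (A \<inter> y)} \<union> (\<Union>p\<in>?I. ?X p))"
    using finite_V finite_ext_fam[OF assms(1)] by (intro card_mono) auto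
  also have "\<dots> \<le> card {A \<in> V. \<kappa> < card (A \<inter> y)} + (\<Sum>p\<in>?I. card (?X p))"
    using finite_ext_fam[OF assms(1)]
    by (intro order_trans[OF card_Un_le] add_mono order.refl card_UN_le)
  finally have "real (card (closed_by H y)) \<le> real (card {A \<in> V. \<kappa> < card (A \<inter> y)}) + (\<Sum>p\<in>?I. real (card (?X p)))"
    by (simp flip: of_nat_sum of_nat_add)
  then show ?thesis using card_near_le[OF yV] by (simp add: open_sum_last)
qed

text \<open>The multiplicities in \<open>open_sum\<close> are corrected by pairwise overlaps. These
  are counted over all sets, available or not, which is affordable because \<open>loss\<close> is
  far below the open proportion.\<close>

lemma card_closed_by_lower:
  assumes cb: "counts_bounded Y H" and Y: "Y \<ge> 1" and H: "finite H" "H \<subseteq> V" "separated H"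
    and y: "y \<in> avail H" "near_ok H y"
  shows "open_sum H (r - 2) y \<le> real (card (closed_by H y)) + loss Y * Wn H (r - 2) y"
proof -
  have yV: "y \<in> V" using y avail_D by auto
  let ?I = "ext_fam H {y} (r - 2) \<kappa>"
  let ?E = "\<lambda>p. E (\<Union>({y} \<union> fst p)) (snd p)"
  let ?X = "\<lambda>p. avail H \<inter> ?E p"
  have finI: "finite ?I" by (rule finite_ext_fam[OF H(1)])
  have sub: "(\<Union>p\<in>?I. ?X p) \<subseteq> closed_by H y"
  proof
    fix A assume "A \<in> (\<Union>p\<in>?I. ?X p)"
    then obtain B K where BK: "(B, K) \<in> ?I" and A: "A \<in> avail H" "A \<inter> \<Union>({y} \<union> B) = K" by (force simp: E_def)
    note val = ext_fam_valid[OF H yV y(2) BK order.refl]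
    have "A \<inter> y = K" using A(2) val(6) by blast
    then have "A \<noteq> y" using val(5) V_D(2)[OF yV] w_ge \<kappa>_pos by auto
    moreover have B: "B \<subseteq> H" "card B = r - 2" using BK by (auto simp: ext_fam_def)
    moreover have "A \<notin> {y} \<union> B" using \<open>A \<noteq> y\<close> B avail_D(2)[OF A(1)] by blast
    then have "sunflower_with (insert A ({y} \<union> B)) K"
      using sunflower_with_insert[of A "{y} \<union> B" K] val(4) A(2) by simp
    ultimately show "A \<in> closed_by H y"
      using closed_by_I[OF y(1) A(1) _ H(1)] by simp
  qed
  have "(\<Sum>p\<in>?I. card (?X p)) \<le> card (\<Union>p\<in>?I. ?X p) + (\<Sum>p\<in>?I. \<Sum>q\<in>?I - {p}. card (?X p \<inter> ?X q))"
    by (rule sum_card_le_card_Union[OF finI]) simp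
  also have "\<dots> \<le> card (closed_by H y) + (\<Sum>p\<in>?I. \<Sum>q\<in>?I - {p}. card (?E p \<inter> ?E q))"
    using sub finite_avail by (intro add_mono sum_mono card_mono) (auto simp: closed_by_def)
  finally have "(\<Sum>p\<in>?I. real (card (?X p))) \<le> real (card (closed_by H y)) + (\<Sum>p\<in>?I. \<Sum>q\<in>?I - {p}. real (card (?E p \<inter> ?E q)))"
    by (simp flip: of_nat_sum of_nat_add)
  also have "(\<Sum>p\<in>?I. \<Sum>q\<in>?I - {p}. real (card (?E p \<inter> ?E q))) \<le> (\<Sum>p\<in>?I. real (card (?E p)) * loss Y)"
    by (intro sum_mono overlap_le[OF cb Y H yV y(2)])
  also have "\<dots> = loss Y * Wn H (r - 2) y"
    by (simp add: Wn_last[OF H yV y(2)] sum_distrib_left mult.commute)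
  finally show ?thesis by (simp add: open_sum_last)
qed

definition "open_tracked q \<epsilon> H \<longleftrightarrow> (\<forall>C K. valid H C K \<longrightarrow>
  \<bar>real (card (avail H \<inter> E (\<Union>C) K)) - q * real (card (E (\<Union>C) K))\<bar> \<le> \<epsilon> * q * real (card (E (\<Union>C) K)))"

text \<open>By \<open>ext_Suc\<close> a full class weighted with \<open>ext (Suc j)\<close>
  contributes \<open>(r - 1 - j) * ext j\<close>, whatever its kernel. Summing the tracked classes
  therefore gives a multiple of \<open>Wn H j u\<close>.\<close>

lemma open_sum_bounds:
  assumes ot: "open_tracked q \<epsilon> H" and H: "finite H" "H \<subseteq> V" "separated H"
    and u: "u \<in> V" "near_ok H u" and j: "j \<le> r - 2"
  shows "\<bar>open_sum H j u - q * real (r - 1 - j) * Wn H j u\<bar> \<le> \<epsilon> * q * real (r - 1 - j) * Wn H j u"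
proof -
  let ?I = "ext_fam H {u} j \<kappa>"
  let ?O = "\<lambda>p. real (card (avail H \<inter> E (\<Union>({u} \<union> fst p)) (snd p)))"
  let ?E = "\<lambda>p. real (card (E (\<Union>({u} \<union> fst p)) (snd p)))"
  let ?x = "\<lambda>p. ext (Suc j) (card (snd p))"
  have xE: "?x p * ?E p = real (r - 1 - j) * ext j (card (snd p))" if "p \<in> ?I" for p
  proof -
    obtain F K where p: "p = (F, K)" by (cases p)
    note val = ext_fam_valid[OF H u that[unfolded p] j]
    have "card (E (\<Union>({u} \<union> F)) K) = e (Suc j) (card K)"
      using val w_ge by (subst card_E_sunflower) auto
    moreover have "real (e (Suc j) (card K)) * ext (Suc j) (card K) = real (r - 1 - j) * ext j (card K)"
      using j r_ge_3 by (intro ext_Suc) linarith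
    ultimately show ?thesis by (simp add: p mult.commute)
  qed
  have sumE: "(\<Sum>p\<in>?I. ?x p * ?E p) = real (r - 1 - j) * Wn H j u"
    unfolding Wn_def ext_sum_def sum_distrib_left by (intro sum.cong refl) (simp only: xE case_prod_unfold)
  have each: "\<bar>?x p * ?O p - q * (?x p * ?E p)\<bar> \<le> \<epsilon> * q * (?x p * ?E p)" if "p \<in> ?I" for p
  proof -
    obtain F K where p: "p = (F, K)" by (cases p)
    have "valid H ({u} \<union> F) K" using ext_fam_valid(1)[OF H u _ j] that p by auto
    from ot[unfolded open_tracked_def, rule_format, OF this]
    have "\<bar>?O p - q * ?E p\<bar> \<le> \<epsilon> * q * ?E p" by (simp add: p)
    then have "?x p * \<bar>?O p - q * ?E p\<bar> \<le> ?x p * (\<epsilon> * q * ?E p)"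
      by (intro mult_left_mono ext_nonneg)
    moreover have "\<bar>?x p * ?O p - q * (?x p * ?E p)\<bar> = \<bar>?x p\<bar> * \<bar>?O p - q * ?E p\<bar>"
      unfolding abs_mult[symmetric] by (simp add: algebra_simps)
    moreover have "\<bar>?x p\<bar> = ?x p" by (simp add: ext_nonneg)
    ultimately show ?thesis by (simp only: mult.assoc mult.left_commute mult.commute)
  qed
  have "open_sum H j u = (\<Sum>p\<in>?I. ?x p * ?O p)" by (simp add: open_sum_def case_prod_unfold)
  then have "open_sum H j u - q * (\<Sum>p\<in>?I. ?x p * ?E p) = (\<Sum>p\<in>?I. ?x p * ?O p - q * (?x p * ?E p))"
    by (simp add: sum_subtractf sum_distrib_left)
  also have "\<bar>\<dots>\<bar> \<le> (\<Sum>p\<in>?I. \<epsilon> * q * (?x p * ?E p))"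
    using each by (intro order_trans[OF sum_abs] sum_mono)
  also have "\<dots> = \<epsilon> * q * (\<Sum>p\<in>?I. ?x p * ?E p)" by (simp add: sum_distrib_left)
  finally show ?thesis unfolding sumE by (simp add: algebra_simps)
qed

end

section \<open>Trajectories and the closing rate\<close>

text \<open>
  Every loss of size \<open>exp (o (w\<^sup>2 / n))\<close> is absorbed in powers of the slack \<open>x\<close>.
\<close>

locale process_params = uniform_family +
  fixes x :: real and T :: nat
  assumes x_ge: "8 \<le> x" "4 * real r \<le> x"
    and T_pos: "1 \<le> T"
    and T_le: "real T \<le> x * exp (real r * lam / 2)"
    and \<omega>_power: "(1 + \<omega>\<^sup>2) ^ w \<le> x"
    and L_ge: "1 \<le> Dg * (real T / N) ^ (r - 1)"
    and L_le: "exp ((22 + 7 * real r) * 2 ^ r * (Dg * (real T / N) ^ (r - 1))) \<le> x"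
    and rate_le: "2 ^ r * (Dg * (real T / N) ^ (r - 1)) / real T * x ^ 8 \<le> 1"
    and loss_le: "loss (x ^ 4) * x ^ 8 \<le> 1"
    and \<nu>_le: "\<nu> * (real T)\<^sup>2 * x ^ 8 \<le> 1"
begin

text \<open>If every set were selected with probability \<open>T / N\<close>, this would be the mean
  number of sunflowers through a given set, with small kernel, whose other members are all
  selected.\<close>

definition "L = Dg * (real T / N) ^ (r - 1)"
text \<open>A bound for the closing rate that is uniform over the run; \<open>2 ^ r\<close>
  dominates every \<open>xt j i\<close>.\<close>

definition "\<eta> = 2 ^ r * L / real T"
text \<open>\<open>pot_W_step\<close> needs \<open>7 * r\<close>, namely \<open>5 * r\<close> for
  the drift and \<open>2 * r\<close> for the second moment; \<open>pot_open_step\<close> needs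
  \<open>9 + 3 = 12\<close>.\<close>

definition "cK = 22 + 7 * real r"
text \<open>A discrete form of \<open>(r - 1 choose j) * (i / T) ^ j\<close>. The falling factorial
  makes the recursion \<open>xt_step\<close> exact, so no discretisation error arises.\<close>

definition "xt j i = real ((r - 1) choose j) * fact j * real (i choose j) / real T ^ j"
definition "hb i = L * xt (r - 2) i / real T"
definition "q i = (\<Prod>l<i. 1 - hb l)"
definition "\<epsilon> i = (1 + cK * \<eta>) ^ i / x\<^sup>2"
definition "sig j = Dg * (real T / N) ^ j"
text \<open>Against the initial tolerance \<open>1 / x ^ 2\<close> this weight gives the exponent
  \<open>x\<close>; against increments of at most \<open>1 / x ^ 5\<close> it leaves the
  second-moment factor \<open>1 / x ^ 2\<close>, which never exceeds the tolerance.\<close>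

definition "\<theta> = x ^ 3"

lemma x_pos: "x > 0" using x_ge by linarith

lemma L_bounds: "1 \<le> L" "exp (cK * 2 ^ r * L) \<le> x"
  using L_ge L_le by (simp_all add: L_def cK_def)

lemma cK_ge: "22 \<le> cK" "7 * real r + 22 \<le> cK" by (simp_all add: cK_def)

lemma \<eta>_pos: "\<eta> > 0" using L_bounds T_pos by (simp add: \<eta>_def)

lemma \<eta>_T: "\<eta> * real T = 2 ^ r * L" using T_pos by (simp add: \<eta>_def)

lemma \<eta>_le: "\<eta> * x ^ 8 \<le> 1" using rate_le by (simp add: \<eta>_def L_def)

lemma x_power_ge: "x \<le> x ^ 8" "8 \<le> x ^ 8"
proof -
  show "x \<le> x ^ 8" using power_increasing[of 1 8 x] x_ge by simp
  then show "8 \<le> x ^ 8" using x_ge by linarith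
qed

lemma \<eta>_le_eighth: "\<eta> \<le> 1 / 8"
proof -
  have "\<eta> * 8 \<le> \<eta> * x ^ 8" using \<eta>_pos x_power_ge by (intro mult_left_mono) auto
  then show ?thesis using \<eta>_le by linarith
qed

lemma inverse_T_le: "2 ^ r / real T \<le> \<eta>"
  using L_bounds(1) T_pos by (simp add: \<eta>_def divide_right_mono)

lemma xt_nonneg: "xt j i \<ge> 0" by (simp add: xt_def)

lemma xt_le:
  assumes "i \<le> T"
  shows "xt j i \<le> 2 ^ r"
proof -
  have "fact j * (i choose j) \<le> T ^ j"
    using binomial_fact_pow[of i j] power_mono[OF assms, of j] by (simp add: mult.commute)
  then have "fact j * real (i choose j) \<le> real T ^ j"
    by (metis of_nat_fact of_nat_le_iff of_nat_mult of_nat_power)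
  moreover have "real ((r - 1) choose j) \<le> 2 ^ r"
  proof -
    have "(r - 1) choose j \<le> 2 ^ (r - 1)" by (rule binomial_le_pow2)
    also have "\<dots> \<le> 2 ^ r" by (intro power_increasing) auto
    finally show ?thesis by (metis of_nat_le_iff of_nat_numeral of_nat_power)
  qed
  ultimately have "real ((r - 1) choose j) * (fact j * real (i choose j)) \<le> 2 ^ r * real T ^ j"
    by (intro mult_mono) auto
  then show ?thesis using T_pos by (simp add: xt_def field_simps)
qed

lemma xt_0: "xt 0 i = 1" by (simp add: xt_def)

lemma xt_at_0: "1 \<le> j \<Longrightarrow> xt j 0 = 0" by (simp add: xt_def)

lemma xt_step:
  assumes "Suc j < r"
  shows "xt (Suc j) (Suc i) = xt (Suc j) i + real (r - 1 - j) * xt j i / real T"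
proof -
  have "Suc j * ((r - 1) choose Suc j) = (r - 1 - j) * ((r - 1) choose j)"
  proof -
    have r1: "Suc (r - 2) = r - 1" using assms by simp
    have "Suc j * ((r - 1) choose Suc j) = (r - 1) * ((r - 2) choose j)"
      using Suc_times_binomial_eq[of "r - 2" j] unfolding r1 by (simp add: mult.commute)
    also have "\<dots> = (r - 1 - j) * ((r - 1) choose j)"
      using binomial_absorb_comp[of "r - 1" j] by (simp add: numeral_2_eq_2)
    finally show ?thesis .
  qed
  then have "real (Suc j) * real ((r - 1) choose Suc j) = real (r - 1 - j) * real ((r - 1) choose j)"
    by (metis of_nat_mult)
  then have *: "real ((r - 1) choose Suc j) * fact (Suc j) = real (r - 1 - j) * (real ((r - 1) choose j) * fact j)"
    using arg_cong[of _ _ "\<lambda>t. t * fact j"] by (simp only: fact_Suc of_nat_mult mult.assoc mult.commute mult.left_commute)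
  have "xt (Suc j) (Suc i) - xt (Suc j) i
      = (real ((r - 1) choose Suc j) * fact (Suc j)) * real (i choose j) / real T ^ Suc j"
    unfolding xt_def by (simp add: diff_divide_distrib[symmetric] algebra_simps del: fact_Suc power_Suc)
  also have "\<dots> = real (r - 1 - j) * xt j i / real T"
    unfolding * by (simp add: xt_def mult.commute mult.left_commute)
  finally show ?thesis by simp
qed

lemma hb_nonneg: "hb i \<ge> 0"
  using L_bounds(1) xt_nonneg by (simp add: hb_def)

lemma hb_le: "i \<le> T \<Longrightarrow> hb i \<le> \<eta>"
  unfolding hb_def \<eta>_def using xt_le[of i "r - 2"] L_bounds(1)
  by (intro divide_right_mono) (auto simp: mult.commute)

lemma hb_le_eighth: "i \<le> T \<Longrightarrow> hb i \<le> 1 / 8"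
  using hb_le[of i] \<eta>_le_eighth by linarith

lemma q_Suc: "q (Suc i) = q i * (1 - hb i)"
  by (simp add: q_def)

lemma q_0: "q 0 = 1" by (simp add: q_def)

lemma one_minus_ge_exp:
  fixes t :: real
  assumes "0 \<le> t" "t \<le> 1 / 2"
  shows "exp (- 2 * t) \<le> 1 - t"
proof -
  have "exp (- 2 * t) = inverse (exp (2 * t))" by (simp add: exp_minus)
  also have "\<dots> \<le> inverse (1 + 2 * t)"
    using assms exp_ge_add_one_self[of "2 * t"] by (intro le_imp_inverse_le) auto
  also have "\<dots> \<le> 1 - t"
  proof -
    have "(1 - t) * (1 + 2 * t) = 1 + t * (1 - 2 * t)" by (simp add: algebra_simps)
    also have "\<dots> \<ge> 1" using assms by simp
    finally show ?thesis using assms by (simp add: inverse_eq_divide divide_le_eq)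
  qed
  finally show ?thesis .
qed

lemma q_ge:
  assumes "i \<le> T"
  shows "1 / x \<le> q i"
proof -
  have ge: "exp (- 2 * \<eta>) \<le> 1 - hb l" if "l < i" for l
    using one_minus_ge_exp[of \<eta>] \<eta>_pos \<eta>_le_eighth hb_le[of l] that assms by auto
  have "1 / x \<le> exp (- (cK * 2 ^ r * L))"
    using L_bounds(2) x_pos by (simp add: exp_minus inverse_eq_divide divide_left_mono)
  also have "\<dots> \<le> exp (- 2 * \<eta> * real i)"
  proof -
    have "2 * \<eta> * real i \<le> 2 * (\<eta> * real T)" using assms \<eta>_pos by simp
    also have "\<dots> \<le> cK * (2 ^ r * L)"
      unfolding \<eta>_T using cK_ge L_bounds(1) by (intro mult_right_mono) auto
    finally show ?thesis by (simp add: mult.assoc)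
  qed
  also have "\<dots> = (\<Prod>l<i. exp (- 2 * \<eta>))" by (simp add: exp_of_nat_mult[symmetric] mult.commute)
  also have "\<dots> \<le> q i" unfolding q_def using ge by (intro prod_mono) auto
  finally show ?thesis .
qed

lemma q_pos: "i \<le> T \<Longrightarrow> q i > 0"
  using q_ge[of i] x_pos by (meson divide_pos_pos less_le_trans zero_less_one)

lemma q_ratio:
  assumes "i < T" shows "q i \<le> 8 / 7 * q (Suc i)"
proof -
  have "7 / 8 * q i \<le> (1 - hb i) * q i"
    using hb_le_eighth[of i] q_pos[of i] assms by (intro mult_right_mono) auto
  then show ?thesis by (simp add: q_Suc mult.commute)
qed

lemma \<epsilon>_Suc: "\<epsilon> (Suc i) = \<epsilon> i + cK * \<eta> * \<epsilon> i"
  by (simp add: \<epsilon>_def algebra_simps add_divide_distrib)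

lemma \<epsilon>_0: "\<epsilon> 0 = 1 / x\<^sup>2" by (simp add: \<epsilon>_def)

lemma \<epsilon>_ge: "1 / x\<^sup>2 \<le> \<epsilon> i"
  unfolding \<epsilon>_def using cK_ge \<eta>_pos by (intro divide_right_mono one_le_power) auto

lemma \<epsilon>_pos: "\<epsilon> i > 0"
  using \<epsilon>_ge[of i] x_pos by (meson divide_pos_pos less_le_trans zero_less_one zero_less_power)

text \<open>Over the run the tolerance grows by a factor of at most
  \<open>exp (cK * 2 ^ r * L) \<le> x\<close>. This is what limits \<open>L\<close>, and with it
  \<open>T\<close>.\<close>

lemma \<epsilon>_le:
  assumes "i \<le> T"
  shows "\<epsilon> i \<le> 1 / x" "\<epsilon> i \<le> 1 / 8"
proof -
  have "(1 + cK * \<eta>) ^ i \<le> (1 + cK * \<eta>) ^ T"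
    using assms cK_ge \<eta>_pos by (intro power_increasing) auto
  also have "\<dots> \<le> exp (cK * \<eta>) ^ T"
    using cK_ge \<eta>_pos by (intro power_mono exp_ge_add_one_self) auto
  also have "\<dots> = exp (cK * (\<eta> * real T))" by (simp add: exp_of_nat_mult[symmetric] algebra_simps)
  also have "\<dots> \<le> x" unfolding \<eta>_T using L_bounds(2) by (simp add: mult.assoc)
  finally have "\<epsilon> i \<le> x / x\<^sup>2" unfolding \<epsilon>_def by (intro divide_right_mono) auto
  also have "\<dots> = 1 / x" using x_pos by (simp add: power2_eq_square)
  finally show "\<epsilon> i \<le> 1 / x" .
  also have "\<dots> \<le> 1 / 8" using x_ge by (intro divide_left_mono) auto
  finally show "\<epsilon> i \<le> 1 / 8" .
qed

lemma sig_pos: "sig j > 0"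
  using Dg_pos T_pos N_pos by (simp add: sig_def)

lemma sig_Suc: "sig (Suc j) * N = sig j * real T"
  using N_pos by (simp add: sig_def)

lemma sig_last: "sig (r - 2) = L * N / real T"
proof -
  have "r - 1 = Suc (r - 2)" using r_ge_3 by simp
  then show ?thesis using N_pos T_pos by (simp add: sig_def L_def)
qed

lemma \<nu>_small: "\<nu> * real T * x ^ 6 \<le> \<eta> * \<epsilon> i"
proof -
  have "\<nu> * real T * x ^ 6 = (\<nu> * (real T)\<^sup>2 * x ^ 8) * (1 / real T * (1 / x\<^sup>2))"
    using T_pos x_pos by (simp add: field_simps power2_eq_square eval_nat_numeral)
  also have "\<dots> \<le> 1 * (\<eta> * \<epsilon> i)"
  proof (intro mult_mono \<nu>_le \<epsilon>_ge)
    have "1 / real T \<le> 2 ^ r / real T" by (intro divide_right_mono) auto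
    then show "1 / real T \<le> \<eta>" using inverse_T_le by linarith
  qed (use \<eta>_pos \<epsilon>_pos x_pos in \<open>auto intro: less_imp_le\<close>)
  finally show ?thesis by simp
qed

lemma \<nu>_T_le: "\<nu> \<le> \<nu> * real T"
  using \<nu>_pos T_pos by simp

text \<open>The error is measured in units of \<open>sig j\<close> and not relative to the
  trajectory, because \<open>xt j 0 = 0\<close> for \<open>j \<ge> 1\<close>. The case
  \<open>j = 0\<close> is exact by \<open>Wn_0\<close>.\<close>

definition "W_tracked i H \<longleftrightarrow> (\<forall>u\<in>V. near_ok H u \<longrightarrow> (\<forall>j\<in>{1..r - 2}.
  \<bar>Wn H j u / sig j - xt j i\<bar> \<le> \<epsilon> i))"

definition "good i H \<longleftrightarrow> H \<subseteq> V \<and> card H = i \<and> separated H \<and> counts_bounded (x ^ 4) H \<and>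
  W_tracked i H \<and> open_tracked (q i) (\<epsilon> i) H"

lemma goodD:
  assumes "good i H"
  shows "H \<subseteq> V" "card H = i" "separated H" "counts_bounded (x ^ 4) H" "W_tracked i H"
    "open_tracked (q i) (\<epsilon> i) H" "finite H"
  using assms finite_subset[OF _ finite_V] by (auto simp: good_def)

lemma W_tracked:
  assumes "good i H" "u \<in> V" "near_ok H u" "j \<le> r - 2"
  shows "\<bar>Wn H j u - xt j i * sig j\<bar> \<le> \<epsilon> i * sig j"
proof (cases "j = 0")
  case True
  then show ?thesis
    using Wn_0[OF goodD(7)[OF assms(1)] assms(2)] \<epsilon>_pos[of i] Dg_pos by (simp add: xt_0 sig_def)
next
  case False
  then have "\<bar>Wn H j u / sig j - xt j i\<bar> \<le> \<epsilon> i"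
    using goodD(5)[OF assms(1)] assms unfolding W_tracked_def by auto
  then have "\<bar>Wn H j u / sig j - xt j i\<bar> * sig j \<le> \<epsilon> i * sig j"
    using sig_pos[of j] by (intro mult_right_mono) auto
  moreover have "\<bar>Wn H j u / sig j - xt j i\<bar> * sig j = \<bar>Wn H j u - xt j i * sig j\<bar>"
    using sig_pos[of j] abs_mult[of "Wn H j u / sig j - xt j i" "sig j"] by (simp add: left_diff_distrib)
  ultimately show ?thesis by simp
qed

text \<open>Through the empty test \<open>open_tracked\<close> also controls the number of all
  available sets.\<close>

lemma valid_empty: "valid H {} {}"
  by (simp add: valid_def sunflower_with_def)

lemma card_avail_bounds:
  assumes "good i H" "i < T"
  shows "\<bar>real (card (avail H)) - q i * N\<bar> \<le> \<epsilon> i * q i * N"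
    "7 / 8 * N \<le> real (card (avail H)) * x" "avail H \<noteq> {}"
proof -
  have "avail H \<inter> V = avail H" using avail_D by auto
  then show 1: "\<bar>real (card (avail H)) - q i * N\<bar> \<le> \<epsilon> i * q i * N"
    using goodD(6)[OF assms(1), unfolded open_tracked_def, rule_format, OF valid_empty]
    by (simp add: E_empty)
  have "\<epsilon> i * (q i * N) \<le> 1 / 8 * (q i * N)"
    using \<epsilon>_le(2)[of i] q_pos[of i] N_pos assms(2) by (intro mult_right_mono) auto
  then have "7 / 8 * (q i * N) \<le> real (card (avail H))" using 1 by linarith
  then have "7 / 8 * (q i * N) * x \<le> real (card (avail H)) * x" using x_pos by simp
  moreover have "7 / 8 * N * 1 \<le> 7 / 8 * N * (q i * x)"
    using q_ge[of i] assms(2) x_pos N_pos by (intro mult_left_mono) (auto simp: field_simps)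
  ultimately show 2: "7 / 8 * N \<le> real (card (avail H)) * x" by (simp add: algebra_simps)
  show "avail H \<noteq> {}" using 2 N_pos by auto
qed

text \<open>As \<open>X \<le> f\<close>, the relative errors of numerator and denominator become an
  absolute error \<open>5 * e * f * a\<close> of the quotient, a form that stays meaningful when
  \<open>X\<close> is close to 0.\<close>

lemma quotient_estimate:
  fixes a X f e S Q m :: real
  assumes e: "0 \<le> e" "e \<le> 1 / 8" and f: "8 \<le> f" and X: "0 \<le> X" "X \<le> f" and a: "0 \<le> a"
    and Q: "\<bar>Q - m\<bar> \<le> e * m" and m: "0 < m" and S: "S \<le> (1 + e) * m * (a * (X + e))" 
  shows "S \<le> (a * X + 5 * e * f * a) * Q"
proof -
  have "S \<le> (1 + e) * m * (a * (X + e))" by fact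
  also have "\<dots> = m * (a * ((1 + e) * (X + e)))" by (simp add: algebra_simps)
  also have "\<dots> \<le> m * (a * ((1 - e) * (X + 5 * e * f)))"
  proof (intro mult_left_mono)
    have "0 \<le> e * (5 * f - 1 - 2 * X - e - 5 * e * f)"
    proof (intro mult_nonneg_nonneg e)
      have "e * f \<le> 1 / 8 * f" using e f by (intro mult_right_mono) auto
      then show "0 \<le> 5 * f - 1 - 2 * X - e - 5 * e * f" using e f X by linarith
    qed
    then show "(1 + e) * (X + e) \<le> (1 - e) * (X + 5 * e * f)" by (simp add: algebra_simps)
  qed (use a m in auto)
  also have "\<dots> = (a * X + 5 * e * f * a) * ((1 - e) * m)" by (simp add: algebra_simps)
  also have "\<dots> \<le> (a * X + 5 * e * f * a) * Q"
    using Q a X e f by (intro mult_left_mono add_nonneg_nonneg mult_nonneg_nonneg) (auto simp: algebra_simps)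
  finally show ?thesis .
qed

lemma quotient_estimate_lower:
  fixes a X f e S Q m W :: real
  assumes e: "0 \<le> e" "e \<le> 1 / 8" and f: "8 \<le> f" and X: "0 \<le> X" "X \<le> f" and a: "0 \<le> a"
    and Q: "\<bar>Q - m\<bar> \<le> e * m" and m: "0 < m" and W: "0 \<le> W" "a * (X - e) \<le> W"
    and S: "(1 - 2 * e) * m * W \<le> S"
  shows "(a * X - 4 * e * f * a) * Q \<le> S"
proof -
  have Q0: "0 \<le> Q" "Q \<le> (1 + e) * m"
  proof -
    have "e * m \<le> 1 / 8 * m" using e m by (intro mult_right_mono) auto
    then show "0 \<le> Q" using Q m by linarith
    show "Q \<le> (1 + e) * m" using Q by (simp add: algebra_simps)
  qed
  have "a * X - 4 * e * f * a = a * (X - 4 * e * f)" by (simp add: algebra_simps)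
  also have "\<dots> \<le> a * ((1 - 3 * e) * (X - e))"
  proof (intro mult_left_mono a)
    have "0 \<le> e * (4 * f - 1 - 3 * X) + 3 * e\<^sup>2" using e f X by (intro add_nonneg_nonneg mult_nonneg_nonneg) auto
    then show "X - 4 * e * f \<le> (1 - 3 * e) * (X - e)" by (simp add: algebra_simps power2_eq_square)
  qed
  also have "\<dots> = (1 - 3 * e) * (a * (X - e))" by simp
  also have "\<dots> \<le> (1 - 3 * e) * W" using W e by (intro mult_left_mono) auto
  finally have "(a * X - 4 * e * f * a) * Q \<le> ((1 - 3 * e) * W) * Q" using Q0 by (intro mult_right_mono) auto
  also have "\<dots> \<le> ((1 - 3 * e) * W) * ((1 + e) * m)" using Q0 W e by (intro mult_left_mono) auto
  also have "\<dots> = ((1 - 3 * e) * (1 + e)) * (m * W)" by (simp add: algebra_simps)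
  also have "\<dots> \<le> (1 - 2 * e) * (m * W)"
    using W m e by (intro mult_right_mono) (auto simp: algebra_simps)
  also have "\<dots> \<le> S" using S by (simp add: algebra_simps)
  finally show ?thesis .
qed

lemma pow2_r_ge: "(8::real) \<le> 2 ^ r"
  using power_increasing[of 3 r "2::real"] r_ge_3 by simp

text \<open>
  The rate does not depend on \<open>y\<close>, so all tracked proportions of available sets decay alike; this
  is what closes the induction over the steps.
\<close>
lemma closing_rate:
  assumes g: "good i H" and i: "i < T" and y: "y \<in> avail H" "near_ok H y"
  shows "\<bar>real (card (closed_by H y)) / real (card (avail H)) - hb i\<bar> \<le> 6 * \<epsilon> i * \<eta>"
proof -
  note gd = goodD[OF g]
  have yV: "y \<in> V" using y avail_D by auto
  define W where "W = Wn H (r - 2) y"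
  define S where "S = open_sum H (r - 2) y"
  define Q where "Q = real (card (avail H))"
  define a where "a = L / real T"
  define e where "e = \<epsilon> i"
  define X where "X = xt (r - 2) i"
  have e: "0 \<le> e" "e \<le> 1 / 8" using \<epsilon>_pos[of i] \<epsilon>_le(2)[of i] i by (auto simp: e_def)
  have X: "0 \<le> X" "X \<le> 2 ^ r" using xt_nonneg xt_le[of i] i by (auto simp: X_def)
  have a: "0 \<le> a" using L_bounds by (simp add: a_def)
  have qp: "0 < q i" using q_pos i by simp
  have m: "0 < q i * N" using qp N_pos by simp
  note cav = card_avail_bounds[OF g i]
  have Q: "\<bar>Q - q i * N\<bar> \<le> e * (q i * N)" using cav(1) by (simp add: Q_def e_def mult.assoc)
  have Qpos: "0 < Q" using cav(3) finite_avail by (simp add: Q_def card_gt_0_iff)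
  have hb: "hb i = a * X" by (simp add: hb_def a_def X_def)
  have eta: "\<eta> = 2 ^ r * a" by (simp add: \<eta>_def a_def)
  have r12: "real (r - 1 - (r - 2)) = 1" using r_ge_3 by simp
  have S: "\<bar>S - q i * W\<bar> \<le> e * q i * W"
    using open_sum_bounds[OF gd(6,7,1,3) yV y(2) order.refl] by (simp only: r12 mult_1_right S_def W_def e_def)
  have W0: "0 \<le> W" unfolding W_def Wn_def by (intro ext_sum_nonneg ext_nonneg)
  have sig: "sig (r - 2) = a * N" by (simp add: sig_last a_def)
  have Wb: "W \<le> a * (X + e) * N" "a * (X - e) * N \<le> W"
    using W_tracked[OF g yV y(2) order.refl] by (auto simp: W_def X_def e_def sig algebra_simps)
  have "S \<le> (1 + e) * (q i * N) * (a * (X + e))"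
  proof -
    have "S \<le> (1 + e) * q i * W" using S by (simp add: algebra_simps)
    also have "\<dots> \<le> (1 + e) * q i * (a * (X + e) * N)"
      using Wb(1) qp e by (intro mult_left_mono) auto
    finally show ?thesis by (simp add: algebra_simps)
  qed
  from quotient_estimate[OF e pow2_r_ge X a Q m this]
  have up: "S \<le> (hb i + 5 * e * \<eta>) * Q" by (simp add: hb eta mult.assoc)
  \<comment> \<open>Sets with large intersection cost one further \<open>e * \<eta>\<close>, which
    raises the constant from 5 to 6.\<close>
  have nuN: "\<nu> * N \<le> e * \<eta> * Q"
  proof -
    have "\<nu> * N \<le> \<nu> * (2 * x * Q)"
    proof (intro mult_left_mono)
      have "2 * (7 / 8 * N) \<le> 2 * (Q * x)" using cav(2) unfolding Q_def by (intro mult_left_mono) auto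
      then show "N \<le> 2 * x * Q" using N_pos by (simp add: algebra_simps)
    qed (use \<nu>_pos in auto)
    also have "\<dots> = (\<nu> * (2 * x)) * Q" by simp
    also have "\<nu> * (2 * x) \<le> (\<nu> * real T) * x ^ 6"
    proof (intro mult_mono \<nu>_T_le)
      have "2 * x \<le> x * x" using x_ge by (intro mult_right_mono) auto
      also have "\<dots> \<le> x ^ 6" using power_increasing[of 2 6 x] x_ge by (simp add: power2_eq_square)
      finally show "2 * x \<le> x ^ 6" .
    qed (use \<nu>_pos x_pos in auto)
    also have "\<dots> \<le> e * \<eta>" using \<nu>_small[of i] by (simp add: e_def mult.commute)
    finally show ?thesis using Qpos by (simp add: mult_right_mono)
  qed
  have upper: "real (card (closed_by H y)) \<le> (hb i + 6 * e * \<eta>) * Q"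
    using card_closed_by_upper[OF gd(7,1) y(1)] up nuN by (simp add: S_def algebra_simps)
  \<comment> \<open>The overlaps were bounded without regard to availability; relating them to
    available sets costs a factor \<open>1 / q i \<le> x\<close>.\<close>
  have "loss (x ^ 4) \<le> e * q i"
  proof -
    have "loss (x ^ 4) \<le> 1 / x ^ 8" using loss_le x_pos by (simp add: field_simps)
    also have "\<dots> \<le> 1 / x ^ 3" using x_ge by (intro divide_left_mono power_increasing) auto
    also have "\<dots> = (1 / x\<^sup>2) * (1 / x)" by (simp add: power_def eval_nat_numeral)
    also have "\<dots> \<le> e * q i" unfolding e_def using q_ge[of i] i \<epsilon>_ge \<epsilon>_pos[of i] x_pos
      by (intro mult_mono) auto
    finally show ?thesis .
  qed
  then have "loss (x ^ 4) * W \<le> e * q i * W" using W0 by (intro mult_right_mono)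
  moreover have "S \<le> real (card (closed_by H y)) + loss (x ^ 4) * W"
    unfolding S_def W_def using x_ge by (intro card_closed_by_lower[OF gd(4) _ gd(7,1,3) y]) auto
  ultimately have lo: "(1 - 2 * e) * (q i * N) * (W / N) \<le> real (card (closed_by H y))"
    using S N_pos by (simp add: algebra_simps)
  have "a * (X - e) \<le> W / N" using Wb(2) N_pos by (simp add: field_simps)
  moreover have "0 \<le> W / N" using W0 by simp
  ultimately have "(a * X - 4 * e * 2 ^ r * a) * Q \<le> real (card (closed_by H y))"
    using quotient_estimate_lower[OF e pow2_r_ge X a Q m _ _ lo] by blast
  then have lower: "(hb i - 4 * e * \<eta>) * Q \<le> real (card (closed_by H y))"
    by (simp add: hb eta mult.assoc)
  have "hb i - 4 * e * \<eta> \<le> real (card (closed_by H y)) / Q" using lower Qpos by (simp add: field_simps)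
  moreover have "real (card (closed_by H y)) / Q \<le> hb i + 6 * e * \<eta>" using upper Qpos by (simp add: field_simps)
  moreover have "0 \<le> e * \<eta>" using e \<eta>_pos by simp
  ultimately show ?thesis by (simp add: Q_def e_def abs_le_iff)
qed

end

section \<open>One step of the tracked quantities\<close>

text \<open>Here \<open>c\<close> is the predicted change, \<open>D\<close> the true mean change and
  \<open>g\<close> the growth of the tolerance in one step, which has to pay for the drift error
  \<delta> and for the second moment, at most \<open>\<beta> * D\<close>.\<close>

lemma average_track:
  fixes d \<phi> :: "'b \<Rightarrow> real"
  assumes X: "finite X" "X \<noteq> {}"
    and d: "\<And>A. A \<in> X \<Longrightarrow> 0 \<le> d A" "\<And>A. A \<in> X \<Longrightarrow> d A \<le> b"
    and s: "s = 1 \<or> s = -1" and \<theta>: "0 \<le> \<theta>" "\<theta> * b \<le> \<beta>" "\<beta> \<le> 1"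
    and D: "D = (\<Sum>A\<in>X. d A) / real (card X)" "\<bar>c - D\<bar> \<le> \<delta>" "\<delta> + \<beta> * D \<le> g"
    and \<phi>: "\<And>A. A \<in> X \<Longrightarrow> \<phi> A \<le> exp (\<theta> * (Z - g + s * (c - d A)))"
  shows "(\<Sum>A\<in>X. \<phi> A) / real (card X) \<le> exp (\<theta> * Z)"
proof -
  have card: "real (card X) > 0" using X by (simp add: card_gt_0_iff)
  have D0: "0 \<le> D" using d(1) D(1) by (simp add: sum_nonneg)
  let ?k = "exp (\<theta> * (Z - g + s * c))"
  have "(\<Sum>A\<in>X. \<phi> A) / real (card X) \<le> (\<Sum>A\<in>X. ?k * exp ((- s * \<theta>) * d A)) / real (card X)"
    using \<phi> by (intro divide_right_mono sum_mono) (auto simp: mult_exp_exp algebra_simps)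
  also have "\<dots> = ?k * ((\<Sum>A\<in>X. exp ((- s * \<theta>) * d A)) / real (card X))"
    by (simp add: sum_distrib_left)
  also have "\<dots> \<le> ?k * exp ((- s * \<theta>) * D + \<theta>\<^sup>2 * b * D)"
    unfolding D(1) using X d s \<theta> by (intro mult_left_mono average_exp_le) auto
  also have "\<dots> = exp (\<theta> * (Z - g + s * (c - D) + \<theta> * b * D))"
    by (simp add: mult_exp_exp algebra_simps power2_eq_square)
  also have "\<dots> \<le> exp (\<theta> * Z)"
  proof -
    have "s * (c - D) \<le> \<delta>" using s D(2) by auto
    moreover have "\<theta> * b * D \<le> \<beta> * D" using \<theta> D0 by (intro mult_right_mono) auto
    ultimately have "Z - g + s * (c - D) + \<theta> * b * D \<le> Z" using D(3) by linarith
    then show ?thesis using \<theta>(1) by (simp add: mult_left_mono)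
  qed
  finally show ?thesis .
qed

section \<open>Proportions of available sets\<close>

context process_params
begin

text \<open>A dropped test has potential 0 and, by \<open>valid_mono\<close>, never becomes valid
  again.\<close>

definition "pot_open s i H C K = (if valid H C K then
  exp (\<theta> * (s * (real (card (avail H \<inter> E (\<Union>C) K)) / (real (card (E (\<Union>C) K)) * q i) - 1) - \<epsilon> i)) else 0)"

lemma valid_mono:
  assumes "valid G C K" "H \<subseteq> G"
  shows "valid H C K"
proof -
  have "C \<subseteq> V" using assms by (simp add: valid_def)
  then have "finite C" using finite_V finite_subset by blast
  then have "card (C \<inter> H) \<le> card (C \<inter> G)" using assms(2) by (intro card_mono) auto
  then show ?thesis using assms unfolding valid_def by fastforce
qed

lemma valid_E_pos: "valid H C K \<Longrightarrow> 0 < card (E (\<Union>C) K)"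
  using w_ge V_D(1) by (intro E_pos card_Union_le) (auto simp: valid_def)

text \<open>Exchanging the roles of the chosen and the closed set by \<open>closed_by_sym\<close>
  expresses the mean loss of \<open>X\<close> through the closing rates of its available
  members.\<close>

lemma sum_card_closed_by:
  "(\<Sum>A\<in>avail H. card (X \<inter> closed_by H A)) = (\<Sum>y\<in>avail H \<inter> X. card (closed_by H y))"
proof -
  have "(\<Sum>A\<in>avail H. card (X \<inter> closed_by H A)) = (\<Sum>A\<in>avail H. \<Sum>y\<in>{y \<in> avail H \<inter> X. y \<in> closed_by H A}. 1)"
    by (intro sum.cong refl) (auto simp: closed_by_def intro!: arg_cong[of _ _ card])
  also have "\<dots> = (\<Sum>y\<in>avail H \<inter> X. \<Sum>A\<in>{A \<in> avail H. y \<in> closed_by H A}. 1)"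
    using finite_avail by (intro sum.swap_restrict) auto
  also have "\<dots> = (\<Sum>y\<in>avail H \<inter> X. card (closed_by H y))"
  proof (intro sum.cong refl)
    fix y assume "y \<in> avail H \<inter> X"
    then have "{A \<in> avail H. y \<in> closed_by H A} = closed_by H y"
      using closed_by_sym by (auto simp: closed_by_def)
    then show "(\<Sum>A\<in>{A \<in> avail H. y \<in> closed_by H A}. 1) = card (closed_by H y)" by simp
  qed
  finally show ?thesis .
qed

text \<open>The closing rate is known for \<open>near_ok\<close> sets only; this bounds the
  exceptions.\<close>

lemma card_near_family:
  assumes "H \<subseteq> V" "finite H" "valid H C K"
  shows "real (card {y \<in> E (\<Union>C) K. \<not> near_ok H y}) \<le> real (card H) * \<nu> * real (card (E (\<Union>C) K))"
proof -
  have C: "C \<subseteq> V" "card C \<le> r - 1" "K \<subseteq> \<Union>C" "card K \<le> \<kappa>" using assms(3) by (auto simp: valid_def)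
  have "finite C" using C finite_V finite_subset by blast
  then have finKC: "finite (\<Union>C)" using C(1) V_D(3) by (intro finite_Union) auto
  then have finK: "finite K" using C finite_subset by blast
  have CU: "\<Union>C \<subseteq> U" using C(1) V_D(1) by blast
  have sub: "{y \<in> E (\<Union>C) K. \<not> near_ok H y} \<subseteq> (\<Union>A\<in>H. {y \<in> E (\<Union>C) K. \<kappa> < card (y \<inter> A - \<Union>C)})"
  proof
    fix y assume y: "y \<in> {y \<in> E (\<Union>C) K. \<not> near_ok H y}"
    then obtain A where A: "A \<in> H" "2 * \<kappa> < card (A \<inter> y)" by (auto simp: near_ok_def not_le)
    have yE: "y \<in> V" "y \<inter> \<Union>C = K" using y by (auto simp: E_def)
    have "A \<inter> y \<subseteq> (y \<inter> A - \<Union>C) \<union> K" using yE by blast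
    then have "card (A \<inter> y) \<le> card ((y \<inter> A - \<Union>C) \<union> K)"
      using V_D(3)[OF yE(1)] finK by (intro card_mono) auto
    also have "\<dots> \<le> card (y \<inter> A - \<Union>C) + card K" by (rule card_Un_le)
    finally have "\<kappa> < card (y \<inter> A - \<Union>C)" using A C by linarith
    then show "y \<in> (\<Union>A\<in>H. {y \<in> E (\<Union>C) K. \<kappa> < card (y \<inter> A - \<Union>C)})" using A y by blast
  qed
  have "card {y \<in> E (\<Union>C) K. \<not> near_ok H y} \<le> (\<Sum>A\<in>H. card {y \<in> E (\<Union>C) K. \<kappa> < card (y \<inter> A - \<Union>C)})"
    using assms(2) by (intro order_trans[OF card_mono[OF _ sub]] card_UN_le) auto
  then have "real (card {y \<in> E (\<Union>C) K. \<not> near_ok H y}) \<le> (\<Sum>A\<in>H. real (card {y \<in> E (\<Union>C) K. \<kappa> < card (y \<inter> A - \<Union>C)}))"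
    by (simp flip: of_nat_sum)
  also have "\<dots> \<le> (\<Sum>A\<in>H. \<nu> * real (card (E (\<Union>C) K)))"
    using assms C CU card_Union_le[OF C(1,2)] by (intro sum_mono near_tail) auto
  finally show ?thesis by simp
qed

lemma card_newly_invalid:
  assumes "H \<subseteq> V" "valid H C K"
  shows "real (card {A \<in> avail H. \<not> valid (insert A H) C K}) \<le> real r * \<nu> * N"
proof -
  have C: "C \<subseteq> V" "card C \<le> r - 1" using assms(2) by (auto simp: valid_def)
  have finC: "finite C" using C finite_V finite_subset by blast
  have sub: "{A \<in> avail H. \<not> valid (insert A H) C K} \<subseteq> (\<Union>v\<in>C. {A \<in> V. \<kappa> < card (A \<inter> v)})"
  proof
    fix A assume A: "A \<in> {A \<in> avail H. \<not> valid (insert A H) C K}"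
    then have AV: "A \<in> V" using avail_D by auto
    show "A \<in> (\<Union>v\<in>C. {A \<in> V. \<kappa> < card (A \<inter> v)})"
    proof (cases "A \<in> C")
      \<comment> \<open>A member of \<open>C\<close> meets itself in \<open>w > \<kappa>\<close>
        points, so choosing it is covered by the same union.\<close>
      case True
      then show ?thesis using AV V_D(2)[OF AV] w_ge \<kappa>_pos by force
    next
      case False
      then have "C \<inter> insert A H = C \<inter> H" by blast
      then have "\<not> (\<forall>A'\<in>insert A H - C. \<forall>v\<in>C. card (A' \<inter> v) \<le> 2 * \<kappa>)"
        using A assms(2) unfolding valid_def by simp
      then obtain A' v where v: "A' \<in> insert A H - C" "v \<in> C" "2 * \<kappa> < card (A' \<inter> v)"
        by (auto simp: not_le)
      moreover have "A' \<notin> H" using v assms(2) unfolding valid_def by (metis DiffD2 DiffI not_le)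
      ultimately have "A' = A" "v \<in> C" "\<kappa> < card (A \<inter> v)" by auto
      then show ?thesis using AV by blast
    qed
  qed
  have "card {A \<in> avail H. \<not> valid (insert A H) C K} \<le> (\<Sum>v\<in>C. card {A \<in> V. \<kappa> < card (A \<inter> v)})"
    using finC finite_V by (intro order_trans[OF card_mono[OF _ sub]] card_UN_le) auto
  then have "real (card {A \<in> avail H. \<not> valid (insert A H) C K}) \<le> (\<Sum>v\<in>C. real (card {A \<in> V. \<kappa> < card (A \<inter> v)}))"
    by (simp flip: of_nat_sum)
  also have "\<dots> \<le> (\<Sum>v\<in>C. \<nu> * N)" using C by (intro sum_mono card_near_le) auto
  also have "\<dots> = real (card C) * (\<nu> * N)" by simp
  also have "\<dots> \<le> real r * (\<nu> * N)" using C \<nu>_pos by (intro mult_right_mono) auto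
  finally show ?thesis by (simp add: mult.assoc)
qed

lemma inverse_card_avail_le:
  assumes "good i H" "i < T" "0 \<le> t" "t \<le> z * N" "0 \<le> z"
  shows "t / real (card (avail H)) \<le> 8 / 7 * x * z"
proof -
  note cav = card_avail_bounds[OF assms(1,2)]
  have Q: "0 < real (card (avail H))" using cav(3) finite_avail by (simp add: card_gt_0_iff)
  have "z * (7 / 8 * N) \<le> z * (real (card (avail H)) * x)" using cav(2) assms(5) by (rule mult_left_mono)
  then have "t \<le> 8 / 7 * x * z * real (card (avail H))" using assms(4) by (simp add: algebra_simps)
  then show ?thesis using Q by (simp add: divide_le_eq)
qed

text \<open>Apart from few exceptions, every available set of the class is closed with probability
  close to \<open>hb i\<close>. The mean loss is therefore close to \<open>hb i\<close> times their
  number, and \<open>q\<close> decreases by exactly this factor.\<close>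

lemma pot_open_step:
  assumes g: "good i H" and i: "i < T" and s: "s = 1 \<or> s = -1"
  shows "(\<Sum>A\<in>avail H. pot_open s (Suc i) (insert A H) C K) / real (card (avail H)) \<le> pot_open s i H C K"
proof (cases "valid H C K")
  case False
  then have "\<not> valid (insert A H) C K" for A using valid_mono[of "insert A H" C K H] by blast
  then show ?thesis using False by (simp add: pot_open_def)
next
  case val: True
  note gd = goodD[OF g]
  define c0 where "c0 = real (card (E (\<Union>C) K))"
  define Q where "Q = real (card (avail H))"
  define Ow where "Ow = real (card (avail H \<inter> E (\<Union>C) K))"
  define q' where "q' = q (Suc i)"
  define cl where "cl A = real (card (E (\<Union>C) K \<inter> closed_by H A))" for A
  \<comment> \<open>If the new set drops the test, the potential becomes 0, so the change may be set
    to 0; \<open>card_closed_by_le\<close> gives no bound in that case.\<close>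
  define d where "d A = (if valid (insert A H) C K then cl A / (c0 * q') else 0)" for A
  define D where "D = (\<Sum>A\<in>avail H. d A) / Q"
  \<comment> \<open>With the later value \<open>q'\<close> in the denominator the predicted change
    is an exact identity: \<open>Ow / (c0 * q i) = Ow / (c0 * q') - c\<close>.\<close>
  define c where "c = Ow * hb i / (c0 * q')"
  have c0: "0 < c0" using valid_E_pos[OF val] by (simp add: c0_def)
  have qp: "0 < q i" "0 < q'" "1 / x \<le> q'" "q i \<le> 8 / 7 * q'"
    using q_pos[of i] q_pos[of "Suc i"] q_ge[of "Suc i"] q_ratio[OF i] i by (auto simp: q'_def)
  have Qpos: "0 < Q" using card_avail_bounds(3)[OF g i] finite_avail by (simp add: Q_def card_gt_0_iff)
  have ep: "0 < \<epsilon> i" "\<epsilon> i \<le> 1 / 8" "1 / x\<^sup>2 \<le> \<epsilon> i" using \<epsilon>_pos \<epsilon>_le(2)[of i] \<epsilon>_ge i by auto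
  have eta: "0 < \<eta>" by (rule \<eta>_pos)
  have ee: "0 < \<epsilon> i * \<eta>" using ep eta by simp
  have hb: "0 \<le> hb i" "hb i \<le> \<eta>" "hb i \<le> 1 / 8" using hb_nonneg hb_le[of i] hb_le_eighth[of i] i by auto
  have Ow: "Ow \<le> 9 / 8 * q i * c0"
  proof -
    have "\<bar>Ow - q i * c0\<bar> \<le> \<epsilon> i * (q i * c0)"
      using gd(6)[unfolded open_tracked_def, rule_format, OF val] by (simp add: Ow_def c0_def mult.assoc)
    moreover have "\<epsilon> i * (q i * c0) \<le> 1 / 8 * (q i * c0)" using ep qp c0 by (intro mult_right_mono) auto
    ultimately show ?thesis by linarith
  qed
  then have Owq: "Ow / (c0 * q') \<le> 9 / 7"
  proof -
    have "9 / 8 * q i * c0 \<le> 9 / 8 * (8 / 7 * q') * c0"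
      using qp(4) c0 by (intro mult_right_mono mult_left_mono) auto
    then have "Ow \<le> 9 / 8 * (8 / 7 * q') * c0" using Ow by linarith
    then show ?thesis using c0 qp by (simp add: field_simps)
  qed
  have Ow0: "0 \<le> Ow" by (simp add: Ow_def)
  have cl0: "0 \<le> cl A" "cl A \<le> c0" for A
    unfolding cl_def c0_def by (auto intro: card_mono)
  have d0: "0 \<le> d A" for A using cl0 c0 qp by (simp add: d_def)
  have db: "d A \<le> 1 / x ^ 5" if A: "A \<in> avail H" for A
  proof (cases "valid (insert A H) C K")
    case True
    have "cl A \<le> c0 * (\<nu> + loss (x ^ 4))"
      unfolding cl_def c0_def using x_ge by (intro card_closed_by_le[OF gd(4) _ gd(7,1) A True]) auto
    also have "\<nu> + loss (x ^ 4) \<le> 2 / x ^ 8"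
    proof -
      have "\<nu> * 1 * x ^ 8 \<le> \<nu> * (real T)\<^sup>2 * x ^ 8"
        using \<nu>_pos T_pos x_pos by (intro mult_right_mono mult_left_mono) auto
      then have "\<nu> * x ^ 8 \<le> 1" using \<nu>_le by simp
      then show ?thesis using loss_le x_pos by (simp add: field_simps)
    qed
    finally have "cl A / (c0 * q') \<le> (2 / x ^ 8) / q'" using c0 qp by (simp add: field_simps)
    also have "\<dots> \<le> (2 / x ^ 8) / (1 / x)" using qp x_pos by (intro divide_left_mono) auto
    also have "\<dots> = 2 / x ^ 7" using x_pos by (simp add: field_simps eval_nat_numeral)
    also have "\<dots> \<le> 1 / x ^ 5"
    proof -
      have "2 * x ^ 5 \<le> x ^ 2 * x ^ 5" using power_mono[of 2 x 2] x_ge by (intro mult_right_mono) auto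
      also have "\<dots> = x ^ 7" by (simp flip: power_add)
      finally show ?thesis using x_pos by (simp add: field_simps)
    qed
    finally show ?thesis using True by (simp add: d_def)
  qed (use x_pos in \<open>simp add: d_def\<close>)
  define h where "h y = real (card (closed_by H y)) / Q" for y
  have h: "0 \<le> h y" "h y \<le> 1" if "y \<in> avail H" for y
  proof -
    have "card (closed_by H y) \<le> card (avail H)"
      using finite_avail by (intro card_mono) (auto simp: closed_by_def)
    then show "0 \<le> h y" "h y \<le> 1" using Qpos by (simp_all add: h_def Q_def)
  qed
  have total: "(\<Sum>A\<in>avail H. cl A) / Q = (\<Sum>y\<in>avail H \<inter> E (\<Union>C) K. h y)"
  proof -
    have "(\<Sum>A\<in>avail H. cl A) = (\<Sum>y\<in>avail H \<inter> E (\<Union>C) K. real (card (closed_by H y)))"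
      unfolding cl_def of_nat_sum[symmetric] by (simp only: sum_card_closed_by)
    then show ?thesis by (simp add: h_def sum_divide_distrib)
  qed
  define B where "B = {y \<in> avail H \<inter> E (\<Union>C) K. \<not> near_ok H y}"
  have dev: "\<bar>Ow * hb i - (\<Sum>A\<in>avail H. cl A) / Q\<bar> \<le> Ow * (6 * \<epsilon> i * \<eta>) + real T * \<nu> * c0"
  proof -
    have "Ow * hb i - (\<Sum>A\<in>avail H. cl A) / Q = (\<Sum>y\<in>avail H \<inter> E (\<Union>C) K. hb i - h y)"
      unfolding total by (simp add: sum_subtractf Ow_def)
    also have "\<bar>\<dots>\<bar> \<le> (\<Sum>y\<in>avail H \<inter> E (\<Union>C) K. 6 * \<epsilon> i * \<eta> + (if near_ok H y then 0 else 1))"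
    proof (intro order_trans[OF sum_abs] sum_mono)
      fix y assume y: "y \<in> avail H \<inter> E (\<Union>C) K"
      show "\<bar>hb i - h y\<bar> \<le> 6 * \<epsilon> i * \<eta> + (if near_ok H y then 0 else 1)"
      proof (cases "near_ok H y")
        case True
        then show ?thesis using closing_rate[OF g i, of y] y by (simp add: h_def Q_def abs_minus_commute)
      next
        case False
        have "\<bar>hb i - h y\<bar> \<le> 1" using hb h[of y] y by auto
        then show ?thesis using False ee by simp
      qed
    qed
    also have "\<dots> = Ow * (6 * \<epsilon> i * \<eta>) + real (card B)"
    proof -
      have "(\<Sum>y\<in>avail H \<inter> E (\<Union>C) K. if near_ok H y then 0 else 1) = (\<Sum>y\<in>B. 1 :: real)"
        unfolding B_def by (intro sum.mono_neutral_cong_right) auto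
      then show ?thesis by (simp add: sum.distrib Ow_def)
    qed
    also have "real (card B) \<le> real T * \<nu> * c0"
    proof -
      have "real (card B) \<le> real (card {y \<in> E (\<Union>C) K. \<not> near_ok H y})"
        unfolding B_def by (intro of_nat_mono card_mono) auto
      also have "\<dots> \<le> real (card H) * \<nu> * c0"
        unfolding c0_def by (rule card_near_family[OF gd(1,7) val])
      also have "\<dots> \<le> real T * \<nu> * c0"
        using gd(2) i \<nu>_pos c0 by (intro mult_right_mono) auto
      finally show ?thesis .
    qed
    finally show ?thesis by simp
  qed
  define I where "I = {A \<in> avail H. \<not> valid (insert A H) C K}"
  have inval: "0 \<le> (\<Sum>A\<in>I. cl A) / Q" "(\<Sum>A\<in>I. cl A) / Q \<le> 8 / 7 * x * (real r * \<nu>) * c0"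
  proof -
    show "0 \<le> (\<Sum>A\<in>I. cl A) / Q" using cl0 Qpos by (simp add: sum_nonneg)
    have "(\<Sum>A\<in>I. cl A) \<le> real (card I) * c0" using cl0 sum_bounded_above[of I cl c0] by simp
    then have "(\<Sum>A\<in>I. cl A) / Q \<le> real (card I) / Q * c0" using Qpos by (simp add: divide_right_mono)
    also have "\<dots> \<le> 8 / 7 * x * (real r * \<nu>) * c0"
      unfolding Q_def I_def using card_newly_invalid[OF gd(1) val] \<nu>_pos c0
      by (intro mult_right_mono inverse_card_avail_le[OF g i]) auto
    finally show "(\<Sum>A\<in>I. cl A) / Q \<le> 8 / 7 * x * (real r * \<nu>) * c0" .
  qed
  have Dsum: "D * (c0 * q') = (\<Sum>A\<in>avail H. cl A) / Q - (\<Sum>A\<in>I. cl A) / Q"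
  proof -
    have "(\<Sum>A\<in>avail H. cl A) - (\<Sum>A\<in>I. cl A) = (\<Sum>A\<in>avail H - I. cl A)"
      using finite_avail by (intro sum_diff[symmetric]) (auto simp: I_def)
    also have "\<dots> = (\<Sum>A\<in>avail H. if valid (insert A H) C K then cl A else 0)"
      using finite_avail by (intro sum.mono_neutral_cong_left) (auto simp: I_def)
    also have "\<dots> = (\<Sum>A\<in>avail H. d A * (c0 * q'))"
      using c0 qp by (intro sum.cong) (auto simp: d_def)
    also have "\<dots> = D * (c0 * q') * Q" using Qpos by (simp add: D_def flip: sum_distrib_right)
    finally show ?thesis using Qpos by (simp add: field_simps)
  qed
  have small: "real T * \<nu> + 8 / 7 * x * (real r * \<nu>) \<le> q' * (\<epsilon> i * \<eta>)"
  proof -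
    have "8 / 7 * x * (real r * \<nu>) \<le> \<nu> * real T * x ^ 4"
    proof -
      have "8 / 7 * x * real r \<le> x * x * x" using x_ge by (intro mult_mono) auto
      also have "\<dots> \<le> x ^ 4" using power_increasing[of 3 4 x] x_ge by (simp add: eval_nat_numeral)
      also have "\<dots> \<le> real T * x ^ 4" using T_pos x_pos by simp
      finally have "\<nu> * (8 / 7 * x * real r) \<le> \<nu> * (real T * x ^ 4)" using \<nu>_pos by (intro mult_left_mono) auto
      then show ?thesis by (simp add: algebra_simps)
    qed
    moreover have "real T * \<nu> \<le> \<nu> * real T * x ^ 4"
      using \<nu>_pos T_pos x_ge by (simp add: one_le_power mult.commute)
    ultimately have "real T * \<nu> + 8 / 7 * x * (real r * \<nu>) \<le> \<nu> * real T * (2 * x ^ 4)" by simp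
    also have "\<dots> \<le> \<nu> * real T * x ^ 5"
      using x_ge \<nu>_pos by (intro mult_left_mono) (auto simp: eval_nat_numeral)
    also have "\<dots> = (\<nu> * real T * x ^ 6) * (1 / x)" using x_pos by (simp add: eval_nat_numeral)
    also have "\<dots> \<le> (\<eta> * \<epsilon> i) * q'" using qp ee x_pos eta ep by (intro mult_mono \<nu>_small) auto
    finally show ?thesis by (simp add: algebra_simps)
  qed
  \<comment> \<open>The 6 of \<open>closing_rate\<close> becomes \<open>54 / 7\<close> through
    \<open>Owq\<close>; sets that are not \<open>near_ok\<close> and dropped tests together add at
    most 1, and \<open>61 / 7 \<le> 9\<close>.\<close>
  have cD: "\<bar>c - D\<bar> \<le> 9 * (\<epsilon> i * \<eta>)"
  proof -
    have "\<bar>c - D\<bar> * (c0 * q') = \<bar>Ow * hb i - D * (c0 * q')\<bar>"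
    proof -
      have "(c - D) * (c0 * q') = Ow * hb i - D * (c0 * q')" using c0 qp by (simp add: c_def field_simps)
      then show ?thesis using c0 qp by (metis abs_mult abs_of_pos mult_pos_pos)
    qed
    also have "\<dots> \<le> Ow * (6 * \<epsilon> i * \<eta>) + real T * \<nu> * c0 + 8 / 7 * x * (real r * \<nu>) * c0"
      using dev inval unfolding Dsum by linarith
    also have "\<dots> \<le> (9 / 7 * (c0 * q')) * (6 * \<epsilon> i * \<eta>) + (q' * (\<epsilon> i * \<eta>)) * c0"
    proof -
      have "Ow \<le> 9 / 7 * (c0 * q')" using Owq c0 qp by (simp add: divide_le_eq)
      then have "Ow * (6 * \<epsilon> i * \<eta>) \<le> (9 / 7 * (c0 * q')) * (6 * \<epsilon> i * \<eta>)"
        using ep eta by (intro mult_right_mono) auto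
      moreover have "(real T * \<nu> + 8 / 7 * x * (real r * \<nu>)) * c0 \<le> (q' * (\<epsilon> i * \<eta>)) * c0"
        using small c0 by (intro mult_right_mono) auto
      ultimately show ?thesis by (simp add: algebra_simps)
    qed
    also have "\<dots> = (61 / 7 * (\<epsilon> i * \<eta>)) * (c0 * q')" by (simp add: algebra_simps)
    also have "\<dots> \<le> (9 * (\<epsilon> i * \<eta>)) * (c0 * q')" using ee c0 qp by (intro mult_right_mono) auto
    finally show ?thesis using c0 qp by (simp add: mult_le_cancel_right)
  qed
  have D: "D \<le> 3 * \<eta>"
  proof -
    have "c \<le> 9 / 7 * \<eta>"
      using mult_mono[OF Owq hb(2)] hb Ow0 c0 qp by (simp add: c_def)
    moreover have "\<epsilon> i * \<eta> \<le> 1 / 8 * \<eta>" using ep eta by (intro mult_right_mono) auto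
    ultimately show ?thesis using cD eta by linarith
  qed
  have "(\<Sum>A\<in>avail H. pot_open s (Suc i) (insert A H) C K) / Q \<le> exp (\<theta> * (s * (Ow / (c0 * q i) - 1) - \<epsilon> i))"
    unfolding Q_def
  proof (rule average_track[where d = d and c = c and s = s and g = "cK * \<eta> * \<epsilon> i" and b = "1 / x ^ 5"
      and \<beta> = "1 / x\<^sup>2" and D = D and \<delta> = "9 * (\<epsilon> i * \<eta>)"])
    show "\<theta> * (1 / x ^ 5) \<le> 1 / x\<^sup>2" using x_pos by (simp add: \<theta>_def field_simps eval_nat_numeral)
    show "1 / x\<^sup>2 \<le> 1" using x_ge by (simp add: one_le_power)
    show "9 * (\<epsilon> i * \<eta>) + 1 / x\<^sup>2 * D \<le> cK * \<eta> * \<epsilon> i"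
    proof -
      have "1 / x\<^sup>2 * D \<le> \<epsilon> i * (3 * \<eta>)"
        using ep D Qpos d0 by (intro mult_mono) (auto simp: D_def sum_nonneg)
      moreover have "12 * (\<epsilon> i * \<eta>) \<le> cK * (\<epsilon> i * \<eta>)" using cK_ge ee by (intro mult_right_mono) auto
      ultimately show ?thesis by (simp add: algebra_simps)
    qed
    show "pot_open s (Suc i) (insert A H) C K
        \<le> exp (\<theta> * (s * (Ow / (c0 * q i) - 1) - \<epsilon> i - cK * \<eta> * \<epsilon> i + s * (c - d A)))" if "A \<in> avail H" for A
    proof (cases "valid (insert A H) C K")
      case True
      have "avail (insert A H) \<inter> E (\<Union>C) K = (avail H \<inter> E (\<Union>C) K) - (E (\<Union>C) K \<inter> closed_by H A)"
        using avail_insert_subset[of A H] by (auto simp: closed_by_def)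
      moreover have sub: "E (\<Union>C) K \<inter> closed_by H A \<subseteq> avail H \<inter> E (\<Union>C) K" by (auto simp: closed_by_def)
      ultimately have newc: "real (card (avail (insert A H) \<inter> E (\<Union>C) K)) = Ow - cl A"
        using finite_avail card_mono[OF _ sub]
        by (simp add: Ow_def cl_def card_Diff_subset finite_subset[OF sub] of_nat_diff)
      then have new: "real (card (avail (insert A H) \<inter> E (\<Union>C) K)) / (c0 * q') = Ow / (c0 * q i) + (c - d A)"
      proof -
        have "Ow / (c0 * q i) = Ow * (1 - hb i) / (c0 * q')"
          using qp c0 hb by (simp add: q'_def q_Suc)
        also have "\<dots> = Ow / (c0 * q') - c"
          by (simp add: c_def right_diff_distrib diff_divide_distrib)
        finally have "Ow / (c0 * q i) = Ow / (c0 * q') - c" .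
        moreover have "d A = cl A / (c0 * q')" using True by (simp add: d_def)
        ultimately show ?thesis unfolding newc by (simp add: diff_divide_distrib)
      qed
      have "pot_open s (Suc i) (insert A H) C K = exp (\<theta> * (s * (Ow / (c0 * q i) + (c - d A) - 1) - \<epsilon> (Suc i)))"
        using True new by (simp add: pot_open_def c0_def q'_def)
      then show ?thesis by (simp add: \<epsilon>_Suc algebra_simps)
    qed (simp add: pot_open_def)
  qed (use finite_avail card_avail_bounds(3)[OF g i] s d0 db cD x_pos in \<open>auto simp: \<theta>_def D_def Q_def\<close>)
  then show ?thesis using val by (simp add: pot_open_def Q_def Ow_def c0_def)
qed

section \<open>Growth of the completion counts\<close>

definition "pot_W s i H j u = (if near_ok H u then
  exp (\<theta> * (s * (Wn H j u / sig j - xt j i) - \<epsilon> i)) else 0)"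

lemma near_ok_mono: "near_ok G u \<Longrightarrow> H \<subseteq> G \<Longrightarrow> near_ok H u"
  by (auto simp: near_ok_def)

text \<open>Two distinct members determine the kernel as \<open>A \<inter> u\<close>. With this set
  as \<open>J\<close> all weights are 1, so \<open>counts_bounded\<close> bounds the plain
  number.\<close>

lemma card_ext_fam_pair:
  assumes cb: "counts_bounded Y H" and H: "finite H" and u: "A \<in> V" "u \<in> V" "A \<noteq> u" and j: "j + 3 \<le> r"
  shows "real (card (ext_fam H {A, u} j \<kappa>)) \<le> Y ^ j * exp (real j * real (r - (2 + j)) * lam / 2)"
proof -
  have kernel: "K = A \<inter> u" if "(F, K) \<in> ext_fam H {A, u} j m" for F K m
    using that u(3) unfolding ext_fam_def sunflower_with_def by blast
  show ?thesis
  proof (cases "j = 0")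
    case True
    have "ext_fam H {A, u} j \<kappa> \<subseteq> {({}, A \<inter> u)}"
      using kernel True H by (auto simp: ext_fam_def card_eq_0_iff dest: finite_subset)
    then have "card (ext_fam H {A, u} j \<kappa>) \<le> card {({} :: 'a set set, A \<inter> u)}" by (rule card_mono[rotated]) simp
    then show ?thesis using True by simp
  next
    case False
    have "real (card (ext_fam H {A, u} j \<kappa>)) = (\<Sum>p\<in>ext_fam H {A, u} j \<kappa>. wt (A \<inter> u) (snd p))"
    proof -
      have "wt (A \<inter> u) (snd p) = 1" if "p \<in> ext_fam H {A, u} j \<kappa>" for p
        using kernel[of "fst p" "snd p" \<kappa>] that wt_bounds(3) by simp
      then show ?thesis by simp
    qed
    also have "\<dots> \<le> (\<Sum>p\<in>ext_fam H {A, u} j (2 * \<kappa>). wt (A \<inter> u) (snd p))"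
    proof (rule sum_mono2[OF finite_ext_fam[OF H]])
      show "ext_fam H {A, u} j \<kappa> \<subseteq> ext_fam H {A, u} j (2 * \<kappa>)" by (auto simp: ext_fam_def)
    qed (rule wt_bounds(1))
    also have "\<dots> = Nw H {A, u} j (A \<inter> u)" by (simp add: Nw_def ext_sum_def case_prod_unfold)
    also have "\<dots> \<le> Y ^ j * exp (real j * real (r - (card {A, u} + j)) * lam / 2)"
      using u j False V_D(1) by (intro counts_boundedD[OF cb]) auto
    also have "card {A, u} = 2" using u(3) by simp
    finally show ?thesis .
  qed
qed

lemma x_exp_le: "x ^ (4 * r) * exp (- lam / 2) \<le> 1 / x ^ 8"
proof -
  have "x ^ (4 * r) * exp (- lam / 2) \<le> loss (x ^ 4)"
    using x_pos by (simp add: loss_def power_mult[symmetric])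
  also have "\<dots> \<le> 1 / x ^ 8" using loss_le x_pos by (simp add: field_simps)
  finally show ?thesis .
qed

text \<open>Let \<open>m = r - 2 - j\<close>. From \<open>L \<ge> 1\<close> follows
  \<open>N ^ m \<le> sig (Suc j) * T ^ m\<close>, and the upper bound on \<open>T\<close> brings in
  \<open>exp (m * r * lam / 2)\<close>. The families through both sets and their completions
  contribute \<open>exp (- m * (r + 1) * lam / 2)\<close>. What remains is
  \<open>exp (- m * lam / 2)\<close> with \<open>m \<ge> 1\<close>.\<close>

lemma W_increment_le:
  assumes g: "good i H" and u: "A \<in> V" "u \<in> V" "A \<noteq> u" and j: "j + 3 \<le> r"
  shows "ext_sum H {A, u} j \<kappa> (\<lambda>K. ext (Suc j) (card K)) \<le> sig (Suc j) * (1 / x ^ 5)"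
proof -
  note gd = goodD[OF g]
  define m where "m = r - (2 + j)"
  have m: "1 \<le> m" "r - 1 = Suc j + m" "r - 1 - Suc j = m" using j by (auto simp: m_def)
  let ?b = "N ^ m * exp (- lam * (real m * real (r + Suc j) / 2))"
  let ?c = "(x ^ 4) ^ j * exp (real j * real m * lam / 2)"
  have "ext_sum H {A, u} j \<kappa> (\<lambda>K. ext (Suc j) (card K)) \<le> (\<Sum>p\<in>ext_fam H {A, u} j \<kappa>. ?b)"
    unfolding ext_sum_def
  proof (rule sum_mono)
    fix p assume "p \<in> ext_fam H {A, u} j \<kappa>"
    then have "card (snd p) \<le> 2 * \<kappa>" by (auto simp: ext_fam_def)
    then have "ext (Suc j) (card (snd p)) \<le> ?b"
      using j unfolding m(3)[symmetric] by (intro ext_le) auto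
    then show "(case p of (F, K) \<Rightarrow> ext (Suc j) (card K)) \<le> ?b"
      by (simp only: case_prod_unfold)
  qed
  also have "\<dots> = real (card (ext_fam H {A, u} j \<kappa>)) * ?b" by simp
  also have "\<dots> \<le> ?c * ?b"
    using card_ext_fam_pair[OF gd(4,7) u j] by (intro mult_right_mono) (auto simp: m_def)
  also have "\<dots> = (x ^ 4) ^ j * (N ^ m * exp (- (real m * (real r + 1) * lam / 2)))"
  proof -
    have "real j * real m * lam / 2 + - lam * (real m * real (r + Suc j) / 2) = - (real m * (real r + 1) * lam / 2)"
      by (simp add: field_simps)
    then show ?thesis by (simp add: mult_exp_exp mult.left_commute mult.assoc)
  qed
  also have "\<dots> \<le> (x ^ 4) ^ j * (sig (Suc j) * (x * exp (- lam / 2)) ^ m)"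
  proof (intro mult_left_mono)
    have "sig (Suc j) * (real T / N) ^ m = L"
      by (simp only: sig_def L_def m(2) power_add mult.assoc)
    then have "1 \<le> sig (Suc j) * (real T / N) ^ m" using L_bounds(1) by simp
    then have "N ^ m \<le> sig (Suc j) * real T ^ m" using N_pos by (simp add: power_divide field_simps)
    also have "\<dots> \<le> sig (Suc j) * (x * exp (real r * lam / 2)) ^ m"
      using T_le sig_pos[of "Suc j"] by (intro mult_left_mono power_mono) auto
    finally have "N ^ m * exp (- (real m * (real r + 1) * lam / 2))
        \<le> sig (Suc j) * (x * exp (real r * lam / 2)) ^ m * exp (- (real m * (real r + 1) * lam / 2))"
      by (intro mult_right_mono) auto
    also have "\<dots> = sig (Suc j) * (x ^ m * exp (real m * (real r * lam / 2) - real m * (real r + 1) * lam / 2))"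
      by (simp only: power_mult_distrib exp_of_nat_mult[symmetric] exp_diff exp_minus divide_inverse[of "exp _" "exp _"] mult.assoc)
    also have "real m * (real r * lam / 2) - real m * (real r + 1) * lam / 2 = real m * (- lam / 2)"
      by (simp add: field_simps)
    also have "x ^ m * exp (real m * (- lam / 2)) = (x * exp (- lam / 2)) ^ m"
      by (simp only: power_mult_distrib exp_of_nat_mult)
    finally show "N ^ m * exp (- (real m * (real r + 1) * lam / 2)) \<le> sig (Suc j) * (x * exp (- lam / 2)) ^ m" .
  qed simp
  also have "\<dots> \<le> (x ^ 4) ^ j * (sig (Suc j) * (x * exp (- lam / 2)))"
  proof (intro mult_left_mono)
    have "x * exp (- lam / 2) \<le> x ^ (4 * r) * exp (- lam / 2)"
      using power_increasing[of 1 "4 * r" x] x_ge r_ge_3 by (intro mult_right_mono) auto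
    also have "\<dots> \<le> 1 / x ^ 8" by (rule x_exp_le)
    also have "\<dots> \<le> 1" using x_ge by (simp add: one_le_power)
    finally have le1: "x * exp (- lam / 2) \<le> 1" .
    have "(x * exp (- lam / 2)) ^ m \<le> (x * exp (- lam / 2)) ^ 1"
      using m(1) le1 x_pos by (intro power_decreasing) auto
    then show "(x * exp (- lam / 2)) ^ m \<le> x * exp (- lam / 2)" by simp
  qed (use sig_pos[of "Suc j"] in auto)
  also have "\<dots> = sig (Suc j) * (x ^ (4 * j + 1) * exp (- lam / 2))"
    by (simp add: power_mult[symmetric] power_add)
  also have "\<dots> \<le> sig (Suc j) * (x ^ (4 * r) * exp (- lam / 2))"
    using sig_pos[of "Suc j"] j x_ge by (intro mult_left_mono mult_right_mono power_increasing) auto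
  also have "\<dots> \<le> sig (Suc j) * (1 / x ^ 5)"
  proof (intro mult_left_mono)
    have "1 / x ^ 8 \<le> 1 / x ^ 5" using x_ge by (intro divide_left_mono power_increasing) auto
    then show "x ^ (4 * r) * exp (- lam / 2) \<le> 1 / x ^ 5" using x_exp_le by linarith
  qed (use sig_pos[of "Suc j"] in auto)
  finally show ?thesis .
qed

text \<open>The mean increment is \<open>open_sum H j u\<close> divided by the number of available
  sets. The proportion \<open>q i\<close> cancels, which leaves, in units of
  \<open>sig (Suc j)\<close>, about \<open>(r - 1 - j) * xt j i / T\<close>, the increment of the
  trajectory.\<close>

lemma pot_W_step:
  assumes g: "good i H" and i: "i < T" and s: "s = 1 \<or> s = -1" and u: "u \<in> V" and j: "Suc j \<le> r - 2"
  shows "(\<Sum>A\<in>avail H. pot_W s (Suc i) (insert A H) (Suc j) u) / real (card (avail H)) \<le> pot_W s i H (Suc j) u"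
proof (cases "near_ok H u")
  case False
  then have "\<not> near_ok (insert A H) u" for A using near_ok_mono[of "insert A H" u H] by blast
  then show ?thesis using False by (simp add: pot_W_def)
next
  case nok: True
  note gd = goodD[OF g]
  have j3: "j + 3 \<le> r" "j \<le> r - 2" using j r_ge_3 by auto
  define Q where "Q = real (card (avail H))"
  define R where "R = real (r - 1 - j)"
  define ex where "ex A = ext_sum H (insert A {u}) j \<kappa> (\<lambda>K. ext (Suc j) (card K))" for A
  \<comment> \<open>Choosing \<open>u\<close> itself destroys \<open>near_ok\<close> for
    \<open>u\<close>, so the potential vanishes and the change may be taken as 0.\<close>
  define d where "d A = (if A = u then 0 else ex A / sig (Suc j))" for A
  define D where "D = (\<Sum>A\<in>avail H. d A) / Q"
  define c where "c = R * xt j i / real T"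
  define a where "a = 1 / real T"
  define e where "e = \<epsilon> i"
  define X where "X = xt j i"
  define f where "f = (2::real) ^ r"
  define m where "m = q i * N"
  define W where "W = Wn H j u"
  define S where "S = open_sum H j u"
  have sp: "0 < sig (Suc j)" by (rule sig_pos)
  have R: "0 \<le> R" "R \<le> real r" "0 < R" using j3 by (auto simp: R_def)
  have e: "0 \<le> e" "e \<le> 1 / 8" "1 / x\<^sup>2 \<le> e" using \<epsilon>_pos[of i] \<epsilon>_le(2)[of i] \<epsilon>_ge[of i] i by (auto simp: e_def)
  have X: "0 \<le> X" "X \<le> f" using xt_nonneg xt_le[of i] i by (auto simp: X_def f_def)
  have a: "0 \<le> a" by (simp add: a_def)
  have fa: "f * a \<le> \<eta>" using inverse_T_le by (simp add: f_def a_def)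
  have m: "0 < m" using q_pos[of i] N_pos i by (simp add: m_def)
  note cav = card_avail_bounds[OF g i]
  have Q: "\<bar>Q - m\<bar> \<le> e * m" using cav(1) by (simp add: Q_def e_def m_def mult.assoc)
  have Qpos: "0 < Q" using cav(3) finite_avail by (simp add: Q_def card_gt_0_iff)
  have ex0: "0 \<le> ex A" for A unfolding ex_def by (intro ext_sum_nonneg ext_nonneg)
  have total: "(\<Sum>A\<in>avail H - {u}. ex A) = S"
  proof -
    have "(\<Sum>A\<in>avail H - {u}. ex A) = (\<Sum>(F, K)\<in>ext_fam H {u} j \<kappa>. ext (Suc j) (card K) *
        real (card ((avail H - {u}) \<inter> E (\<Union>({u} \<union> F)) K)))"
      unfolding ex_def using avail_D gd(7) by (intro sum_ext_sum_insert) auto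
    also have "\<dots> = S" unfolding S_def open_sum_def
    proof (intro sum.cong refl)
      fix p assume p: "p \<in> ext_fam H {u} j \<kappa>"
      obtain F K where FK: "p = (F, K)" by (cases p)
      have "K \<noteq> u" using p FK V_D(2)[OF u] w_ge \<kappa>_pos by (auto simp: ext_fam_def)
      moreover have "u \<inter> \<Union>({u} \<union> F) = u" by blast
      ultimately have "u \<notin> E (\<Union>({u} \<union> F)) K" unfolding E_def by auto
      then have "(avail H - {u}) \<inter> E (\<Union>({u} \<union> F)) K = avail H \<inter> E (\<Union>({u} \<union> F)) K" by blast
      then show "(case p of (F, K) \<Rightarrow> ext (Suc j) (card K) * real (card ((avail H - {u}) \<inter> E (\<Union>({u} \<union> F)) K)))
          = (case p of (F, K) \<Rightarrow> ext (Suc j) (card K) * real (card (avail H \<inter> E (\<Union>({u} \<union> F)) K)))"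
        by (simp only: FK prod.case)
    qed
    finally show ?thesis .
  qed
  have DS: "D = R * (S / (R * sig (Suc j)) / Q)"
  proof -
    have "(\<Sum>A\<in>avail H. d A) = (\<Sum>A\<in>avail H - {u}. ex A / sig (Suc j))"
      using finite_avail by (intro sum.mono_neutral_cong_right) (auto simp: d_def)
    then show ?thesis using total R by (simp add: D_def sum_divide_distrib[symmetric])
  qed
  have Sb: "\<bar>S - q i * R * W\<bar> \<le> e * q i * R * W"
    using open_sum_bounds[OF gd(6,7,1,3) u nok j3(2)] by (simp add: S_def R_def W_def e_def)
  have W0: "0 \<le> W" unfolding W_def Wn_def by (intro ext_sum_nonneg ext_nonneg)
  have sigj: "sig j = sig (Suc j) * N * a"
    using sig_Suc[of j] T_pos by (simp add: a_def field_simps)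
  have Wb: "W \<le> (X + e) * sig j" "(X - e) * sig j \<le> W"
    using W_tracked[OF g u nok j3(2)] by (auto simp: W_def X_def e_def algebra_simps)
  define S' where "S' = S / (R * sig (Suc j))"
  define W' where "W' = W / (sig (Suc j) * N)"
  have W': "0 \<le> W'" "a * (X - e) \<le> W'" "W' \<le> a * (X + e)"
    using W0 Wb sp N_pos unfolding sigj by (auto simp: W'_def field_simps)
  have qW: "q i * R * W = m * W' * (R * sig (Suc j))"
    using sp N_pos by (simp add: W'_def m_def)
  have S'b: "\<bar>S' - m * W'\<bar> \<le> e * (m * W')"
  proof -
    have eq: "S' * (R * sig (Suc j)) = S" using sp R by (simp add: S'_def)
    have "\<bar>S - q i * R * W\<bar> \<le> e * (q i * R * W)" using Sb by (simp only: mult.assoc)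
    then have "\<bar>S' * (R * sig (Suc j)) - m * W' * (R * sig (Suc j))\<bar> \<le> e * (m * W' * (R * sig (Suc j)))"
      unfolding eq qW .
    moreover have "\<bar>S' - m * W'\<bar> * (R * sig (Suc j)) = \<bar>S' * (R * sig (Suc j)) - m * W' * (R * sig (Suc j))\<bar>"
      using sp R unfolding left_diff_distrib[symmetric] abs_mult by simp
    ultimately have "\<bar>S' - m * W'\<bar> * (R * sig (Suc j)) \<le> e * (m * W') * (R * sig (Suc j))"
      by (simp only: mult.assoc)
    moreover have "0 < R * sig (Suc j)" using sp R by simp
    ultimately show ?thesis by (rule mult_right_le_imp_le)
  qed
  have f8: "8 \<le> f" unfolding f_def by (rule pow2_r_ge)
  have up: "S' \<le> (a * X + 5 * e * f * a) * Q"
  proof (rule quotient_estimate[OF e(1,2) f8 X a Q m])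
    have "S' \<le> (1 + e) * (m * W')" using S'b by (simp add: algebra_simps)
    also have "\<dots> \<le> (1 + e) * (m * (a * (X + e)))" using W' m e by (intro mult_left_mono) auto
    finally show "S' \<le> (1 + e) * m * (a * (X + e))" by (simp add: mult.assoc)
  qed
  have lo: "(a * X - 4 * e * f * a) * Q \<le> S'"
  proof (rule quotient_estimate_lower[OF e(1,2) f8 X a Q m W'(1,2)])
    have "0 \<le> e * (m * W')" using e m W' by simp
    then show "(1 - 2 * e) * m * W' \<le> S'" using S'b by (simp add: algebra_simps)
  qed
  have rate: "S' / Q \<le> a * X + 5 * e * f * a" "a * X - 4 * e * f * a \<le> S' / Q"
    using up lo Qpos by (simp_all add: divide_le_eq le_divide_eq)
  have efa: "0 \<le> e * f * a" "e * f * a \<le> e * \<eta>" using e f8 a fa by (auto simp: mult.assoc intro: mult_left_mono)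
  have cD: "\<bar>c - D\<bar> \<le> 5 * real r * (e * \<eta>)"
  proof -
    have "c - D = R * (a * X - S' / Q)" by (simp add: DS S'_def c_def a_def X_def right_diff_distrib)
    then have "\<bar>c - D\<bar> = R * \<bar>a * X - S' / Q\<bar>" using R by (simp add: abs_mult)
    also have "\<dots> \<le> real r * (5 * (e * \<eta>))"
      using rate efa R by (intro mult_mono) (auto simp: abs_le_iff)
    finally show ?thesis by simp
  qed
  have D0: "0 \<le> D" unfolding D_def using ex0 sp Qpos by (auto simp: d_def intro!: divide_nonneg_pos sum_nonneg)
  have D: "D \<le> 2 * real r * \<eta>"
  proof -
    have "a * X \<le> \<eta>" using X a fa mult_left_mono[OF X(2) a] by (simp add: mult.commute)
    moreover have "5 * (e * f * a) \<le> 5 * (1 / 8 * \<eta>)"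
      using efa(2) mult_right_mono[OF e(2), of \<eta>] \<eta>_pos by linarith
    ultimately have "S' / Q \<le> 2 * \<eta>" using rate(1) \<eta>_pos by linarith
    then have "R * (S' / Q) \<le> R * (2 * \<eta>)" using R by (intro mult_left_mono) auto
    also have "\<dots> \<le> real r * (2 * \<eta>)" using R \<eta>_pos by (intro mult_right_mono) auto
    finally have "R * (S' / Q) \<le> real r * (2 * \<eta>)" .
    then show ?thesis by (simp add: DS S'_def)
  qed
  have xt': "xt (Suc j) (Suc i) = xt (Suc j) i + c"
    using xt_step[of j i] j3 by (simp add: c_def R_def)
  have "(\<Sum>A\<in>avail H. pot_W s (Suc i) (insert A H) (Suc j) u) / Q
      \<le> exp (\<theta> * (s * (Wn H (Suc j) u / sig (Suc j) - xt (Suc j) i) - \<epsilon> i))"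
    unfolding Q_def
  proof (rule average_track[where d = d and c = c and s = "- s" and g = "cK * \<eta> * \<epsilon> i" and b = "1 / x ^ 5"
      and \<beta> = "1 / x\<^sup>2" and D = D and \<delta> = "5 * real r * (e * \<eta>)"])
    show "\<theta> * (1 / x ^ 5) \<le> 1 / x\<^sup>2" using x_pos by (simp add: \<theta>_def field_simps eval_nat_numeral)
    show "1 / x\<^sup>2 \<le> 1" using x_ge by (simp add: one_le_power)
    show "5 * real r * (e * \<eta>) + 1 / x\<^sup>2 * D \<le> cK * \<eta> * \<epsilon> i"
    proof -
      have "1 / x\<^sup>2 * D \<le> e * (2 * real r * \<eta>)" using e D D0 by (intro mult_mono) auto
      moreover have "7 * real r * (e * \<eta>) \<le> cK * (e * \<eta>)"
        using cK_ge e \<eta>_pos by (intro mult_right_mono) auto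
      ultimately show ?thesis by (simp add: e_def algebra_simps)
    qed
    show "d A \<le> 1 / x ^ 5" if "A \<in> avail H" for A
    proof (cases "A = u")
      case False
      then have "ex A \<le> sig (Suc j) * (1 / x ^ 5)"
        unfolding ex_def using that avail_D u by (intro W_increment_le[OF g _ _ _ j3(1)]) auto
      then show ?thesis using False sp by (simp add: d_def divide_le_eq mult.commute)
    qed (use x_pos in \<open>simp add: d_def\<close>)
    show "pot_W s (Suc i) (insert A H) (Suc j) u
        \<le> exp (\<theta> * (s * (Wn H (Suc j) u / sig (Suc j) - xt (Suc j) i) - \<epsilon> i - cK * \<eta> * \<epsilon> i + - s * (c - d A)))"
      if A: "A \<in> avail H" for A
    proof (cases "near_ok (insert A H) u")
      case True
      have "A \<noteq> u" using near_ok_notin[OF u True] by blast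
      then have "Wn (insert A H) (Suc j) u = Wn H (Suc j) u + ex A"
        unfolding Wn_def ex_def using avail_D(2)[OF A] gd(7) by (intro ext_sum_insert) auto
      then have "Wn (insert A H) (Suc j) u / sig (Suc j) = Wn H (Suc j) u / sig (Suc j) + d A"
        using \<open>A \<noteq> u\<close> by (simp add: d_def add_divide_distrib)
      then have "pot_W s (Suc i) (insert A H) (Suc j) u
          = exp (\<theta> * (s * (Wn H (Suc j) u / sig (Suc j) + d A - (xt (Suc j) i + c)) - \<epsilon> (Suc i)))"
        using True by (simp add: pot_W_def xt')
      then show ?thesis by (simp add: \<epsilon>_Suc algebra_simps)
    qed (simp add: pot_W_def)
  qed (use finite_avail cav(3) s ex0 sp cD x_pos in \<open>auto simp: \<theta>_def D_def Q_def d_def\<close>)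
  then show ?thesis using nok by (simp add: pot_W_def Q_def)
qed

section \<open>A priori bounds for the weighted counts\<close>

definition "bnd a M = (x ^ 4) ^ a * exp (real a * real (r - M) * lam / 2)"
definition "mean a M = 2 * x\<^sup>2 * exp (- lam * real (M - 1)) * bnd a (M - 1)"
text \<open>Only the upper tail is needed. The exponential weight is the reciprocal of the largest
  increment. One half of \<open>bnd (Suc a) M\<close> is reserved for the accumulated means, the
  other half is the initial margin.\<close>

definition "pot_N i H C a J = exp ((Nw H C (Suc a) J - bnd (Suc a) (card C + Suc a) / 2) / bnd a (card C + Suc a)
  - 2 * real i * mean a (card C + Suc a) / bnd a (card C + Suc a))"

lemma bnd_pos: "bnd a M > 0" using x_pos by (simp add: bnd_def)

lemma counts_bounded_bnd:
  assumes "counts_bounded (x ^ 4) H" "C \<noteq> {}" "C \<subseteq> V" "1 \<le> a" "card C + a \<le> r - 1" "J \<subseteq> U"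
  shows "Nw H C a J \<le> bnd a (card C + a)"
  using counts_boundedD[OF assms] by (simp add: bnd_def)

text \<open>The exponents compare because \<open>a + 2 \<le> M\<close>, which expresses that
  \<open>C\<close> is nonempty; so the linear exponent in \<open>counts_bounded\<close> reproduces
  itself. \<open>T\<close> contributes one factor \<open>x\<close> and \<open>mean\<close> two; this
  is why each added set is granted \<open>x ^ 4\<close>, the last \<open>x\<close> absorbing the
  constant 8.\<close>

lemma mean_le:
  assumes "a + 2 \<le> M" "M \<le> r - 1"
  shows "4 * real T * mean a M \<le> bnd (Suc a) M"
proof -
  have "4 * real T * mean a M \<le> 4 * (x * exp (real r * lam / 2)) * mean a M"
    using T_le bnd_pos[of a "M - 1"] by (intro mult_right_mono mult_left_mono) (auto simp: mean_def)
  also have "\<dots> = 8 * x ^ 3 * (x ^ 4) ^ a * (exp (real r * lam / 2) * exp (- lam * real (M - 1)) * exp (real a * real (r - (M - 1)) * lam / 2))"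
    by (simp add: mean_def bnd_def eval_nat_numeral)
  also have "\<dots> \<le> x ^ 4 * (x ^ 4) ^ a * exp (real (Suc a) * real (r - M) * lam / 2)"
  proof (intro mult_mono)
    have "real r / 2 - real (M - 1) + real a * real (r - (M - 1)) / 2 \<le> real (Suc a) * real (r - M) / 2"
    proof -
      have 1: "real (M - 1) = real M - 1" "real (r - (M - 1)) = real r - real M + 1" "real (r - M) = real r - real M"
        using assms r_ge_3 by (auto simp: of_nat_diff)
      have "real a + 2 \<le> real M" using assms by simp
      then show ?thesis unfolding 1 by (simp add: field_simps)
    qed
    then have "(real r / 2 - real (M - 1) + real a * real (r - (M - 1)) / 2) * lam \<le> (real (Suc a) * real (r - M) / 2) * lam"
      using lam_nonneg by (rule mult_right_mono)
    then show "exp (real r * lam / 2) * exp (- lam * real (M - 1)) * exp (real a * real (r - (M - 1)) * lam / 2)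
        \<le> exp (real (Suc a) * real (r - M) * lam / 2)"
      by (simp add: mult_exp_exp algebra_simps)
    have "8 * x ^ 3 \<le> x * x ^ 3" using x_ge by (intro mult_right_mono) auto
    then show "8 * x ^ 3 \<le> x ^ 4" by (simp add: eval_nat_numeral)
  qed (use x_pos in auto)
  finally show ?thesis by (simp add: bnd_def)
qed

text \<open>For \<open>a = 0\<close> the kernel ranges over subsets of a member of \<open>C\<close>,
  and \<open>sum_wt_le\<close> applies; for \<open>a > 0\<close> the powers of
  \<open>\<omega> \<le> 1\<close> are dropped and the bound for \<open>a\<close> chosen members is
  used.\<close>

lemma Nw_weight_sum:
  assumes g: "good i H" and C: "C \<noteq> {}" "C \<subseteq> V" "card C + Suc a \<le> r - 1" and J: "J \<subseteq> U"
  shows "(\<Sum>(F, K)\<in>ext_fam H C a (2 * \<kappa>). wt J K * \<omega> ^ card K) \<le> x * bnd a (card C + a)"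
proof (cases "a = 0")
  case True
  note gd = goodD[OF g]
  obtain v where v: "v \<in> C" "v \<in> V" using C by blast
  have finv: "finite (Pow v)" using V_D(3)[OF v(2)] by simp
  have sub: "ext_fam H C a (2 * \<kappa>) \<subseteq> Pair {} ` Pow v"
    using True v gd(7) by (auto simp: ext_fam_def sunflower_with_def card_eq_0_iff dest: finite_subset)
  have "(\<Sum>(F, K)\<in>ext_fam H C a (2 * \<kappa>). wt J K * \<omega> ^ card K) \<le> (\<Sum>(F, K)\<in>Pair ({} :: 'a set set) ` Pow v. wt J K * \<omega> ^ card K)"
    using finv sub wt_bounds(1) less_imp_le[OF \<omega>_bounds(1)]
    by (intro sum_mono2) (auto intro!: mult_nonneg_nonneg)
  also have "\<dots> = (\<Sum>K\<in>Pow v. wt J K * \<omega> ^ card K)"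
    by (subst sum.reindex) (auto simp: inj_on_def)
  also have "\<dots> \<le> x" using sum_wt_le[OF v(2)] \<omega>_power by (rule order_trans)
  finally show ?thesis using True by (simp add: bnd_def)
next
  case False
  have "(\<Sum>(F, K)\<in>ext_fam H C a (2 * \<kappa>). wt J K * \<omega> ^ card K) \<le> Nw H C a J"
    unfolding Nw_def ext_sum_def using wt_bounds(1) \<omega>_bounds less_imp_le[OF \<omega>_bounds(1)]
    by (intro sum_mono) (auto intro!: mult_left_le power_le_one)
  also have "\<dots> \<le> bnd a (card C + a)"
    using False C J by (intro counts_bounded_bnd goodD(4)[OF g]) auto
  also have "\<dots> \<le> x * bnd a (card C + a)" using bnd_pos[of a "card C + a"] x_ge by simp
  finally show ?thesis .
qed

lemma Nw_increment_le:
  assumes g: "good i H" and C: "C \<noteq> {}" "C \<subseteq> V" "card C + Suc a \<le> r - 1" and J: "J \<subseteq> U"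
    and A: "A \<in> V" "A \<notin> C"
  shows "Nw H (insert A C) a J \<le> bnd a (card C + Suc a)"
proof -
  note gd = goodD[OF g]
  have finC: "finite C" using C finite_V finite_subset by blast
  have cC: "card (insert A C) = Suc (card C)" using A finC by simp
  show ?thesis
  proof (cases "a = 0")
    case True
    obtain v where v: "v \<in> C" using C by blast
    have kernel: "p = ({}, A \<inter> v)" if "p \<in> ext_fam H (insert A C) a (2 * \<kappa>)" for p
      using that True v A gd(7) unfolding ext_fam_def sunflower_with_def
      by (auto simp: card_eq_0_iff dest: finite_subset)
    then have "ext_fam H (insert A C) a (2 * \<kappa>) \<subseteq> {({}, A \<inter> v)}" by blast
    then have "Nw H (insert A C) a J \<le> (\<Sum>(F, K)\<in>{({} :: 'a set set, A \<inter> v)}. wt J K)"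
      unfolding Nw_def ext_sum_def using wt_bounds(1) by (intro sum_mono2) auto
    then show ?thesis using wt_bounds(2)[of J "A \<inter> v"] True by (simp add: bnd_def)
  next
    case False
    then show ?thesis
      using counts_bounded_bnd[OF gd(4), of "insert A C" a J] C A J cC by simp
  qed
qed

text \<open>An increment of the count with \<open>Suc a\<close> chosen members is a count with
  \<open>a\<close> chosen members for \<open>insert A C\<close>. Its mean is bounded through all
  sets of the classes instead of the available ones, at the price of a factor of order
  \<open>x\<close>.\<close>

lemma pot_N_step:
  assumes g: "good i H" and i: "i < T" and C: "C \<noteq> {}" "C \<subseteq> V" "card C + Suc a \<le> r - 1" and J: "J \<subseteq> U"
  shows "(\<Sum>A\<in>avail H. pot_N (Suc i) (insert A H) C a J) / real (card (avail H)) \<le> pot_N i H C a J"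
proof -
  note gd = goodD[OF g]
  define M where "M = card C + Suc a"
  define inc where "inc = bnd a M"
  define mn where "mn = mean a M"
  define Q where "Q = real (card (avail H))"
  define d where "d A = (if A \<in> C then 0 else Nw H (insert A C) a J)" for A
  define D where "D = (\<Sum>A\<in>avail H. d A) / Q"
  have inc: "0 < inc" unfolding inc_def by (rule bnd_pos)
  have Qpos: "0 < Q" using card_avail_bounds(3)[OF g i] finite_avail by (simp add: Q_def card_gt_0_iff)
  have d0: "0 \<le> d A" for A unfolding d_def Nw_def using wt_bounds(1) by (auto intro: ext_sum_nonneg)
  have db: "d A \<le> inc" if "A \<in> avail H" for A
    using that Nw_increment_le[OF g C J, of A] avail_D inc unfolding d_def inc_def M_def by auto
  have "(\<Sum>A\<in>avail H. d A) = (\<Sum>A\<in>avail H - C. Nw H (insert A C) a J)"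
    using finite_avail by (intro sum.mono_neutral_cong_right) (auto simp: d_def)
  also have "\<dots> = (\<Sum>(F, K)\<in>ext_fam H C a (2 * \<kappa>). wt J K * real (card ((avail H - C) \<inter> E (\<Union>(C \<union> F)) K)))"
    unfolding Nw_def using avail_D gd(7) C(1) by (intro sum_ext_sum_insert) auto
  also have "\<dots> \<le> (\<Sum>(F, K)\<in>ext_fam H C a (2 * \<kappa>). wt J K * \<omega> ^ card K * (N * exp (- lam * real (M - 1))))"
  proof (rule sum_mono)
    fix p assume p: "p \<in> ext_fam H C a (2 * \<kappa>)"
    obtain F K where FK: "p = (F, K)" by (cases p)
    have F: "F \<subseteq> H - C" "card F = a" "card K \<le> 2 * \<kappa>" "sunflower_with (C \<union> F) K"
      using p FK by (auto simp: ext_fam_def)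
    have fin: "finite F" "finite C"
      using F gd(7) C(2) finite_V finite_subset by (meson finite_Diff finite_subset)+
    have "card (C \<union> F) = M - 1"
      using F(1,2) fin by (subst card_Un_disjoint) (auto simp: M_def)
    moreover have "C \<union> F \<subseteq> V" using C F gd(1) by blast
    ultimately have "real (card (E (\<Union>(C \<union> F)) K)) \<le> N * \<omega> ^ card K * exp (- lam * real (M - 1))"
      using E_small[of "C \<union> F" K] F C by (simp add: M_def)
    moreover have "card ((avail H - C) \<inter> E (\<Union>(C \<union> F)) K) \<le> card (E (\<Union>(C \<union> F)) K)"
      by (intro card_mono) auto
    ultimately have "real (card ((avail H - C) \<inter> E (\<Union>(C \<union> F)) K)) \<le> N * \<omega> ^ card K * exp (- lam * real (M - 1))"
      by linarith
    then have "wt J K * real (card ((avail H - C) \<inter> E (\<Union>(C \<union> F)) K)) \<le> wt J K * (N * \<omega> ^ card K * exp (- lam * real (M - 1)))"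
      using wt_bounds(1) by (intro mult_left_mono)
    then show "(case p of (F, K) \<Rightarrow> wt J K * real (card ((avail H - C) \<inter> E (\<Union>(C \<union> F)) K)))
        \<le> (case p of (F, K) \<Rightarrow> wt J K * \<omega> ^ card K * (N * exp (- lam * real (M - 1))))"
      by (simp add: FK algebra_simps)
  qed
  also have "\<dots> = (\<Sum>(F, K)\<in>ext_fam H C a (2 * \<kappa>). wt J K * \<omega> ^ card K) * (N * exp (- lam * real (M - 1)))"
    by (simp add: sum_distrib_right case_prod_unfold)
  also have "\<dots> \<le> (x * bnd a (M - 1)) * (N * exp (- lam * real (M - 1)))"
    using Nw_weight_sum[OF g C J] by (intro mult_right_mono) (auto simp: M_def)
  finally have tot: "(\<Sum>A\<in>avail H. d A) \<le> (x * bnd a (M - 1) * exp (- lam * real (M - 1))) * N"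
    by (simp add: algebra_simps)
  have "D \<le> 8 / 7 * x * (x * bnd a (M - 1) * exp (- lam * real (M - 1)))"
    unfolding D_def Q_def using d0 bnd_pos[of a "M - 1"] x_pos tot
    by (intro inverse_card_avail_le[OF g i]) (auto intro: sum_nonneg)
  also have "\<dots> \<le> mn"
    using bnd_pos[of a "M - 1"] x_pos by (simp add: mn_def mean_def power2_eq_square)
  finally have D: "D \<le> mn" .
  have pot: "pot_N k G C a J = exp ((Nw G C (Suc a) J - bnd (Suc a) M / 2) / inc - 2 * real k * mn / inc)" for k G
    by (simp only: pot_N_def M_def inc_def mn_def)
  let ?k = "exp ((Nw H C (Suc a) J - bnd (Suc a) M / 2) / inc - 2 * real (Suc i) * mn / inc)"
  have "pot_N (Suc i) (insert A H) C a J = ?k * exp ((1 / inc) * d A)" if "A \<in> avail H" for A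
  proof -
    have "Nw (insert A H) C (Suc a) J = Nw H C (Suc a) J + d A"
      unfolding d_def Nw_def using ext_sum_insert[OF gd(7) avail_D(2)[OF that], of C] ext_sum_insert_in[of A C] by auto
    then show ?thesis
      by (simp add: pot mult_exp_exp add_divide_distrib diff_divide_distrib)
  qed
  then have "(\<Sum>A\<in>avail H. pot_N (Suc i) (insert A H) C a J) / Q = ?k * ((\<Sum>A\<in>avail H. exp ((1 / inc) * d A)) / Q)"
    by (simp add: sum_distrib_left)
  also have "\<dots> \<le> ?k * exp ((1 / inc) * D + (1 / inc)\<^sup>2 * inc * D)"
    unfolding D_def Q_def using finite_avail card_avail_bounds(3)[OF g i] d0 db inc
    by (intro mult_left_mono average_exp_le) auto
  \<comment> \<open>As the weight is \<open>1 / inc\<close>, the second-moment term equals the mean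
    term; hence the factor 2 in \<open>pot_N\<close>.\<close>
  also have "(1 / inc) * D + (1 / inc)\<^sup>2 * inc * D = 2 * D / inc"
    using inc by (simp add: power2_eq_square)
  also have "?k * exp (2 * D / inc) \<le> ?k * exp (2 * mn / inc)"
    using D inc by (intro mult_left_mono) (auto intro: divide_right_mono)
  also have "\<dots> = pot_N i H C a J"
    by (simp add: pot mult_exp_exp add_divide_distrib algebra_simps)
  finally show ?thesis by (simp add: Q_def)
qed

text \<open>A first-moment budget: the indicator of failure plus a bound on the failure probability
  for each remaining step.\<close>

definition "pot_sep i H = (if separated H then 0 else 1) + real (T - i) * (2 * x * (real T * \<nu>))"

lemma pot_sep_step:
  assumes g: "good i H" and i: "i < T"
  shows "(\<Sum>A\<in>avail H. pot_sep (Suc i) (insert A H)) / real (card (avail H)) \<le> pot_sep i H"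
proof -
  note gd = goodD[OF g]
  define Q where "Q = real (card (avail H))"
  define p where "p = 2 * x * (real T * \<nu>)"
  define X where "X = {A \<in> avail H. \<not> separated (insert A H)}"
  have Qpos: "0 < Q" using card_avail_bounds(3)[OF g i] finite_avail by (simp add: Q_def card_gt_0_iff)
  have sub: "X \<subseteq> (\<Union>B\<in>H. {A \<in> V. \<kappa> < card (A \<inter> B)})"
  proof
    fix A assume A: "A \<in> X"
    then have "\<exists>B\<in>H. 2 * \<kappa> < card (A \<inter> B)"
      using gd(3) unfolding X_def separated_def by (auto simp: Int_commute not_le)
    then obtain B where "B \<in> H" "\<kappa> < card (A \<inter> B)" by auto
    moreover have "A \<in> V" using A avail_D by (auto simp: X_def)
    ultimately show "A \<in> (\<Union>B\<in>H. {A \<in> V. \<kappa> < card (A \<inter> B)})" by blast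
  qed
  have "card X \<le> (\<Sum>B\<in>H. card {A \<in> V. \<kappa> < card (A \<inter> B)})"
    using gd(7) finite_V by (intro order_trans[OF card_mono[OF _ sub]] card_UN_le) auto
  then have "real (card X) \<le> (\<Sum>B\<in>H. real (card {A \<in> V. \<kappa> < card (A \<inter> B)}))" by (simp flip: of_nat_sum)
  also have "\<dots> \<le> (\<Sum>B\<in>H. \<nu> * N)" using gd(1) by (intro sum_mono card_near_le) auto
  also have "\<dots> = real i * (\<nu> * N)" using gd(2) by simp
  also have "\<dots> \<le> real T * (\<nu> * N)" using i \<nu>_pos by (intro mult_right_mono) auto
  finally have "real (card X) / Q \<le> 8 / 7 * x * (real T * \<nu>)"
    unfolding Q_def using \<nu>_pos by (intro inverse_card_avail_le[OF g i]) (auto simp: mult.assoc)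
  also have "\<dots> \<le> p" using x_pos \<nu>_pos by (simp add: p_def)
  finally have Xp: "real (card X) / Q \<le> p" .
  have Ti: "real (T - i) = real (T - Suc i) + 1" using i by simp
  have "(\<Sum>A\<in>avail H. pot_sep (Suc i) (insert A H)) = (\<Sum>A\<in>avail H. if separated (insert A H) then 0 else 1) + Q * (real (T - Suc i) * p)"
    by (simp only: pot_sep_def p_def[symmetric] sum.distrib sum_constant Q_def)
  also have "(\<Sum>A\<in>avail H. if separated (insert A H) then 0 else 1) = (\<Sum>A\<in>X. 1 :: real)"
    using finite_avail unfolding X_def by (intro sum.mono_neutral_cong_right) auto
  also have "\<dots> = real (card X)" by simp
  finally have "(\<Sum>A\<in>avail H. pot_sep (Suc i) (insert A H)) / Q = real (card X) / Q + real (T - Suc i) * p"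
    using Qpos by (simp add: add_divide_distrib)
  also have "\<dots> \<le> pot_sep i H"
  proof -
    have "pot_sep i H = real (T - i) * p" using gd(3) by (simp add: pot_sep_def p_def)
    then show ?thesis using Xp by (simp add: Ti distrib_right)
  qed
  finally show ?thesis by (simp add: Q_def)
qed

end

section \<open>The potential\<close>

lemma card_small_subsets:
  assumes "finite V"
  shows "card {C. C \<subseteq> V \<and> card C \<le> k} \<le> (card V + 1) ^ k"
proof (induction k)
  case 0
  have "{C. C \<subseteq> V \<and> card C \<le> 0} \<subseteq> {{}}" using assms finite_subset by fastforce
  then have "card {C. C \<subseteq> V \<and> card C \<le> 0} \<le> card {{} :: 'a set}" by (rule card_mono[rotated]) simp
  then show ?case by simp
next
  case (Suc k)
  let ?S = "\<lambda>k. {C. C \<subseteq> V \<and> card C \<le> k}"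
  have fin: "finite (?S k)" using assms by simp
  have "?S (Suc k) \<subseteq> insert {} ((\<lambda>(v, C). insert v C) ` (V \<times> ?S k))"
  proof
    fix C assume C: "C \<in> ?S (Suc k)"
    show "C \<in> insert {} ((\<lambda>(v, C). insert v C) ` (V \<times> ?S k))"
    proof (cases "C = {}")
      case False
      then obtain v where v: "v \<in> C" by blast
      have "finite C" using C assms finite_subset by blast
      then have "card (C - {v}) = card C - 1" using v by simp
      moreover have "card C \<le> Suc k" using C by simp
      ultimately have "card (C - {v}) \<le> k" by linarith
      then have "(v, C - {v}) \<in> V \<times> ?S k" using C v by auto
      moreover have "C = insert v (C - {v})" using v by blast
      ultimately show ?thesis by (metis (mono_tags, lifting) case_prod_conv image_eqI insertCI)
    qed simp
  qed
  then have "card (?S (Suc k)) \<le> card (insert {} ((\<lambda>(v, C). insert v C) ` (V \<times> ?S k)))"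
    using assms fin by (intro card_mono) auto
  also have "\<dots> \<le> Suc (card ((\<lambda>(v, C). insert v C) ` (V \<times> ?S k)))" by (rule card_insert_le_m1) simp_all
  also have "\<dots> \<le> Suc (card (V \<times> ?S k))"
    unfolding Suc_le_mono using assms fin by (intro card_image_le) auto
  also have "\<dots> = Suc (card V * card (?S k))" by (simp add: card_cartesian_product)
  also have "\<dots> \<le> Suc (card V * (card V + 1) ^ k)" using Suc.IH by simp
  also have "\<dots> \<le> (card V + 1) ^ Suc k" by simp
  finally show ?case .
qed

context process_params
begin

definition "idx_open = {(s :: real, C, K). s \<in> {1, -1} \<and> C \<subseteq> V \<and> card C \<le> r - 1 \<and> K \<subseteq> U}"
definition "idx_W = {(s :: real, j, u). s \<in> {1, -1} \<and> j < r - 2 \<and> u \<in> V}"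
definition "idx_N = {(C, a, J). C \<noteq> {} \<and> C \<subseteq> V \<and> card C + Suc a \<le> r - 1 \<and> J \<subseteq> U}"

text \<open>The indicator and \<open>pot_sep\<close> are at least 1 on failure, and a violated test
  makes the exponent of its summand nonnegative. All summands being nonnegative,
  \<open>\<Phi> i H < 1\<close> certifies \<open>good i H\<close>.\<close>

definition "\<Phi> i H = (if H \<subseteq> V \<and> card H = i then 0 else 1) + pot_sep i H
  + (\<Sum>(C, a, J)\<in>idx_N. pot_N i H C a J)
  + (\<Sum>(s, j, u)\<in>idx_W. pot_W s i H (Suc j) u)
  + (\<Sum>(s, C, K)\<in>idx_open. pot_open s i H C K)"

lemma finite_idx: "finite idx_open" "finite idx_W" "finite idx_N"
proof -
  have "idx_open \<subseteq> {1, -1} \<times> Pow V \<times> Pow U" by (auto simp: idx_open_def)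
  then show "finite idx_open" using finite_V finite_U by (rule_tac finite_subset) auto
  have "idx_W \<subseteq> {1, -1} \<times> {..<r} \<times> V" by (auto simp: idx_W_def)
  then show "finite idx_W" using finite_V by (rule_tac finite_subset) auto
  have "idx_N \<subseteq> Pow V \<times> {..<r} \<times> Pow U" by (auto simp: idx_N_def)
  then show "finite idx_N" using finite_V finite_U by (rule_tac finite_subset) auto
qed

lemma pot_nonneg: "0 \<le> pot_open s i H C K" "0 \<le> pot_W s i H j u" "0 \<le> pot_N i H C a J" "0 \<le> pot_sep i H"
  using \<nu>_pos x_pos by (auto simp: pot_open_def pot_W_def pot_N_def pot_sep_def)

lemma sums_nonneg:
  "0 \<le> (\<Sum>(C, a, J)\<in>idx_N. pot_N i H C a J)" "0 \<le> (\<Sum>(s, j, u)\<in>idx_W. pot_W s i H (Suc j) u)"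
  "0 \<le> (\<Sum>(s, C, K)\<in>idx_open. pot_open s i H C K)"
  using pot_nonneg by (auto intro!: sum_nonneg)

lemma \<Phi>_nonneg: "0 \<le> \<Phi> i H"
  unfolding \<Phi>_def using sums_nonneg[of i H] pot_nonneg(4)[of i H] by auto

lemma good_if_small:
  assumes small: "\<Phi> i H < 1" and i: "i \<le> T"
  shows "good i H"
proof -
  note nn = sums_nonneg[of i H] pot_nonneg(4)[of i H]
  have base: "H \<subseteq> V" "card H = i" using small nn unfolding \<Phi>_def by (auto split: if_splits)
  have ind: "(0 :: real) \<le> (if H \<subseteq> V \<and> card H = i then 0 else 1)" by simp
  have N1: "pot_N i H C a J < 1" if "(C, a, J) \<in> idx_N" for C a J
  proof -
    have "pot_N i H C a J \<le> (\<Sum>(C, a, J)\<in>idx_N. pot_N i H C a J)"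
      using member_le_sum[OF that, of "\<lambda>(C, a, J). pot_N i H C a J"] finite_idx pot_nonneg by auto
    then show ?thesis using small nn ind unfolding \<Phi>_def by linarith
  qed
  have W1: "pot_W s i H (Suc j) u < 1" if "(s, j, u) \<in> idx_W" for s j u
  proof -
    have "pot_W s i H (Suc j) u \<le> (\<Sum>(s, j, u)\<in>idx_W. pot_W s i H (Suc j) u)"
      using member_le_sum[OF that, of "\<lambda>(s, j, u). pot_W s i H (Suc j) u"] finite_idx pot_nonneg by auto
    then show ?thesis using small nn ind unfolding \<Phi>_def by linarith
  qed
  have O1: "pot_open s i H C K < 1" if "(s, C, K) \<in> idx_open" for s C K
  proof -
    have "pot_open s i H C K \<le> (\<Sum>(s, C, K)\<in>idx_open. pot_open s i H C K)"
      using member_le_sum[OF that, of "\<lambda>(s, C, K). pot_open s i H C K"] finite_idx pot_nonneg by auto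
    then show ?thesis using small nn ind unfolding \<Phi>_def by linarith
  qed
  have th: "0 < \<theta>" using x_pos by (simp add: \<theta>_def)
  have "separated H"
  proof (rule ccontr)
    assume "\<not> separated H"
    then have "1 \<le> pot_sep i H" using \<nu>_pos x_pos by (simp add: pot_sep_def)
    then show False using small nn ind unfolding \<Phi>_def by linarith
  qed
  moreover have "counts_bounded (x ^ 4) H"
    unfolding counts_bounded_def
  proof (intro allI impI)
    fix C a J assume C: "C \<noteq> {}" "C \<subseteq> V" "1 \<le> a" "card C + a \<le> r - 1" "J \<subseteq> U"
    obtain a' where a': "a = Suc a'" using C(3) by (cases a) auto
    define M where "M = card C + a"
    have "0 < card C" using C finite_V finite_subset by (metis card_gt_0_iff)
    then have M: "a' + 2 \<le> M" "M \<le> r - 1" using C a' by (auto simp: M_def)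
    have "pot_N i H C a' J < 1" using C a' by (intro N1) (simp add: idx_N_def)
    then have "(Nw H C a J - bnd a M / 2 - 2 * real i * mean a' M) / bnd a' M < 0"
      by (simp add: pot_N_def a' M_def diff_divide_distrib)
    then have "Nw H C a J - bnd a M / 2 - 2 * real i * mean a' M < 0"
      using bnd_pos[of a' M] by (simp add: divide_less_0_iff)
    moreover have "2 * real i * mean a' M \<le> 2 * real T * mean a' M"
      using i bnd_pos[of a' "M - 1"] by (intro mult_right_mono) (auto simp: mean_def)
    moreover have "4 * real T * mean a' M \<le> bnd a M" using mean_le[OF M] by (simp add: a')
    ultimately have "Nw H C a J \<le> bnd a M" by linarith
    then show "Nw H C a J \<le> (x ^ 4) ^ a * exp (real a * real (r - (card C + a)) * lam / 2)"
      by (simp add: bnd_def M_def)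
  qed
  moreover have "W_tracked i H"
    unfolding W_tracked_def
  proof (intro ballI impI)
    fix u j assume u: "u \<in> V" "near_ok H u" "j \<in> {1..r - 2}"
    then obtain j' where j': "j = Suc j'" "j' < r - 2" by (cases j) auto
    have "s * (Wn H j u / sig j - xt j i) - \<epsilon> i < 0" if s: "s = 1 \<or> s = -1" for s :: real
    proof -
      have "pot_W s i H (Suc j') u < 1" using s u j' by (intro W1) (auto simp: idx_W_def)
      then show ?thesis using u th j' by (simp add: pot_W_def mult_less_0_iff)
    qed
    from this[of 1] this[of "-1"] show "\<bar>Wn H j u / sig j - xt j i\<bar> \<le> \<epsilon> i" by auto
  qed
  moreover have "open_tracked (q i) (\<epsilon> i) H"
    unfolding open_tracked_def
  proof (intro allI impI)
    fix C K assume val: "valid H C K"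
    define c where "c = real (card (E (\<Union>C) K)) * q i"
    define Ow where "Ow = real (card (avail H \<inter> E (\<Union>C) K))"
    have c: "0 < c" using valid_E_pos[OF val] q_pos[OF i] by (simp add: c_def)
    have idx: "C \<subseteq> V" "card C \<le> r - 1" "K \<subseteq> U" using val V_D(1) unfolding valid_def by blast+
    have "s * (Ow / c - 1) - \<epsilon> i < 0" if s: "s = 1 \<or> s = -1" for s :: real
    proof -
      have "pot_open s i H C K < 1" using s idx by (intro O1) (auto simp: idx_open_def)
      then show ?thesis using val th by (simp add: pot_open_def c_def Ow_def mult_less_0_iff)
    qed
    from this[of 1] this[of "-1"] have "\<bar>Ow / c - 1\<bar> \<le> \<epsilon> i" by auto
    then have "\<bar>Ow / c - 1\<bar> * c \<le> \<epsilon> i * c" using c by (intro mult_right_mono) auto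
    moreover have "\<bar>Ow / c - 1\<bar> * c = \<bar>Ow - c\<bar>"
      using c abs_mult[of "Ow / c - 1" c] by (simp add: left_diff_distrib)
    ultimately show "\<bar>real (card (avail H \<inter> E (\<Union>C) K)) - q i * real (card (E (\<Union>C) K))\<bar>
        \<le> \<epsilon> i * q i * real (card (E (\<Union>C) K))"
      by (simp add: c_def Ow_def mult.commute mult.left_commute)
  qed
  ultimately show ?thesis using base by (simp add: good_def)
qed

lemma \<Phi>_step:
  assumes i: "i < T" and small: "\<Phi> i H < 1"
  shows "measure_pmf.expectation (process_step r U w H) (\<Phi> (Suc i)) \<le> \<Phi> i H"
proof -
  have g: "good i H" using good_if_small[OF small] i by simp
  note gd = goodD[OF g]
  let ?Q = "real (card (avail H))"
  have swap: "(\<Sum>A\<in>avail H. \<Sum>p\<in>I. f A p) / ?Q = (\<Sum>p\<in>I. (\<Sum>A\<in>avail H. f A p) / ?Q)" for I :: "'c set" and f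
    by (subst sum.swap) (simp add: sum_divide_distrib)
  have base: "(if insert A H \<subseteq> V \<and> card (insert A H) = Suc i then 0 else 1) = (0 :: real)" if "A \<in> avail H" for A
    using that avail_D[OF that] gd by simp
  have "measure_pmf.expectation (process_step r U w H) (\<Phi> (Suc i)) = (\<Sum>A\<in>avail H. \<Phi> (Suc i) (insert A H)) / ?Q"
    by (rule expectation_process_step[OF finite_U card_avail_bounds(3)[OF g i]])
  also have "\<dots> = (\<Sum>A\<in>avail H. pot_sep (Suc i) (insert A H)) / ?Q
      + (\<Sum>p\<in>idx_N. (\<Sum>A\<in>avail H. case p of (C, a, J) \<Rightarrow> pot_N (Suc i) (insert A H) C a J) / ?Q)
      + (\<Sum>p\<in>idx_W. (\<Sum>A\<in>avail H. case p of (s, j, u) \<Rightarrow> pot_W s (Suc i) (insert A H) (Suc j) u) / ?Q)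
      + (\<Sum>p\<in>idx_open. (\<Sum>A\<in>avail H. case p of (s, C, K) \<Rightarrow> pot_open s (Suc i) (insert A H) C K) / ?Q)"
    using base by (simp add: \<Phi>_def sum.distrib add_divide_distrib swap cong: sum.cong)
  also have "\<dots> \<le> pot_sep i H + (\<Sum>(C, a, J)\<in>idx_N. pot_N i H C a J)
      + (\<Sum>(s, j, u)\<in>idx_W. pot_W s i H (Suc j) u) + (\<Sum>(s, C, K)\<in>idx_open. pot_open s i H C K)"
  proof (intro add_mono sum_mono pot_sep_step[OF g i])
    fix p assume p: "p \<in> idx_N"
    then show "(\<Sum>A\<in>avail H. case p of (C, a, J) \<Rightarrow> pot_N (Suc i) (insert A H) C a J) / ?Q
        \<le> (case p of (C, a, J) \<Rightarrow> pot_N i H C a J)"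
      using pot_N_step[OF g i] by (auto simp: idx_N_def)
  next
    fix p assume p: "p \<in> idx_W"
    then show "(\<Sum>A\<in>avail H. case p of (s, j, u) \<Rightarrow> pot_W s (Suc i) (insert A H) (Suc j) u) / ?Q
        \<le> (case p of (s, j, u) \<Rightarrow> pot_W s i H (Suc j) u)"
      using pot_W_step[OF g i] by (auto simp: idx_W_def)
  next
    fix p assume p: "p \<in> idx_open"
    then show "(\<Sum>A\<in>avail H. case p of (s, C, K) \<Rightarrow> pot_open s (Suc i) (insert A H) C K) / ?Q
        \<le> (case p of (s, C, K) \<Rightarrow> pot_open s i H C K)"
      using pot_open_step[OF g i] by (auto simp: idx_open_def)
  qed
  also have "\<dots> = \<Phi> i H" using gd by (simp add: \<Phi>_def)
  finally show ?thesis .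
qed

section \<open>Initial values of the potential\<close>

lemma avail_initial: "avail {} = V"
proof -
  have "sunflower_free r {S}" for S :: "'a set"
  proof -
    have "card F \<noteq> r" if "F \<subseteq> {S}" for F using that r_ge_3 card_mono[of "{S}" F] by auto
    then show ?thesis by (auto simp: sunflower_free_def is_sunflower_def)
  qed
  then show ?thesis by (auto simp: available_def)
qed

lemma ext_sum_initial: "ext_sum {} C (Suc a) m f = 0"
proof -
  have "ext_fam {} C (Suc a) m = {}" by (auto simp: ext_fam_def)
  then show ?thesis by (simp add: ext_sum_def)
qed

lemma \<theta>_\<epsilon>_0: "\<theta> * \<epsilon> 0 = x"
  using x_pos by (simp add: \<theta>_def \<epsilon>_0 eval_nat_numeral)

text \<open>All deviations and counts vanish for the empty family, so every exponential test starts
  with its full margin, at least \<open>x\<close>.\<close>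

lemma pot_initial:
  "pot_open s 0 {} C K \<le> exp (- x)" "pot_W s 0 {} (Suc j) u \<le> exp (- x)"
  "card C + Suc a \<le> r - 1 \<Longrightarrow> pot_N 0 {} C a J \<le> exp (- x)"
  "pot_sep 0 ({} :: 'a set set) \<le> 2 / x ^ 7"
proof -
  show "pot_open s 0 {} C K \<le> exp (- x)"
  proof (cases "valid {} C K")
    case True
    have "V \<inter> E (\<Union>C) K = E (\<Union>C) K" by (auto simp: E_def)
    moreover have "E (\<Union>C) K \<noteq> {}" using valid_E_pos[OF True] by auto
    ultimately show ?thesis using True valid_E_pos[OF True] \<theta>_\<epsilon>_0
      by (simp add: pot_open_def avail_initial q_0)
  qed (simp add: pot_open_def)
  show "pot_W s 0 {} (Suc j) u \<le> exp (- x)"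
    using \<theta>_\<epsilon>_0 by (simp add: pot_W_def Wn_def ext_sum_initial xt_at_0)
  show "pot_N 0 {} C a J \<le> exp (- x)" if "card C + Suc a \<le> r - 1"
  proof -
    define M where "M = card C + Suc a"
    have "x ^ 4 * bnd a M \<le> bnd (Suc a) M"
    proof -
      have "real a * real (r - M) * lam / 2 \<le> real (Suc a) * real (r - M) * lam / 2"
        using lam_nonneg by (intro divide_right_mono mult_right_mono) auto
      then show ?thesis
        unfolding bnd_def power_Suc mult.assoc[symmetric] using x_pos by (intro mult_left_mono) auto
    qed
    moreover have "2 * x \<le> x ^ 4"
    proof -
      have "2 * x \<le> x * x" using x_ge by (intro mult_right_mono) auto
      also have "\<dots> \<le> x ^ 4" using power_increasing[of 2 4 x] x_ge by (simp add: power2_eq_square)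
      finally show ?thesis .
    qed
    then have "2 * x * bnd a M \<le> x ^ 4 * bnd a M" using bnd_pos[of a M] by (intro mult_right_mono) auto
    ultimately have "2 * x * bnd a M \<le> bnd (Suc a) M" by linarith
    then have "x \<le> bnd (Suc a) M / 2 / bnd a M" using bnd_pos[of a M] by (simp add: field_simps)
    then show ?thesis by (simp add: pot_N_def Nw_def ext_sum_initial M_def)
  qed
  have "pot_sep 0 ({} :: 'a set set) = \<nu> * (real T)\<^sup>2 * x ^ 8 * (2 / x ^ 7)"
    using x_pos by (simp add: pot_sep_def separated_def power2_eq_square eval_nat_numeral)
  also have "\<dots> \<le> 1 * (2 / x ^ 7)" using \<nu>_le x_pos by (intro mult_right_mono) auto
  finally show "pot_sep 0 ({} :: 'a set set) \<le> 2 / x ^ 7" by simp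
qed

lemma card_idx:
  "real (card idx_N) + real (card idx_W) + real (card idx_open) \<le> 5 * real r * 2 ^ ((n + 1) * r)"
proof -
  define \<C> where "\<C> = {C. C \<subseteq> V \<and> card C \<le> r - 1}"
  define Z :: nat where "Z = (2 ^ (n + 1)) ^ (r - 1)"
  have fin: "finite \<C>" using finite_V by (simp add: \<C>_def)
  have V2: "card V \<le> 2 ^ n"
    unfolding card_uniform_subsets[OF finite_U] by (rule binomial_le_pow2)
  have C: "card \<C> \<le> Z"
  proof -
    have "card \<C> \<le> (card V + 1) ^ (r - 1)" unfolding \<C>_def by (rule card_small_subsets[OF finite_V])
    also have "\<dots> \<le> Z" unfolding Z_def
    proof (rule power_mono)
      have "card V + 1 \<le> 2 ^ n + 2 ^ n" using V2 by (intro add_mono) auto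
      then show "card V + 1 \<le> 2 ^ (n + 1)" by simp
    qed simp
    finally show ?thesis .
  qed
  have Z1: "1 \<le> Z" by (simp add: Z_def)
  have U2: "card (Pow U) = 2 ^ n" using finite_U by (simp add: card_Pow)
  have "card idx_N \<le> card (\<C> \<times> {..<r} \<times> Pow U)"
    using fin finite_U by (intro card_mono) (auto simp: idx_N_def \<C>_def)
  also have "\<dots> \<le> Z * (r * 2 ^ n)" using C U2 by (simp add: card_cartesian_product)
  finally have N: "card idx_N \<le> r * (Z * 2 ^ n)" by (simp add: algebra_simps)
  have "card idx_W \<le> card ({1, -1 :: real} \<times> {..<r} \<times> V)"
    using finite_V by (intro card_mono) (auto simp: idx_W_def)
  also have "\<dots> = 2 * (r * card V)" by (simp add: card_cartesian_product)
  also have "\<dots> \<le> 2 * (r * 2 ^ n)" using V2 by (intro mult_le_mono) auto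
  also have "\<dots> \<le> 2 * (r * (Z * 2 ^ n))" using Z1 by simp
  finally have W: "card idx_W \<le> 2 * (r * (Z * 2 ^ n))" .
  have "card idx_open \<le> card ({1, -1 :: real} \<times> \<C> \<times> Pow U)"
    using fin finite_U by (intro card_mono) (auto simp: idx_open_def \<C>_def)
  also have "\<dots> = 2 * (card \<C> * 2 ^ n)" using U2 by (simp add: card_cartesian_product)
  also have "\<dots> \<le> 2 * (Z * 2 ^ n)" using C by (intro mult_le_mono) auto
  also have "\<dots> \<le> 2 * (r * (Z * 2 ^ n))" using r_ge_3 by simp
  finally have "card idx_N + card idx_W + card idx_open \<le> 5 * r * (Z * 2 ^ n)" using N W by linarith
  also have "Z * 2 ^ n \<le> 2 ^ ((n + 1) * r)"
  proof -
    have "Z * 2 ^ n \<le> Z * 2 ^ (n + 1)" by simp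
    also have "\<dots> = 2 ^ ((n + 1) * Suc (r - 1))" by (simp add: Z_def power_mult[symmetric] power_add[symmetric])
    finally show ?thesis using r_ge_3 by simp
  qed
  finally have "card idx_N + card idx_W + card idx_open \<le> 5 * r * 2 ^ ((n + 1) * r)" by simp
  then have "real (card idx_N + card idx_W + card idx_open) \<le> real (5 * r * 2 ^ ((n + 1) * r))"
    by (rule of_nat_mono)
  then show ?thesis by simp
qed

lemma \<Phi>_initial: "\<Phi> 0 {} \<le> 2 / x ^ 7 + 5 * real r * 2 ^ ((n + 1) * r) * exp (- x)"
proof -
  define SN where "SN = (\<Sum>(C, a, J)\<in>idx_N. pot_N 0 {} C a J)"
  define SW where "SW = (\<Sum>(s, j, u)\<in>idx_W. pot_W s 0 {} (Suc j) u)"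
  define SO where "SO = (\<Sum>(s, C, K)\<in>idx_open. pot_open s 0 {} C K)"
  have "SN \<le> (\<Sum>p\<in>idx_N. exp (- x))"
    unfolding SN_def using pot_initial(3) by (intro sum_mono) (auto simp: idx_N_def)
  moreover have "SW \<le> (\<Sum>p\<in>idx_W. exp (- x))"
    unfolding SW_def using pot_initial(2) by (intro sum_mono) auto
  moreover have "SO \<le> (\<Sum>p\<in>idx_open. exp (- x))"
    unfolding SO_def using pot_initial(1) by (intro sum_mono) auto
  moreover have "\<Phi> 0 {} = pot_sep 0 ({} :: 'a set set) + SN + SW + SO"
    unfolding \<Phi>_def SN_def SW_def SO_def by simp
  ultimately have "\<Phi> 0 {} \<le> 2 / x ^ 7 + (real (card idx_N) + real (card idx_W) + real (card idx_open)) * exp (- x)"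
    using pot_initial(4) unfolding sum_constant distrib_right by linarith
  also have "\<dots> \<le> 2 / x ^ 7 + 5 * real r * 2 ^ ((n + 1) * r) * exp (- x)"
    using card_idx by (intro add_left_mono mult_right_mono) auto
  finally show ?thesis .
qed

lemma process_size:
  "measure_pmf.prob (sunflower_free_process r U w) {H. T \<le> card H}
    \<ge> 1 - (2 / x ^ 7 + 5 * real r * 2 ^ ((n + 1) * r) * exp (- x))"
proof (cases "\<Phi> 0 {} < 1")
  case True
  have "measure_pmf.prob (sunflower_free_process r U w) {H. T \<le> card H} \<ge> 1 - \<Phi> 0 {}"
  proof (rule potential_card_bound[OF finite_U _ \<Phi>_step \<Phi>_nonneg _ True])
    show "card H = T" if "\<Phi> T H < 1" for H using good_if_small[OF that] goodD(2) by auto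
  qed (use r_ge_3 in auto)
  then show ?thesis using \<Phi>_initial by linarith
next
  case False
  then show ?thesis
    using \<Phi>_initial measure_nonneg[of "measure_pmf (sunflower_free_process r U w)" "{H. T \<le> card H}"] by linarith
qed

end

section \<open>The sunflower degree\<close>

lemma choose_shrink_top_lower:
  assumes "b + k < m"
  shows "real (m choose k) * exp (- real b * real k / real (m - b - k)) \<le> real ((m - b) choose k)"
  using assms
proof (induction b)
  case (Suc b)
  define M where "M = m - Suc b"
  have M: "m - b = Suc M" "k < M" "m - Suc b - k = M - k" using Suc.prems by (auto simp: M_def)
  have "(Suc M) * (M choose k) = (Suc M - k) * (Suc M choose k)"
    using binomial_absorb_comp[of "Suc M" k] by simp
  then have "real (Suc M) * real (M choose k) = real (Suc M - k) * real (Suc M choose k)"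
    by (metis of_nat_mult)
  then have eq: "real (M choose k) = real (Suc M choose k) * (real (Suc M - k) / real (Suc M))"
    by (simp add: field_simps del: binomial_Suc_Suc of_nat_Suc)
  have "real (Suc M) / real (Suc M - k) \<le> exp (real k / real (Suc M - k))"
  proof -
    have "real (Suc M) / real (Suc M - k) = 1 + real k / real (Suc M - k)"
      using M(2) by (simp add: field_simps of_nat_diff)
    then show ?thesis using exp_ge_add_one_self[of "real k / real (Suc M - k)"] by simp
  qed
  also have "\<dots> \<le> exp (real k / real (M - k))"
    using M(2) by (auto intro!: divide_left_mono mult_pos_pos)
  finally have "exp (- (real k / real (M - k))) \<le> real (Suc M - k) / real (Suc M)"
    using M(2) by (simp add: exp_minus inverse_eq_divide field_simps)
  moreover have "real (m choose k) * exp (- real b * real k / real (M - k)) \<le> real (Suc M choose k)"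
  proof -
    have "real b * real k / real (m - b - k) \<le> real b * real k / real (M - k)"
      using M Suc.prems by (intro divide_left_mono) auto
    then have "real (m choose k) * exp (- real b * real k / real (M - k))
        \<le> real (m choose k) * exp (- real b * real k / real (m - b - k))"
      by (intro mult_left_mono) auto
    also have "\<dots> \<le> real ((m - b) choose k)" by (rule Suc.IH) (use Suc.prems in simp)
    finally show ?thesis unfolding M(1) .
  qed
  ultimately have "real (m choose k) * exp (- real b * real k / real (M - k)) * exp (- (real k / real (M - k)))
      \<le> real (Suc M choose k) * (real (Suc M - k) / real (Suc M))"
    by (intro mult_mono) auto
  moreover have "exp (- real b * real k / real (M - k)) * exp (- (real k / real (M - k)))
      = exp (- real (Suc b) * real k / real (M - k))"
    by (simp add: mult_exp_exp add_divide_distrib diff_divide_distrib algebra_simps)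
  ultimately have "real (m choose k) * exp (- real (Suc b) * real k / real (M - k)) \<le> real (M choose k)"
    unfolding eq by (simp only: mult.assoc)
  then show ?case unfolding M(3) by (simp only: M_def)
qed simp

context uniform_family
begin

text \<open>The product telescopes: the ground set left over by one factor is the ground set of the
  next.\<close>

lemma prod_e:
  assumes "s \<le> w" "s + Suc k * (w - s) \<le> n"
  shows "(\<Prod>l\<in>{0<..<Suc k}. real (e l s)) = fact (n - w) / (fact (w - s) ^ k * fact (n - (s + Suc k * (w - s))))"
  using assms(2)
proof (induction k)
  case 0
  have "{0<..<Suc 0} = {}" by auto
  moreover have "s + Suc 0 * (w - s) = w" using assms(1) by simp
  ultimately show ?case by simp
next
  case (Suc k)
  define M where "M = n - (s + Suc k * (w - s))"
  have "{0<..<Suc (Suc k)} = insert (Suc k) {0<..<Suc k}" by auto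
  then have "(\<Prod>l\<in>{0<..<Suc (Suc k)}. real (e l s)) = real (e (Suc k) s) * (\<Prod>l\<in>{0<..<Suc k}. real (e l s))"
    by simp
  also have "(\<Prod>l\<in>{0<..<Suc k}. real (e l s)) = fact (n - w) / (fact (w - s) ^ k * fact M)"
    using Suc by (simp add: M_def)
  also have "real (e (Suc k) s) = fact M / (fact (w - s) * fact (M - (w - s)))"
    using Suc.prems unfolding e_def M_def[symmetric] by (intro binomial_fact) (auto simp: M_def)
  also have "M - (w - s) = n - (s + Suc (Suc k) * (w - s))" by (simp add: M_def)
  finally show ?case by simp
qed

text \<open>The summands agree for \<open>s \<le> \<kappa>\<close>, and the other summands of the
  degree are nonnegative. This direction suffices because the degree enters the size bound with a
  negative exponent.\<close>

lemma Dg_le_degree: "Dg \<le> sunflower_degree r n w"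
proof -
  have r1: "Suc (r - 1) = r" using r_ge_3 by simp
  let ?f = "\<lambda>s. if r * w \<le> n + (r - 1) * s
    then fact w * fact (n - w) / (fact (r - 1) * fact s * fact (w - s) ^ r * fact (n + (r - 1) * s - r * w))
    else (0 :: real)"
  have "Dg = (\<Sum>s\<le>\<kappa>. ?f s)"
    unfolding Dg_def
  proof (intro sum.cong refl)
    fix s assume "s \<in> {..\<kappa>}"
    then have s: "s \<le> w" "s < w" using w_ge \<kappa>_pos by auto
    have rw: "s + r * (w - s) = r * w - (r - 1) * s" "(r - 1) * s \<le> r * w"
    proof -
      have "(r - 1) * s \<le> r * s" by (intro mult_right_mono) auto
      also have "\<dots> \<le> r * w" using s by (intro mult_left_mono) auto
      finally show "(r - 1) * s \<le> r * w" .
      have "r * s = (r - 1) * s + s" using r1 by (metis add.commute mult_Suc)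
      moreover have "r * (w - s) + r * s = r * w" using s by (simp add: diff_mult_distrib2)
      ultimately show "s + r * (w - s) = r * w - (r - 1) * s" by linarith
    qed
    have fit: "r * w \<le> n" using U_large by simp
    have sub: "n + (r - 1) * s - r * w = n - (s + r * (w - s))" using rw fit by linarith
    have "s + Suc (r - 1) * (w - s) \<le> n" unfolding r1 using rw fit by linarith
    from prod_e[OF s(1) this]
    have "ext 0 s = fact (n - w) / (fact (w - s) ^ (r - 1) * fact (n - (s + r * (w - s)))) / fact (r - 1)"
      unfolding ext_def r1 by simp
    moreover have "real (w choose s) = fact w / (fact s * fact (w - s))"
      using s by (intro binomial_fact) auto
    moreover have "fact (w - s) ^ r = (fact (w - s) :: real) * fact (w - s) ^ (r - 1)"
      using r1 by (metis power_Suc)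
    moreover have "r * w \<le> n + (r - 1) * s" using fit by simp
    ultimately show "real (w choose s) * ext 0 s = ?f s"
      unfolding sub by (simp add: mult.commute mult.left_commute)
  qed
  also have "\<dots> \<le> (\<Sum>s<w. ?f s)"
    using w_ge \<kappa>_pos by (intro sum_mono2) auto
  finally show ?thesis by (simp add: sunflower_degree_def)
qed

text \<open>By Vandermonde the choices of a kernel and a second member number at most
  \<open>N\<close> together; the other \<open>r - 2\<close> members gain
  \<open>exp (- (r - 2) * (r + 1) * lam / 2)\<close>, at most \<open>exp (- 2 * lam)\<close>. The
  consequence is a lower bound on the number of steps.\<close>

lemma Dg_le: "Dg \<le> N ^ (r - 1) * exp (- 2 * lam)"
proof -
  have "Dg \<le> (\<Sum>s\<le>\<kappa>. real (w choose s) * (real (e 1 s) * (N ^ (r - 2) * exp (- 2 * lam))))"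
    unfolding Dg_def
  proof (intro sum_mono mult_left_mono)
    fix s assume s: "s \<in> {..\<kappa>}"
    have "real (e 1 s) * ext 1 s = real (r - 1) * ext 0 s" using ext_Suc[of 0 s] r_ge_3 by simp
    moreover have "1 * ext 0 s \<le> real (r - 1) * ext 0 s" using r_ge_3 ext_nonneg by (intro mult_right_mono) auto
    ultimately have "ext 0 s \<le> real (e 1 s) * ext 1 s" by simp
    also have "\<dots> \<le> real (e 1 s) * (N ^ (r - 2) * exp (- 2 * lam))"
    proof (intro mult_left_mono)
      have "ext 1 s \<le> N ^ (r - 1 - 1) * exp (- lam * (real (r - 1 - 1) * real (r + 1) / 2))"
        using s r_ge_3 by (intro ext_le) auto
      also have "\<dots> \<le> N ^ (r - 2) * exp (- 2 * lam)"
      proof -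
        have "1 * 4 \<le> real (r - 2) * real (r + 1)" using r_ge_3 by (intro mult_mono) auto
        then have "2 \<le> real (r - 2) * real (r + 1) / 2" by linarith
        then have "lam * 2 \<le> lam * (real (r - 2) * real (r + 1) / 2)" using lam_nonneg by (rule mult_left_mono)
        then have le: "exp (- lam * (real (r - 2) * real (r + 1) / 2)) \<le> exp (- 2 * lam)" by simp
        have r11: "r - 1 - 1 = r - 2" by simp
        show ?thesis unfolding r11 using le by (intro mult_left_mono) auto
      qed
      finally show "ext 1 s \<le> N ^ (r - 2) * exp (- 2 * lam)" .
    qed simp
    finally show "ext 0 s \<le> real (e 1 s) * (N ^ (r - 2) * exp (- 2 * lam))" .
  qed simp
  also have "\<dots> = real (\<Sum>s\<le>\<kappa>. (w choose s) * e 1 s) * (N ^ (r - 2) * exp (- 2 * lam))"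
    by (simp add: sum_distrib_right mult.assoc)
  also have "\<dots> \<le> N * (N ^ (r - 2) * exp (- 2 * lam))"
  proof (intro mult_right_mono of_nat_mono)
    have "(\<Sum>s\<le>\<kappa>. (w choose s) * e 1 s) \<le> (\<Sum>s\<le>w. (w choose s) * ((n - w) choose (w - s)))"
    proof -
      have "(w choose s) * e 1 s = (w choose s) * ((n - w) choose (w - s))" if "s \<in> {..\<kappa>}" for s
        using that w_ge by (simp add: e_def)
      then have "(\<Sum>s\<le>\<kappa>. (w choose s) * e 1 s) = (\<Sum>s\<le>\<kappa>. (w choose s) * ((n - w) choose (w - s)))"
        by (rule sum.cong[OF refl])
      also have "\<dots> \<le> (\<Sum>s\<le>w. (w choose s) * ((n - w) choose (w - s)))"
        using w_ge by (intro sum_mono2) auto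
      finally show ?thesis .
    qed
    also have "\<dots> = (w + (n - w)) choose w" by (rule vandermonde)
    also have "w + (n - w) = n" using n_ge by simp
    finally show "(\<Sum>s\<le>\<kappa>. (w choose s) * e 1 s) \<le> card V"
      by (simp add: card_uniform_subsets[OF finite_U])
  qed simp
  also have "\<dots> = N ^ Suc (r - 2) * exp (- 2 * lam)" by simp
  also have "Suc (r - 2) = r - 1" using r_ge_3 by simp
  finally show ?thesis .
qed

text \<open>The empty kernel alone suffices. The error \<epsilon> in the exponent comes from the
  points already occupied, up to \<open>r * w\<close> of them. The consequence is an upper bound on
  the number of steps.\<close>

lemma Dg_ge:
  fixes \<epsilon> :: real
  assumes "2 * real r * real w / real n \<le> \<epsilon>" "\<epsilon> \<le> 1"
  shows "N ^ (r - 1) * exp (- ((1 + \<epsilon>) * ((real w)\<^sup>2 / real n) * (real (r - 1) * real r / 2))) \<le> fact (r - 1) * Dg"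
proof -
  define \<mu> where "\<mu> = (real w)\<^sup>2 / real n"
  have each: "N * exp (- ((1 + \<epsilon>) * \<mu>) * real l) \<le> real (e l 0)" if l: "l < r" for l
  proof -
    define d where "d = n - l * w - w"
    have "Suc l * w \<le> r * w" using l by (intro mult_right_mono) auto
    then have lw: "l * w + w \<le> r * w" by simp
    have "w \<le> r * w" "0 < r * w" using r_ge_3 w_pos by auto
    then have "r * w < n" using U_large by linarith
    then have fit: "l * w + w < n" using lw by linarith
    have d: "real n - real r * real w \<le> real d"
    proof -
      have "n \<le> d + r * w" using lw unfolding d_def by linarith
      then show ?thesis by (metis diff_le_eq of_nat_add of_nat_le_iff of_nat_mult)
    qed
    have "real (n choose w) * exp (- real (l * w) * real w / real d) \<le> real ((n - l * w) choose w)"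
      unfolding d_def by (rule choose_shrink_top_lower[OF fit])
    moreover have "real (l * w) * real w / real d \<le> (1 + \<epsilon>) * \<mu> * real l"
    proof -
      have np: "0 < real n" using n_pos by simp
      define u where "u = real r * real w / real n"
      have "2 * u \<le> \<epsilon>" using assms(1) by (simp add: u_def mult.assoc)
      moreover from this have "u \<le> 1 / 2" using assms(2) by linarith
      moreover have "0 \<le> u" by (simp add: u_def)
      ultimately have u: "0 \<le> u" "u \<le> 1 / 2" "2 * u \<le> \<epsilon>" by auto
      have nd: "real n * (1 - u) \<le> real d" using d np by (simp add: u_def right_diff_distrib)
      have pos: "0 < real n * (1 - u)" using np u by simp
      have "real (l * w) * real w / real d \<le> real (l * w) * real w / (real n * (1 - u))"
      proof (rule divide_left_mono[OF nd])
        have "0 < real d" using pos nd by linarith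
        then show "0 < real d * (real n * (1 - u))" using pos by (rule mult_pos_pos)
      qed simp
      also have "\<dots> = real l * \<mu> * (1 / (1 - u))" by (simp add: \<mu>_def power2_eq_square)
      also have "\<dots> \<le> real l * \<mu> * (1 + \<epsilon>)"
      proof (intro mult_left_mono)
        have "0 \<le> u * (1 - 2 * u)" using u by (intro mult_nonneg_nonneg) auto
        then have "1 \<le> (1 + 2 * u) * (1 - u)" by (simp add: algebra_simps)
        then have "1 / (1 - u) \<le> 1 + 2 * u" using u by (simp add: divide_le_eq)
        then show "1 / (1 - u) \<le> 1 + \<epsilon>" using u by linarith
      qed (simp add: \<mu>_def)
      finally show ?thesis by (simp add: algebra_simps)
    qed
    then have "real (n choose w) * exp (- ((1 + \<epsilon>) * \<mu>) * real l) \<le> real (n choose w) * exp (- real (l * w) * real w / real d)"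
      by (intro mult_left_mono) auto
    ultimately show ?thesis by (simp add: e_def card_uniform_subsets[OF finite_U])
  qed
  have "N ^ (r - 1) * exp (- ((1 + \<epsilon>) * \<mu> * (real (r - 1) * real r / 2)))
      = (\<Prod>l\<in>{0<..<r}. N * exp (- ((1 + \<epsilon>) * \<mu>) * real l))"
  proof -
    have "(\<Sum>l\<in>{0<..<r}. real l) = real (r - 1) * real r / 2" using sum_between[of 0] r_ge_3 by simp
    then have "- ((1 + \<epsilon>) * \<mu> * (real (r - 1) * real r / 2)) = (\<Sum>l\<in>{0<..<r}. - ((1 + \<epsilon>) * \<mu>) * real l)"
      by (simp only: sum_distrib_left[symmetric] minus_mult_left)
    then show ?thesis by (simp add: prod.distrib exp_sum)
  qed
  also have "\<dots> \<le> (\<Prod>l\<in>{0<..<r}. real (e l 0))"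
    using each by (intro prod_mono) auto
  also have "\<dots> = fact (r - 1) * ext 0 0" by (simp add: ext_def)
  also have "ext 0 0 \<le> Dg"
  proof -
    have "(\<Sum>s\<in>{0}. real (w choose s) * ext 0 s) \<le> Dg"
      unfolding Dg_def using ext_nonneg by (intro sum_mono2) auto
    then show ?thesis by simp
  qed
  finally show ?thesis by (simp add: \<mu>_def)
qed

end

section \<open>Choice of the parameters\<close>

text \<open>\<open>\<delta>\<^sub>0\<close> fixes
  \<open>x = exp (\<delta>\<^sub>0 r * \<mu>)\<close>; it has order \<open>1 / r\<close> because
  \<open>x ^ (4 * r + 9)\<close> must stay below \<open>exp (lam / 2)\<close>.
  \<open>\<eta>\<^sub>0\<close> is the ratio of \<kappa> to \<open>w\<close>, so small that
  \<open>lam\<close> falls short of \<mu> by a relative error of at most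
  \<open>1 / (250 * r ^ 2)\<close>. \<open>c\<^sub>0\<close> ensures
  \<open>cK * 2 ^ r * L \<le> \<delta>\<^sub>0 r * \<mu>\<close>; half of its \<open>4 ^ r\<close>,
  in the exponent, pays for rounding up the number of steps.\<close>

definition "\<delta>\<^sub>0 r = 1 / (100 * real r)"
definition "\<eta>\<^sub>0 r = 1 / (1000 * real r ^ 3)"
definition "c\<^sub>0 r = \<delta>\<^sub>0 r / ((22 + 7 * real r) * 4 ^ r)"

lemma powr_inverse_power:
  fixes a :: real
  assumes "0 < a" "0 < m"
  shows "(a powr (1 / real m)) ^ m = a" "(a powr (- 1 / real m)) ^ m = 1 / a"
proof -
  have "(a powr y) ^ m = a powr (y * real m)" for y
    using assms by (simp add: powr_powr powr_realpow[symmetric])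
  from this[of "1 / real m"] this[of "- 1 / real m"]
  show "(a powr (1 / real m)) ^ m = a" "(a powr (- 1 / real m)) ^ m = 1 / a"
    using assms by (simp_all only:) (simp_all add: powr_minus_divide)
qed

lemma size_bound:
  fixes r n w :: nat and \<mu> x :: real
  assumes r: "3 \<le> r"
    and \<mu>: "\<mu> = (real w)\<^sup>2 / real n" and x: "x = exp (\<delta>\<^sub>0 r * \<mu>)"
    and sparse: "real w \<le> real n / (400 * real r ^ 3)"
    and small: "2 * real w / real n \<le> exp (- 2 * real (r + 2) / \<eta>\<^sub>0 r)"
    and w: "2 \<le> \<eta>\<^sub>0 r * real w"
    and x_large: "8 \<le> x" "4 * real r \<le> x" "2 ^ r \<le> x" "fact (r - 1) \<le> exp (\<delta>\<^sub>0 r * \<mu> / 2)"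
    and c\<mu>: "1 \<le> c\<^sub>0 r * \<mu>"
  shows "measure_pmf.prob (sunflower_free_process r {..<n} w)
      {H. c\<^sub>0 r powr (1 / (real r - 1)) * \<mu> powr (1 / (real r - 1)) * real (n choose w)
        * sunflower_degree r n w powr (- 1 / (real r - 1)) \<le> real (card H)}
    \<ge> 1 - (2 / x ^ 7 + 5 * real r * 2 ^ ((n + 1) * r) * exp (- x))"
proof -
  define \<delta> where "\<delta> = \<delta>\<^sub>0 r"
  define \<eta> where "\<eta> = \<eta>\<^sub>0 r"
  define \<kappa> where "\<kappa> = nat \<lfloor>\<eta> * real w\<rfloor>"
  have r3: "3 \<le> real r" using r by simp
  have r2: "9 \<le> real r ^ 2" using power_mono[of 3 "real r" 2] r3 by simp
  have \<eta>: "0 < \<eta>" "4 * real r * \<eta> = 1 / (250 * real r ^ 2)"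
    using r by (auto simp: \<eta>_def \<eta>\<^sub>0_def field_simps eval_nat_numeral)
  have \<delta>: "0 < \<delta>" "\<delta> * real r = 1 / 100" using r by (auto simp: \<delta>_def \<delta>\<^sub>0_def)
  have w0: "0 < real w" using w \<eta> by (auto simp: \<eta>_def[symmetric] intro: ccontr)
  have n0: "0 < real n"
  proof (rule ccontr)
    assume "\<not> 0 < real n"
    then have "real w \<le> 0" using sparse by simp
    then show False using w0 by simp
  qed
  have \<kappa>: "real \<kappa> \<le> \<eta> * real w" "\<eta> * real w / 2 \<le> real \<kappa>" "1 \<le> \<kappa>"
  proof -
    have "real \<kappa> = of_int \<lfloor>\<eta> * real w\<rfloor>" using \<eta> w by (simp add: \<kappa>_def)
    then show k: "real \<kappa> \<le> \<eta> * real w" "\<eta> * real w / 2 \<le> real \<kappa>" using w unfolding \<eta>_def by linarith+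
    have "0 < real \<kappa>" using k w unfolding \<eta>_def by linarith
    then show "1 \<le> \<kappa>" by simp
  qed
  have small_\<eta>: "(2 * real r + 6) * \<eta> \<le> 1 / (250 * real r ^ 2)"
  proof -
    have "(2 * real r + 6) * \<eta> \<le> (4 * real r) * \<eta>" using r3 \<eta> by (intro mult_right_mono) auto
    then show ?thesis using \<eta> by simp
  qed
  have inv_r2: "1 / (250 * real r ^ 2) \<le> 1 / 10" "0 < 1 / (250 * real r ^ 2)"
    using r2 r3 by (auto simp: field_simps)
  have \<kappa>w: "2 * (r + 1) * \<kappa> \<le> w"
  proof -
    have "2 * (real r + 1) * real \<kappa> \<le> 2 * (real r + 1) * (\<eta> * real w)" using \<kappa> by (intro mult_left_mono) auto
    also have "\<dots> = (2 * (real r + 1) * \<eta>) * real w" by simp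
    also have "\<dots> \<le> 1 * real w"
    proof (intro mult_right_mono)
      have "2 * (real r + 1) * \<eta> \<le> (2 * real r + 6) * \<eta>" using \<eta> by (intro mult_right_mono) auto
      then show "2 * (real r + 1) * \<eta> \<le> 1" using small_\<eta> inv_r2 by linarith
    qed simp
    finally have "real (2 * (r + 1) * \<kappa>) \<le> real w" by (simp add: algebra_simps)
    then show ?thesis by (simp only: of_nat_le_iff)
  qed
  have rw: "2 * real r * real w / real n \<le> 1 / (200 * real r ^ 2)"
  proof -
    have "2 * real r * real w / real n \<le> 2 * real r * (real n / (400 * real r ^ 3)) / real n"
      using sparse n0 by (intro divide_right_mono mult_left_mono) auto
    also have "\<dots> = 1 / (200 * real r ^ 2)" using n0 r by (simp add: field_simps eval_nat_numeral)
    finally show ?thesis .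
  qed
  have inv_r2': "1 / (200 * real r ^ 2) \<le> 1" using r2 by (simp add: divide_le_eq)
  interpret uniform_family "{..<n}" r w \<kappa>
  proof
    show "2 * r * w \<le> card {..<n}"
    proof -
      have "2 * real r * real w / real n \<le> 1" using rw inv_r2' by linarith
      then have "2 * real r * real w \<le> real n" using n0 by (simp add: divide_le_eq)
      then have "real (2 * r * w) \<le> real n" by simp
      then show ?thesis by (simp only: of_nat_le_iff card_lessThan)
    qed
  qed (use r \<kappa> \<kappa>w in auto)
  have N: "card (uniform_subsets {..<n} w) = n choose w"
    by (simp add: card_uniform_subsets)
  define NN where "NN = real (n choose w)"
  have N0: "0 < NN" using N_pos by (simp add: NN_def N)
  define D where "D = Dg"
  have D0: "0 < D" using Dg_pos by (simp add: D_def)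
  define m where "m = r - 1"
  have m: "2 \<le> m" "real m = real r - 1" "0 < m" using r by (auto simp: m_def)
  have \<mu>0: "0 < \<mu>" using w0 n0 by (simp add: \<mu>)
  have \<mu>_le_w: "\<mu> \<le> real w"
  proof -
    have "real w \<le> real n" using n_ge by simp
    then have "real w * real w \<le> real n * real w" using w0 by (intro mult_right_mono) auto
    then show ?thesis using n0 by (simp add: \<mu> power2_eq_square divide_le_eq mult.commute)
  qed
  have lam_le: "lam \<le> \<mu>"
  proof -
    have "real (w - 4 * \<kappa>) * real (w - 2 * (r + 1) * \<kappa>) \<le> real w * real w" by (intro mult_mono) auto
    then show ?thesis using n0 by (simp add: lam_def \<mu> power2_eq_square divide_right_mono)
  qed
  have lam_ge: "(1 - 1 / (250 * real r ^ 2)) * \<mu> \<le> lam"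
  proof -
    define a where "a = 4 * \<eta>"
    define b where "b = 2 * (real r + 1) * \<eta>"
    have ab: "0 \<le> a" "0 \<le> b" "a + b \<le> 1 / (250 * real r ^ 2)"
      using \<eta> small_\<eta> by (auto simp: a_def b_def algebra_simps)
    have 1: "(1 - a) * real w \<le> real (w - 4 * \<kappa>)"
      using \<kappa>(1) w_ge by (simp add: of_nat_diff a_def algebra_simps)
    have 2: "(1 - b) * real w \<le> real (w - 2 * (r + 1) * \<kappa>)"
    proof -
      have "2 * (real r + 1) * real \<kappa> \<le> 2 * (real r + 1) * (\<eta> * real w)" using \<kappa> by (intro mult_left_mono) auto
      moreover have "real (w - 2 * (r + 1) * \<kappa>) = real w - 2 * (real r + 1) * real \<kappa>"
        using \<kappa>w by (simp add: of_nat_diff algebra_simps)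
      ultimately show ?thesis by (simp add: b_def algebra_simps)
    qed
    have "0 \<le> a * b" using ab by simp
    moreover have "(1 - a) * (1 - b) = 1 - (a + b) + a * b" by (simp add: algebra_simps)
    ultimately have "1 - 1 / (250 * real r ^ 2) \<le> (1 - a) * (1 - b)" using ab(3) by linarith
    then have "(1 - 1 / (250 * real r ^ 2)) * (real w * real w) \<le> ((1 - a) * (1 - b)) * (real w * real w)"
      by (intro mult_right_mono) auto
    also have "\<dots> = ((1 - a) * real w) * ((1 - b) * real w)" by simp
    also have "\<dots> \<le> real (w - 4 * \<kappa>) * real (w - 2 * (r + 1) * \<kappa>)"
    proof (intro mult_mono 1 2)
      have "b \<le> 1" using ab inv_r2(1) by linarith
      then show "0 \<le> (1 - b) * real w" by simp
    qed simp
    finally have "(1 - 1 / (250 * real r ^ 2)) * (real w * real w) / real n \<le> lam"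
      using n0 by (simp add: lam_def divide_right_mono)
    then show ?thesis by (simp add: \<mu> power2_eq_square)
  qed
  have lam9: "9 / 10 * \<mu> \<le> lam"
  proof -
    have "9 / 10 * \<mu> \<le> (1 - 1 / (250 * real r ^ 2)) * \<mu>" using inv_r2 \<mu>0 by (intro mult_right_mono) auto
    then show ?thesis using lam_ge by linarith
  qed
  have xp: "x ^ k = exp (real k * (\<delta> * \<mu>))" for k by (simp add: x \<delta>_def exp_of_nat_mult)
  have x1: "1 \<le> x" "0 < x" using x_large(1) by auto
  \<comment> \<open>The solution of \<open>D * (T0 / NN) ^ m = c\<^sub>0 r * \<mu>\<close>. Since
    \<open>T0 \<ge> 1\<close>, rounding up at most doubles it.\<close>
  define T0 where "T0 = (c\<^sub>0 r * \<mu>) powr (1 / real m) * NN * D powr (- 1 / real m)"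
  define T where "T = nat \<lceil>T0\<rceil>"
  have T0_pow: "T0 ^ m = c\<^sub>0 r * \<mu> * NN ^ m / D"
    unfolding T0_def power_mult_distrib using c\<mu> D0 m(3)
    by (simp only: powr_inverse_power) (simp add: powr_inverse_power)
  have T0_nonneg: "0 \<le> T0" using N0 by (simp add: T0_def)
  have T0_pow_ge: "exp (2 * lam) \<le> T0 ^ m"
  proof -
    have "D \<le> NN ^ m * exp (- 2 * lam)" using Dg_le by (simp add: D_def NN_def N m_def)
    then have "exp (2 * lam) * D \<le> NN ^ m" by (simp add: exp_minus field_simps)
    also have "\<dots> \<le> c\<^sub>0 r * \<mu> * NN ^ m" using c\<mu> N0 by simp
    finally show ?thesis unfolding T0_pow using D0 by (simp add: le_divide_eq)
  qed
  have T0_1: "1 \<le> T0"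
  proof -
    have "1 ^ m \<le> T0 ^ m" using T0_pow_ge lam_nonneg by (simp add: order_trans[OF _ T0_pow_ge])
    then show ?thesis using T0_nonneg m by (simp only: power_mono_iff zero_le_one)
  qed
  have T: "T0 \<le> real T" "real T \<le> 2 * T0" "1 \<le> T"
  proof -
    have "real T = of_int \<lceil>T0\<rceil>" using T0_1 by (simp add: T_def)
    then show t: "T0 \<le> real T" "real T \<le> 2 * T0" using T0_1 by linarith+
    then have "1 \<le> real T" using T0_1 by linarith
    then show "1 \<le> T" by simp
  qed
  define L where "L = D * (real T / NN) ^ m"
  have T_pow: "real T ^ m = L * NN ^ m / D" using D0 N0 by (simp add: L_def power_divide)
  have c\<^sub>0_eq: "(22 + 7 * real r) * 4 ^ r * (c\<^sub>0 r * \<mu>) = \<delta> * \<mu>"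
  proof -
    have "0 < (22 + 7 * real r) * 4 ^ r" by (intro mult_pos_pos) auto
    then show ?thesis by (simp add: c\<^sub>0_def \<delta>_def field_simps)
  qed
  have L1: "c\<^sub>0 r * \<mu> \<le> L" "1 \<le> L"
  proof -
    have "T0 ^ m \<le> real T ^ m" using T T0_nonneg by (intro power_mono) auto
    then have "c\<^sub>0 r * \<mu> * NN ^ m / D \<le> L * NN ^ m / D" by (simp only: T0_pow T_pow)
    then show "c\<^sub>0 r * \<mu> \<le> L" using D0 N0 by (simp add: divide_le_cancel)
    then show "1 \<le> L" using c\<mu> by linarith
  qed
  have L2: "(22 + 7 * real r) * 2 ^ r * L \<le> \<delta> * \<mu>"
  proof -
    have "real T ^ m \<le> (2 * T0) ^ m" using T by (intro power_mono) auto
    also have "\<dots> = 2 ^ m * T0 ^ m" by (simp add: power_mult_distrib)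
    also have "\<dots> \<le> 2 ^ r * T0 ^ m" using T0_nonneg by (intro mult_right_mono power_increasing) (auto simp: m_def)
    finally have "L * NN ^ m / D \<le> 2 ^ r * (c\<^sub>0 r * \<mu>) * NN ^ m / D" by (simp add: T0_pow T_pow)
    then have "L \<le> 2 ^ r * (c\<^sub>0 r * \<mu>)" using D0 N0 by (simp add: divide_le_cancel)
    then have "(22 + 7 * real r) * 2 ^ r * L \<le> (22 + 7 * real r) * 2 ^ r * (2 ^ r * (c\<^sub>0 r * \<mu>))"
      by (intro mult_left_mono) auto
    also have "\<dots> = (22 + 7 * real r) * (2 * 2) ^ r * (c\<^sub>0 r * \<mu>)" by (simp only: power_mult_distrib mult.assoc)
    also have "\<dots> = \<delta> * \<mu>" using c\<^sub>0_eq by simp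
    finally show ?thesis .
  qed
  have L3: "2 ^ r * L \<le> \<delta> * \<mu>" "L \<le> \<delta> * \<mu> / 2"
  proof -
    have "1 * (2 ^ r * L) \<le> (22 + 7 * real r) * (2 ^ r * L)" using L1 by (intro mult_right_mono) auto
    then show 1: "2 ^ r * L \<le> \<delta> * \<mu>" using L2 by (simp only: mult_1_left mult.assoc)
    have "2 ^ 1 * L \<le> 2 ^ r * L" using L1 r by (intro mult_right_mono power_increasing) auto
    then show "L \<le> \<delta> * \<mu> / 2" using 1 by simp
  qed
  have dm: "0 < \<delta> * \<mu>" using \<delta> \<mu>0 by simp
  have T_upper: "real T \<le> x * exp (real r * lam / 2)"
  proof -
    define \<epsilon> where "\<epsilon> = 1 / (200 * real r ^ 2)"
    define \<zeta> where "\<zeta> = 1 / (250 * real r ^ 2)"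
    have "2 * real r * real w / real (card {..<n}) \<le> \<epsilon>" using rw by (simp add: \<epsilon>_def)
    from Dg_ge[OF this] inv_r2'
    have "NN ^ m * exp (- ((1 + \<epsilon>) * \<mu> * (real m * real r / 2))) \<le> fact (r - 1) * D"
      by (simp add: NN_def N m_def D_def \<epsilon>_def \<mu>)
    then have "NN ^ m \<le> fact (r - 1) * D * exp ((1 + \<epsilon>) * \<mu> * (real m * real r / 2))"
      by (simp add: exp_minus field_simps)
    then have "NN ^ m / D \<le> fact (r - 1) * exp ((1 + \<epsilon>) * \<mu> * (real m * real r / 2))"
      using D0 by (simp add: divide_le_eq mult.commute mult.left_commute)
    then have "L * (NN ^ m / D) \<le> L * (fact (r - 1) * exp ((1 + \<epsilon>) * \<mu> * (real m * real r / 2)))"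
      using L1 by (intro mult_left_mono) auto
    also have "\<dots> = (L * fact (r - 1)) * exp ((1 + \<epsilon>) * \<mu> * (real m * real r / 2))" by simp
    also have "\<dots> \<le> x * exp ((1 + \<epsilon>) * \<mu> * (real m * real r / 2))"
    proof (rule mult_right_mono)
      have "L \<le> exp (\<delta> * \<mu> / 2)" using L3 exp_ge_add_one_self[of "\<delta> * \<mu> / 2"] by linarith
      then have "L * fact (r - 1) \<le> exp (\<delta> * \<mu> / 2) * exp (\<delta> * \<mu> / 2)"
        using x_large(4) L1 by (intro mult_mono) (auto simp: \<delta>_def)
      then show "L * fact (r - 1) \<le> x" by (simp add: mult_exp_exp x \<delta>_def mult.commute)
    qed simp
    also have "\<dots> \<le> (x * exp (real r * lam / 2)) ^ m"
    proof -
      \<comment> \<open>\<epsilon> comes from \<open>Dg_ge\<close> and \<zeta> from the gap between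
        \<open>lam\<close> and \<mu>. One factor of \<open>x ^ m\<close> is already spent on
        \<open>L * fact (r - 1)\<close>; as \<open>m \<ge> 2\<close>, the other \<open>m - 1\<close>
        are at least half of them.\<close>
      have "(\<epsilon> + \<zeta>) * (real m * real r / 2) \<le> (real m - 1) * \<delta>"
      proof -
        have "(\<epsilon> + \<zeta>) * (real m * real r / 2) = real m * (9 / 2000 / real r)"
          using r by (simp add: \<epsilon>_def \<zeta>_def field_simps eval_nat_numeral)
        also have "\<dots> \<le> real m * (\<delta> / 2)"
          using r by (intro mult_left_mono) (auto simp: \<delta>_def \<delta>\<^sub>0_def field_simps)
        also have "\<dots> \<le> (real m - 1) * \<delta>" using m \<delta> by (simp add: field_simps)
        finally show ?thesis .
      qed
      then have 1: "((\<epsilon> + \<zeta>) * (real m * real r / 2)) * \<mu> \<le> ((real m - 1) * \<delta>) * \<mu>"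
        using \<mu>0 by (intro mult_right_mono) auto
      have 2: "(real m * real r / 2) * ((1 - \<zeta>) * \<mu>) \<le> (real m * real r / 2) * lam"
        using lam_ge by (intro mult_left_mono) (auto simp: \<zeta>_def)
      define G where "G = real m * real r / 2"
      have "\<epsilon> * (G * \<mu>) + \<zeta> * (G * \<mu>) \<le> real m * (\<delta> * \<mu>) - \<delta> * \<mu>"
        using 1 unfolding G_def[symmetric] by (simp add: algebra_simps)
      moreover have "G * \<mu> - \<zeta> * (G * \<mu>) \<le> G * lam"
        using 2 unfolding G_def[symmetric] by (simp add: algebra_simps)
      moreover have "(1 + \<epsilon>) * \<mu> * (real m * real r / 2) = G * \<mu> + \<epsilon> * (G * \<mu>)"
        unfolding G_def[symmetric] by (simp add: algebra_simps)
      moreover have "real m * (real r * lam / 2) = G * lam" by (simp add: G_def)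
      ultimately have "\<delta> * \<mu> + (1 + \<epsilon>) * \<mu> * (real m * real r / 2) \<le> real m * (\<delta> * \<mu>) + real m * (real r * lam / 2)"
        by linarith
      then have "exp (\<delta> * \<mu> + (1 + \<epsilon>) * \<mu> * (real m * real r / 2)) \<le> exp (real m * (\<delta> * \<mu>) + real m * (real r * lam / 2))"
        by simp
      then show ?thesis
        by (simp add: exp_add power_mult_distrib xp exp_of_nat_mult[symmetric] x \<delta>_def)
    qed
    finally have "real T ^ m \<le> (x * exp (real r * lam / 2)) ^ m" by (simp add: T_pow)
    then show ?thesis using x1 m by (simp add: power_mono_iff)
  qed
  interpret process_params "{..<n}" r w \<kappa> x T
  proof
    have Leq: "Dg * (real T / real (card (uniform_subsets {..<n} w))) ^ (r - 1) = L"
      by (simp add: L_def D_def NN_def N m_def)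
    show "8 \<le> x" "4 * real r \<le> x" "1 \<le> T" "real T \<le> x * exp (real r * lam / 2)" by fact+
    show "1 \<le> Dg * (real T / real (card (uniform_subsets {..<n} w))) ^ (r - 1)" unfolding Leq by fact
    show "exp ((22 + 7 * real r) * 2 ^ r * (Dg * (real T / real (card (uniform_subsets {..<n} w))) ^ (r - 1))) \<le> x"
      unfolding Leq x using L2 by (simp add: \<delta>_def)
    show "(1 + \<omega>\<^sup>2) ^ w \<le> x"
    proof -
      have "(1 + \<omega>\<^sup>2) ^ w \<le> exp (\<omega>\<^sup>2) ^ w" by (intro power_mono exp_ge_add_one_self) auto
      also have "\<dots> = exp (real w * \<omega>\<^sup>2)" by (simp add: exp_of_nat_mult)
      also have "real w * \<omega>\<^sup>2 = (4 * real w / real n) * \<mu>" by (simp add: \<omega>_def \<mu> power2_eq_square)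
      also have "\<dots> \<le> \<delta> * \<mu>"
      proof (intro mult_right_mono)
        have "4 * real w / real n \<le> 4 * (real n / (400 * real r ^ 3)) / real n"
          using sparse n0 by (intro divide_right_mono mult_left_mono) auto
        also have "\<dots> = 1 / (100 * real r ^ 3)" using n0 by simp
        also have "\<dots> \<le> 1 / (100 * real r)"
          using power_increasing[of 1 3 "real r"] r by (intro divide_left_mono) auto
        finally show "4 * real w / real n \<le> \<delta>" by (simp add: \<delta>_def \<delta>\<^sub>0_def)
      qed (use \<mu>0 in simp)
      finally show ?thesis by (simp add: x \<delta>_def)
    qed
    show "2 ^ r * (Dg * (real T / real (card (uniform_subsets {..<n} w))) ^ (r - 1)) / real T * x ^ 8 \<le> 1"
    proof -
      have "1 + \<delta> * \<mu> \<le> x" unfolding x \<delta>_def by (rule exp_ge_add_one_self)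
      then have "2 ^ r * L \<le> x" using L3 by linarith
      then have "2 ^ r * L * x ^ 8 \<le> x * x ^ 8" using x1 by (intro mult_right_mono) auto
      also have "\<dots> = x ^ 9" by (simp add: eval_nat_numeral)
      also have "\<dots> \<le> T0"
      proof -
        have "(x ^ 9) ^ m = exp (9 * (\<delta> * real m) * \<mu>)" by (simp add: xp exp_of_nat_mult[symmetric] algebra_simps)
        also have "\<dots> \<le> exp (2 * lam)"
        proof -
          have "\<delta> * real m \<le> \<delta> * real r" using \<delta> m by (intro mult_left_mono) auto
          then have "9 * (\<delta> * real m) \<le> 9 / 100" using \<delta> by linarith
          then have "9 * (\<delta> * real m) * \<mu> \<le> 9 / 100 * \<mu>" using \<mu>0 by (intro mult_right_mono) auto
          then have "9 * (\<delta> * real m) * \<mu> \<le> 2 * lam" using lam9 \<mu>0 by linarith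
          then show ?thesis by simp
        qed
        also have "\<dots> \<le> T0 ^ m" by (rule T0_pow_ge)
        finally show ?thesis using T0_nonneg x1 m by (simp add: power_mono_iff)
      qed
      also have "\<dots> \<le> real T" by fact
      finally show ?thesis unfolding Leq using T(3) by (simp add: divide_le_eq)
    qed
    show "loss (x ^ 4) * x ^ 8 \<le> 1"
    proof -
      have "loss (x ^ 4) * x ^ 8 = 2 ^ r * x ^ (4 * r + 8) * exp (- lam / 2)"
        by (simp add: loss_def power_mult[symmetric] power_add)
      also have "\<dots> \<le> x * x ^ (4 * r + 8) * exp (- lam / 2)"
        using x_large(3) x1 by (intro mult_right_mono) auto
      also have "\<dots> = x ^ (4 * r + 9) * exp (- lam / 2)" by (simp add: power_add eval_nat_numeral)
      also have "\<dots> = exp ((real (4 * r + 9) * \<delta>) * \<mu> - lam / 2)" by (simp only: xp mult_exp_exp) (simp add: algebra_simps)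
      also have "\<dots> \<le> 1"
      proof -
        have "real (4 * r + 9) * \<delta> \<le> (7 * real r) * \<delta>" using r \<delta> by (intro mult_right_mono) auto
        moreover have "(7 * real r) * \<delta> = 7 * (\<delta> * real r)" by simp
        ultimately have "real (4 * r + 9) * \<delta> \<le> 7 / 100" using \<delta>(2) by linarith
        then have "(real (4 * r + 9) * \<delta>) * \<mu> \<le> 7 / 100 * \<mu>" using \<mu>0 by (intro mult_right_mono) auto
        then have "(real (4 * r + 9) * \<delta>) * \<mu> - lam / 2 \<le> 0" using lam9 \<mu>0 by linarith
        then show ?thesis by simp
      qed
      finally show ?thesis .
    qed
    show "\<nu> * (real T)\<^sup>2 * x ^ 8 \<le> 1"
    proof -
      \<comment> \<open>Since \<open>\<kappa> \<ge> \<eta> * w / 2\<close>, the smallness of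
        \<open>w / n\<close> gives \<open>\<omega> ^ \<kappa> \<le> exp (- (r + 2) * w)\<close>.
        This beats \<open>2 ^ w\<close> and, because \<open>\<mu> \<le> w\<close>, also
        \<open>T ^ 2 * x ^ 8 \<le> x ^ 10 * exp (r * \<mu>)\<close>.\<close>
      have "\<omega> \<le> exp (- 2 * real (r + 2) / \<eta>)" using small by (simp add: \<omega>_def \<eta>_def)
      then have "\<omega> ^ \<kappa> \<le> exp (- 2 * real (r + 2) / \<eta>) ^ \<kappa>" using \<omega>_bounds by (intro power_mono) auto
      also have "\<dots> = exp (- (2 * real (r + 2) / \<eta> * real \<kappa>))"
        using \<eta>(1) by (simp add: exp_of_nat_mult[symmetric] field_simps)
      also have "\<dots> \<le> exp (- (real (r + 2) * real w))"
      proof -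
        have "2 * real (r + 2) / \<eta> * (\<eta> * real w / 2) \<le> 2 * real (r + 2) / \<eta> * real \<kappa>"
          using \<kappa> \<eta> by (intro mult_left_mono) auto
        moreover have "2 * real (r + 2) / \<eta> * (\<eta> * real w / 2) = real (r + 2) * real w"
          using \<eta>(1) by simp
        ultimately show ?thesis by (simp only: exp_le_cancel_iff neg_le_iff_le)
      qed
      finally have om: "\<omega> ^ \<kappa> \<le> exp (- (real (r + 2) * real w))" .
      have "(2 :: real) ^ w \<le> exp 1 ^ w" using exp_ge_add_one_self[of 1] by (intro power_mono) auto
      also have "\<dots> = exp (real w)" by (simp add: exp_of_nat_mult[symmetric])
      finally have "\<nu> \<le> exp (real w) * exp (- (real (r + 2) * real w))"
        unfolding \<nu>_def using om \<omega>_bounds by (intro mult_mono) auto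
      also have "\<dots> = exp (- (real (r + 1) * real w))" by (simp add: mult_exp_exp algebra_simps)
      also have "\<dots> \<le> exp (- (real (r + 1) * \<mu>))" using \<mu>_le_w by simp
      finally have nu: "\<nu> \<le> exp (- (real (r + 1) * \<mu>))" .
      have "(real T)\<^sup>2 \<le> (x * exp (real r * lam / 2))\<^sup>2" using T_upper by (intro power_mono) auto
      also have "\<dots> = x ^ 2 * exp (real r * lam)" by (simp add: power_mult_distrib exp_of_nat_mult[symmetric])
      also have "\<dots> \<le> x ^ 2 * exp (real r * \<mu>)" using lam_le x1 by (intro mult_left_mono) (auto intro: mult_left_mono)
      finally have "(real T)\<^sup>2 * x ^ 8 \<le> x ^ 2 * exp (real r * \<mu>) * x ^ 8" using x1 by (intro mult_right_mono) auto
      also have "\<dots> = x ^ 10 * exp (real r * \<mu>)" by (simp add: eval_nat_numeral)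
      also have "\<dots> = exp ((10 * \<delta>) * \<mu> + real r * \<mu>)" by (simp add: xp mult_exp_exp)
      also have "\<dots> \<le> exp (real (r + 1) * \<mu>)"
      proof -
        have "10 * \<delta> \<le> 1" using r by (simp add: \<delta>_def \<delta>\<^sub>0_def field_simps)
        then have "(10 * \<delta>) * \<mu> \<le> 1 * \<mu>" using \<mu>0 by (intro mult_right_mono) auto
        then show ?thesis by (simp add: algebra_simps)
      qed
      finally have "\<nu> * ((real T)\<^sup>2 * x ^ 8) \<le> exp (- (real (r + 1) * \<mu>)) * exp (real (r + 1) * \<mu>)"
        using nu \<nu>_pos by (intro mult_mono) auto
      also have "\<dots> = 1" by (simp add: mult_exp_exp)
      finally show ?thesis by (simp add: mult.assoc)
    qed
  qed
  have deg: "sunflower_degree r n w powr (- 1 / real m) \<le> D powr (- 1 / real m)"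
    using Dg_le_degree D0 by (intro powr_mono2') (auto simp: D_def)
  have target: "c\<^sub>0 r powr (1 / (real r - 1)) * \<mu> powr (1 / (real r - 1)) * real (n choose w)
        * sunflower_degree r n w powr (- 1 / (real r - 1)) \<le> T0"
  proof -
    have "c\<^sub>0 r powr (1 / real m) * \<mu> powr (1 / real m) * NN * sunflower_degree r n w powr (- 1 / real m)
        \<le> c\<^sub>0 r powr (1 / real m) * \<mu> powr (1 / real m) * NN * D powr (- 1 / real m)"
      using deg N0 by (intro mult_left_mono) auto
    then show ?thesis by (simp add: T0_def NN_def m(2) powr_mult)
  qed
  have "measure_pmf.prob (sunflower_free_process r {..<n} w) {H. T \<le> card H}
      \<le> measure_pmf.prob (sunflower_free_process r {..<n} w)
      {H. c\<^sub>0 r powr (1 / (real r - 1)) * \<mu> powr (1 / (real r - 1)) * real (n choose w)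
        * sunflower_degree r n w powr (- 1 / (real r - 1)) \<le> real (card H)}"
  proof (rule measure_pmf.finite_measure_mono)
    have "T0 \<le> real (card H)" if "T \<le> card H" for H :: "nat set set"
      using T(1) that by linarith
    then show "{H. T \<le> card H} \<subseteq> {H :: nat set set. c\<^sub>0 r powr (1 / (real r - 1)) * \<mu> powr (1 / (real r - 1)) * real (n choose w)
        * sunflower_degree r n w powr (- 1 / (real r - 1)) \<le> real (card H)}"
      using target by (auto intro: order_trans)
  qed simp
  then show ?thesis using process_size by simp
qed

text \<open>\<open>\<alpha> < 1\<close> makes \<open>w / n\<close> tend to 0.
  \<open>\<alpha> > 1 / 2\<close> makes \<mu>, which is of order
  \<open>n powr (2 * \<alpha> - 1)\<close>, a positive power of \<open>n\<close>, so that
  \<open>x\<close> outgrows \<open>n ^ 2\<close>.\<close>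

lemma powr_facts:
  fixes \<alpha> B :: real
  assumes "1 / 2 < \<alpha>" "\<alpha> < 1"
  shows "0 < B \<Longrightarrow> eventually (\<lambda>n. 2 * real n powr (\<alpha> - 1) \<le> B) sequentially"
    and "eventually (\<lambda>n. B \<le> real n powr (2 * \<alpha> - 1)) sequentially"
    and "eventually (\<lambda>n. B \<le> real n powr \<alpha>) sequentially"
    and "0 < B \<Longrightarrow> eventually (\<lambda>n. (real n)\<^sup>2 \<le> exp (B * real n powr (2 * \<alpha> - 1))) sequentially"
proof -
  have lim: "((\<lambda>n. 2 * real n powr (\<alpha> - 1)) \<longlongrightarrow> 0) sequentially" using assms by real_asymp
  show "eventually (\<lambda>n. 2 * real n powr (\<alpha> - 1) \<le> B) sequentially" if "0 < B"
    using order_tendstoD(2)[OF lim that] by (rule eventually_mono) (rule less_imp_le)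
  have "filterlim (\<lambda>n. real n powr (2 * \<alpha> - 1)) at_top sequentially" using assms by real_asymp
  then show "eventually (\<lambda>n. B \<le> real n powr (2 * \<alpha> - 1)) sequentially" by (simp add: filterlim_at_top)
  have "filterlim (\<lambda>n. real n powr \<alpha>) at_top sequentially" using assms by real_asymp
  then show "eventually (\<lambda>n. B \<le> real n powr \<alpha>) sequentially" by (simp add: filterlim_at_top)
  show "eventually (\<lambda>n. (real n)\<^sup>2 \<le> exp (B * real n powr (2 * \<alpha> - 1))) sequentially" if "0 < B"
    using assms that by real_asymp
qed

theorem theorem1p12:
  fixes r :: nat and \<alpha> :: real
  assumes "r \<ge> 3" and "1/2 < \<alpha>" and "\<alpha> < 1"
  shows "\<exists>c>0. \<forall>w :: nat \<Rightarrow> nat. (\<forall>n. \<bar>real (w n) - real n powr \<alpha>\<bar> < 1) \<longrightarrow>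
    (\<lambda>n. measure_pmf.prob (sunflower_free_process r {..<n} (w n))
       {H. H \<subseteq> uniform_subsets {..<n} (w n) \<and> sunflower_free r H \<and>
           real (card H) \<ge> c * ((real (w n))\<^sup>2 / real n) powr (1 / (real r - 1))
              * real (n choose w n) * sunflower_degree r n (w n) powr (- 1 / (real r - 1))})
      \<longlonglongrightarrow> 1"
proof (intro exI[of _ "c\<^sub>0 r powr (1 / (real r - 1))"] conjI allI impI)
  have c: "0 < c\<^sub>0 r" "0 < \<delta>\<^sub>0 r" "0 < \<eta>\<^sub>0 r"
    using assms by (auto simp: c\<^sub>0_def \<delta>\<^sub>0_def \<eta>\<^sub>0_def intro!: divide_pos_pos mult_pos_pos)
  then show "0 < c\<^sub>0 r powr (1 / (real r - 1))" by simp
  fix w :: "nat \<Rightarrow> nat" assume w: "\<forall>n. \<bar>real (w n) - real n powr \<alpha>\<bar> < 1"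
  define \<mu> where "\<mu> n = (real (w n))\<^sup>2 / real n" for n
  define P where "P n = measure_pmf.prob (sunflower_free_process r {..<n} (w n))
       {H. H \<subseteq> uniform_subsets {..<n} (w n) \<and> sunflower_free r H \<and>
           real (card H) \<ge> c\<^sub>0 r powr (1 / (real r - 1)) * ((real (w n))\<^sup>2 / real n) powr (1 / (real r - 1))
              * real (n choose w n) * sunflower_degree r n (w n) powr (- 1 / (real r - 1))}" for n
  \<comment> \<open>The failure bound of \<open>size_bound\<close> with \<open>x\<close> and
    \<open>x ^ 7\<close> replaced by their lower bound \<open>n ^ 2\<close> and the base 2 replaced
    by \<open>exp 1\<close>.\<close>
  define g where "g n = 2 / (real n)\<^sup>2 + 5 * real r * exp (real ((n + 1) * r) - (real n)\<^sup>2)" for n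
  note pf = powr_facts[OF assms(2,3)]
  have "eventually (\<lambda>n. 1 - g n \<le> P n) sequentially"
  proof -
    \<comment> \<open>The factorial is squared because \<open>size_bound\<close> compares it with
      \<open>exp (\<delta>\<^sub>0 r * \<mu> / 2)\<close>, the square root of
      \<open>x\<close>.\<close>
    define M where "M = Max {8, 4 * real r, 2 ^ r, (fact (r - 1))\<^sup>2}"
    have M: "8 \<le> M" "4 * real r \<le> M" "2 ^ r \<le> M" "(fact (r - 1))\<^sup>2 \<le> M" by (auto simp: M_def)
    have ev1: "eventually (\<lambda>n. 2 * real n powr (\<alpha> - 1) \<le> 1 / (400 * real r ^ 3)) sequentially"
      using assms by (intro pf(1)) auto
    have ev2: "eventually (\<lambda>n. 2 * real n powr (\<alpha> - 1) \<le> exp (- 2 * real (r + 2) / \<eta>\<^sub>0 r) / 2) sequentially"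
      by (intro pf(1)) auto
    have ev3: "eventually (\<lambda>n. max (4 * ln M / \<delta>\<^sub>0 r) (4 / c\<^sub>0 r) \<le> real n powr (2 * \<alpha> - 1)) sequentially"
      by (rule pf(2))
    have ev4: "eventually (\<lambda>n. max 2 (4 / \<eta>\<^sub>0 r) \<le> real n powr \<alpha>) sequentially" by (rule pf(3))
    have ev5: "eventually (\<lambda>n. (real n)\<^sup>2 \<le> exp (\<delta>\<^sub>0 r / 4 * real n powr (2 * \<alpha> - 1))) sequentially"
      using c by (intro pf(4)) auto
    show ?thesis using ev1 ev2 ev3 ev4 ev5 eventually_gt_at_top[of 0]
    proof eventually_elim
      case (elim n)
      define x where "x = exp (\<delta>\<^sub>0 r * \<mu> n)"
      have n: "0 < real n" using elim by simp
      have wb: "real n powr \<alpha> / 2 \<le> real (w n)" "real (w n) \<le> 2 * real n powr \<alpha>"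
      proof -
        have "real n powr \<alpha> \<ge> 2" using elim by simp
        moreover have "\<bar>real (w n) - real n powr \<alpha>\<bar> < 1" using w by blast
        ultimately show "real n powr \<alpha> / 2 \<le> real (w n)" "real (w n) \<le> 2 * real n powr \<alpha>" by linarith+
      qed
      have wn: "real (w n) / real n \<le> 2 * real n powr (\<alpha> - 1)"
        using wb(2) n by (simp add: powr_diff divide_right_mono)
      have mu: "real n powr (2 * \<alpha> - 1) / 4 \<le> \<mu> n"
      proof -
        have "(real n powr \<alpha> / 2)\<^sup>2 \<le> (real (w n))\<^sup>2" using wb(1) by (intro power_mono) auto
        moreover have "(real n powr \<alpha>)\<^sup>2 = real n powr (2 * \<alpha>)"
          by (simp add: power2_eq_square powr_add[symmetric])
        ultimately have "real n powr (2 * \<alpha>) / 4 \<le> (real (w n))\<^sup>2" by (simp add: power_divide)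
        then have "real n powr (2 * \<alpha>) / 4 / real n \<le> \<mu> n" unfolding \<mu>_def using n by (intro divide_right_mono) auto
        then show ?thesis using n by (simp add: powr_diff)
      qed
      have Mx: "M \<le> exp (\<delta>\<^sub>0 r * \<mu> n)"
      proof -
        have "4 * ln M / \<delta>\<^sub>0 r \<le> 4 * \<mu> n" using elim(3) mu by simp
        then have "ln M \<le> \<delta>\<^sub>0 r * \<mu> n" using c by (simp add: field_simps)
        then have "exp (ln M) \<le> exp (\<delta>\<^sub>0 r * \<mu> n)" by simp
        then show ?thesis using M(1) by simp
      qed
      have nx: "(real n)\<^sup>2 \<le> x"
      proof -
        have "\<delta>\<^sub>0 r * (real n powr (2 * \<alpha> - 1) / 4) \<le> \<delta>\<^sub>0 r * \<mu> n" using mu c by (intro mult_left_mono) auto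
        then have "exp (\<delta>\<^sub>0 r / 4 * real n powr (2 * \<alpha> - 1)) \<le> x" by (simp add: x_def)
        then show ?thesis using elim(5) by linarith
      qed
      have "1 - (2 / x ^ 7 + 5 * real r * 2 ^ ((n + 1) * r) * exp (- x)) \<le>
        measure_pmf.prob (sunflower_free_process r {..<n} (w n))
        {H. c\<^sub>0 r powr (1 / (real r - 1)) * \<mu> n powr (1 / (real r - 1)) * real (n choose w n)
          * sunflower_degree r n (w n) powr (- 1 / (real r - 1)) \<le> real (card H)}"
      proof (rule size_bound[OF assms(1) \<mu>_def x_def])
        show "real (w n) \<le> real n / (400 * real r ^ 3)"
        proof -
          have "real (w n) / real n \<le> 1 / (400 * real r ^ 3)" using wn elim(1) by linarith
          then show ?thesis using n by (simp add: divide_le_eq)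
        qed
        show "2 * real (w n) / real n \<le> exp (- 2 * real (r + 2) / \<eta>\<^sub>0 r)" using wn elim(2) by simp
        show "2 \<le> \<eta>\<^sub>0 r * real (w n)"
        proof -
          have "4 / \<eta>\<^sub>0 r \<le> 2 * real (w n)" using elim(4) wb(1) by simp
          then show ?thesis using c by (simp add: field_simps)
        qed
        show "8 \<le> x" "4 * real r \<le> x" "2 ^ r \<le> x" using M Mx unfolding x_def by linarith+
        show "fact (r - 1) \<le> exp (\<delta>\<^sub>0 r * \<mu> n / 2)"
        proof (rule power2_le_imp_le)
          have "(exp (\<delta>\<^sub>0 r * \<mu> n / 2))\<^sup>2 = exp (\<delta>\<^sub>0 r * \<mu> n)" by (simp add: exp_double[symmetric])
          then show "(fact (r - 1))\<^sup>2 \<le> (exp (\<delta>\<^sub>0 r * \<mu> n / 2))\<^sup>2" using M(4) Mx by linarith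
        qed simp
        have "4 / c\<^sub>0 r \<le> 4 * \<mu> n" using elim(3) mu by simp
        then show "1 \<le> c\<^sub>0 r * \<mu> n" using c by (simp add: field_simps)
      qed
      also have "\<dots> \<le> P n"
        unfolding P_def \<mu>_def
      \<comment> \<open>Uniformity and sunflower-freeness hold on the whole support, so adding them
        to the event does not lower its probability.\<close>
      proof (rule measure_pmf.finite_measure_mono_AE)
        have r0: "r > 0" using assms(1) by simp
        show "AE H in measure_pmf (sunflower_free_process r {..<n} (w n)).
            H \<in> {H. c\<^sub>0 r powr (1 / (real r - 1)) * ((real (w n))\<^sup>2 / real n) powr (1 / (real r - 1)) * real (n choose w n)
              * sunflower_degree r n (w n) powr (- 1 / (real r - 1)) \<le> real (card H)} \<longrightarrow>
            H \<in> {H. H \<subseteq> uniform_subsets {..<n} (w n) \<and> sunflower_free r H \<and>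
              real (card H) \<ge> c\<^sub>0 r powr (1 / (real r - 1)) * ((real (w n))\<^sup>2 / real n) powr (1 / (real r - 1))
              * real (n choose w n) * sunflower_degree r n (w n) powr (- 1 / (real r - 1))}"
          using sunflower_free_process_uniform[OF finite_lessThan r0] sunflower_free_process_free[OF finite_lessThan r0]
          by (auto simp: AE_measure_pmf_iff)
      qed simp
      finally have "1 - (2 / x ^ 7 + 5 * real r * 2 ^ ((n + 1) * r) * exp (- x)) \<le> P n" .
      moreover have "2 / x ^ 7 + 5 * real r * 2 ^ ((n + 1) * r) * exp (- x) \<le> g n"
        unfolding g_def
      proof (rule add_mono)
        have x1: "1 \<le> x" using M Mx unfolding x_def by linarith
        have "(real n)\<^sup>2 \<le> x ^ 7" using nx power_increasing[of 1 7 x] x1 by simp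
        then show "2 / x ^ 7 \<le> 2 / (real n)\<^sup>2" using n x1 by (intro divide_left_mono) auto
        have "(2 :: real) ^ ((n + 1) * r) \<le> exp 1 ^ ((n + 1) * r)"
          using exp_ge_add_one_self[of 1] by (intro power_mono) auto
        then have "2 ^ ((n + 1) * r) * exp (- x) \<le> exp (real ((n + 1) * r)) * exp (- (real n)\<^sup>2)"
          using nx by (intro mult_mono) (auto simp: exp_of_nat_mult[symmetric])
        then have "5 * real r * (2 ^ ((n + 1) * r) * exp (- x)) \<le> 5 * real r * (exp (real ((n + 1) * r)) * exp (- (real n)\<^sup>2))"
          by (intro mult_left_mono) auto
        then show "5 * real r * 2 ^ ((n + 1) * r) * exp (- x) \<le> 5 * real r * exp (real ((n + 1) * r) - (real n)\<^sup>2)"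
          by (simp add: mult_exp_exp mult.assoc)
      qed
      ultimately show ?case by linarith
    qed
  qed
  moreover have "eventually (\<lambda>n. P n \<le> 1) sequentially" by (simp add: P_def)
  moreover have "(\<lambda>n. 1 - g n) \<longlonglongrightarrow> 1"
  proof -
    have "(\<lambda>n. 2 / (real n)\<^sup>2 + 5 * real r * exp ((real n + 1) * real r - (real n)\<^sup>2)) \<longlonglongrightarrow> 0"
      by real_asymp
    moreover have "g = (\<lambda>n. 2 / (real n)\<^sup>2 + 5 * real r * exp ((real n + 1) * real r - (real n)\<^sup>2))"
      by (simp add: g_def fun_eq_iff algebra_simps)
    ultimately have "g \<longlonglongrightarrow> 0" by simp
    from tendsto_diff[OF tendsto_const[of 1] this] show ?thesis by simp
  qed
  ultimately have "P \<longlonglongrightarrow> 1"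
    by (intro tendsto_sandwich[of "\<lambda>n. 1 - g n" P sequentially "\<lambda>_. 1" 1]) auto
  then show "(\<lambda>n. measure_pmf.prob (sunflower_free_process r {..<n} (w n))
       {H. H \<subseteq> uniform_subsets {..<n} (w n) \<and> sunflower_free r H \<and>
           real (card H) \<ge> c\<^sub>0 r powr (1 / (real r - 1)) * ((real (w n))\<^sup>2 / real n) powr (1 / (real r - 1))
              * real (n choose w n) * sunflower_degree r n (w n) powr (- 1 / (real r - 1))}) \<longlonglongrightarrow> 1"
    unfolding P_def .
qed

end
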